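(* Let $\mathbb{F}$ be a field and let $m$, $n$, $r\le\min\{m,n\}$ be positive integers. Let $\epsilon_1(s)\mid\dots\mid\epsilon_r(s)$ and $\psi_r(s)\mid\dots\mid\psi_1(s)$ be monic polynomials in $\mathbb{F}[s]$ such that $\frac{\epsilon_i(s)}{\psi_i(s)}$ are irreducible rational functions for $i=1,\dots,r$. Let $q_1\le\dots\le q_r$ be integers and let $K(s)\in\mathbb{F}[s]^{m\times r}$ and $L(s)^T\in\mathbb{F}[s]^{n\times r}$ be minimal bases with column degrees $k_1\ge\dots\ge k_r$ and $\ell_1\ge\dots\ge\ell_r$, respectively. Let $g_1\ge\dots\ge g_r$ be the decreasing reordering of $k_r+\ell_1,\,k_{r-1}+\ell_2,\dots,k_1+\ell_r$. (Necessity, arbitrary field.) If $R(s)\in\mathbb{F}(s)^{m\times n}$ is a rational matrix with $\operatorname{rank}(R(s))=r$, $\frac{\epsilon_1(s)}{\psi_1(s)},\dots,\frac{\epsilon_r(s)}{\psi_r(s)}$ as invariant rational functions, $q_1,\dots,q_r$ as invariant orders at $\infty$, $\mathcal{R}(R(s))=\mathcal{R}(K(s))$ and $\mathcal{R}(R(s)^T)=\mathcal{R}(L(s)^T)$, then $$(-g_r,\dots,-g_1)\prec(\deg(\epsilon_r)-\deg(\psi_r)+q_r,\dots,\deg(\epsilon_1)-\deg(\psi_1)+q_1).$$ (Sufficiency.) Conversely, if $\mathbb{F}$ is algebraically closed, this condition is sufficient for the existence of a rational matrix $R(s)\in\mathbb{F}(s)^{m\times n}$ with $\operatorname{rank}(R(s))=r$,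 $\frac{\epsilon_1(s)}{\psi_1(s)},\dots,\frac{\epsilon_r(s)}{\psi_r(s)}$ as invariant rational functions, $q_1,\dots,q_r$ as invariant orders at $\infty$, $\mathcal{R}(R(s))=\mathcal{R}(K(s))$ and $\mathcal{R}(R(s)^T)=\mathcal{R}(L(s)^T)$.
   Context: $\mathbb{F}[s]$ is the ring of polynomials and $\mathbb{F}(s)$ its field of fractions; a rational matrix is a matrix with entries in $\mathbb{F}(s)$, and its rank is its rank over $\mathbb{F}(s)$. Invariant rational functions: for $R(s)\in\mathbb{F}(s)^{m\times n}$ of rank $r$ there are unimodular matrices $U(s),V(s)$ (square polynomial matrices with polynomial inverse) such that $U(s)R(s)V(s)=\begin{bmatrix}\operatorname{diag}\left(\frac{\epsilon_1(s)}{\psi_1(s)},\dots,\frac{\epsilon_r(s)}{\psi_r(s)}\right)&0\\0&0\end{bmatrix}$ (Smith--McMillan form), with $\epsilon_1\mid\dots\mid\epsilon_r$ and $\psi_r\mid\dots\mid\psi_1$ monic polynomials and each $\epsilon_i/\psi_i$ irreducible (numerator and denominator coprime). These fractions are uniquely determined and are the (finite) invariant rational functions of $R(s)$. Invariant orders at infinity: a rational function is proper if the degree of its numerator is at most that of its denominator; a biproper matrix is an invertible square matrix of proper rational functions whose inverse also has proper entries. For $R(s)$ of rank $r$ there are biproper matrices $B_1(s),B_2(s)$ with $B_1(s)R(s)B_2(s)=\begin{bmatrix}\operatorname{diag}(s^{-q_1},\dots,s^{-q_r})&0\\0&0\end{bmatrix}$, where $q_1\le\dots\le q_r$ are uniquely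 determined integers, called the invariant orders at infinity of $R(s)$. For $P(s)\in\mathbb{F}(s)^{m\times n}$, $\mathcal{R}(P(s))\subseteq\mathbb{F}(s)^m$ is the $\mathbb{F}(s)$-subspace spanned by the columns of $P(s)$. A polynomial basis of a subspace $\mathcal{V}$ of $\mathbb{F}(s)^p$ is a basis consisting of polynomial vectors; its order is the sum of the degrees of its vectors (degree of a vector = maximum degree of its entries). A minimal basis of $\mathcal{V}$ is a polynomial basis of least order. A matrix $N(s)\in\mathbb{F}[s]^{m\times r}$ is called a minimal basis if its $r$ columns form a minimal basis of $\mathcal{R}(N(s))$; its column degrees are the degrees of its columns. For sequences of integers $a_1\ge\dots\ge a_r$ and $b_1\ge\dots\ge b_r$, $(a_1,\dots,a_r)\prec(b_1,\dots,b_r)$ (majorization) means $\sum_{i=1}^k a_i\le\sum_{i=1}^k b_i$ for $1\le k\le r-1$ and $\sum_{i=1}^r a_i=\sum_{i=1}^r b_i$. *)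

theory Defs
  imports
    "Jordan_Normal_Form.DL_Rank"
    "HOL-Computational_Algebra.Polynomial_Factorial"
begin

text \<open>
  The ring of polynomials over the field \<open>'a\<close> is \<open>'a poly\<close>, and its field of fractions is
  \<open>'a poly fract\<close>. Indices of lists, matrices and vectors start at 0, so the
  \<open>i\<close>-th entry of a sequence in the mathematical text is the entry \<open>i - 1\<close> of a list.
\<close>

abbreviation rat_mat :: "'a::field poly mat \<Rightarrow> 'a poly fract mat" where
  "rat_mat A \<equiv> map_mat to_fract A"

definition diag_block :: "nat \<Rightarrow> nat \<Rightarrow> 'b::zero list \<Rightarrow> 'b mat" where
  "diag_block m n ds = mat m n (\<lambda>(i, j). if i = j \<and> i < length ds then ds ! i else 0)"


section \<open>Invariant rational functions\<close>

text \<open>\<open>invertible_mat\<close> over \<open>'a poly\<close> asks for an inverse with polynomial entries.\<close>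

definition unimodular_mat :: "'a::field poly mat \<Rightarrow> bool" where
  "unimodular_mat U \<longleftrightarrow> invertible_mat U"

definition smith_mcmillan_seq :: "'a::field poly list \<Rightarrow> 'a poly list \<Rightarrow> bool" where
  "smith_mcmillan_seq eps psi \<longleftrightarrow>
     length eps = length psi \<and>
     (\<forall>i < length eps. lead_coeff (eps ! i) = 1 \<and> lead_coeff (psi ! i) = 1 \<and>
        coprime (eps ! i) (psi ! i)) \<and>
     (\<forall>i. Suc i < length eps \<longrightarrow>
        eps ! i dvd eps ! Suc i \<and> psi ! Suc i dvd psi ! i)"

definition invariant_rational_functions ::
    "'a::field poly fract mat \<Rightarrow> 'a poly list \<Rightarrow> 'a poly list \<Rightarrow> bool" where
  "invariant_rational_functions R eps psi \<longleftrightarrow>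
     length eps = vec_space.rank (dim_row R) R \<and>
     smith_mcmillan_seq eps psi \<and>
     (\<exists>U \<in> carrier_mat (dim_row R) (dim_row R). \<exists>V \<in> carrier_mat (dim_col R) (dim_col R).
        unimodular_mat U \<and> unimodular_mat V \<and>
        rat_mat U * R * rat_mat V =
          diag_block (dim_row R) (dim_col R)
            (map2 (\<lambda>e p. to_fract e / to_fract p) eps psi))"


section \<open>Invariant orders at infinity\<close>

text \<open>
  Whether a nonzero fraction satisfies the degree condition does not depend on the representation,
  and zero is proper because \<open>degree 0 = 0\<close>.
\<close>

definition proper_fract :: "'a::field poly fract \<Rightarrow> bool" where
  "proper_fract f \<longleftrightarrow>
     (\<exists>a b. b \<noteq> 0 \<and> f = to_fract a / to_fract b \<and> degree a \<le> degree b)"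

definition proper_mat :: "'a::field poly fract mat \<Rightarrow> bool" where
  "proper_mat A \<longleftrightarrow> (\<forall>i < dim_row A. \<forall>j < dim_col A. proper_fract (A $$ (i, j)))"

definition biproper_mat :: "'a::field poly fract mat \<Rightarrow> bool" where
  "biproper_mat B \<longleftrightarrow> square_mat B \<and> proper_mat B \<and>
     (\<exists>C. proper_mat C \<and> inverts_mat B C \<and> inverts_mat C B)"

text \<open>The polynomial \<open>[:0, 1:]\<close> is the indeterminate \<open>s\<close>.\<close>

definition invariant_orders_at_infinity :: "'a::field poly fract mat \<Rightarrow> int list \<Rightarrow> bool" where
  "invariant_orders_at_infinity R q \<longleftrightarrow>
     length q = vec_space.rank (dim_row R) R \<and>
     sorted q \<and>
     (\<exists>B1 \<in> carrier_mat (dim_row R) (dim_row R). \<exists>B2 \<in> carrier_mat (dim_col R) (dim_col R).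
        biproper_mat B1 \<and> biproper_mat B2 \<and>
        B1 * R * B2 =
          diag_block (dim_row R) (dim_col R)
            (map (\<lambda>i. (to_fract [:0, 1:] :: 'a poly fract) powi (- i)) q))"


section \<open>Minimal bases\<close>

abbreviation range_space :: "'a::field poly fract mat \<Rightarrow> 'a poly fract vec set" where
  "range_space P \<equiv> vec_space.col_space (dim_row P) P"

text \<open>
  Vectors are nonempty in all uses below; the zero vector gets degree 0, but it never belongs
  to a basis.
\<close>

definition vec_degree :: "'a::zero poly vec \<Rightarrow> nat" where
  "vec_degree v = Max ((\<lambda>i. degree (v $ i)) ` {..<dim_vec v})"

text \<open>
  \<open>W\<close> is a subspace of the space of \<open>p\<close>-vectors of rational functions, made into a vector space
  by restricting the carrier. A basis of it is a finite set, so the sums of degrees below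
  are meaningful.
\<close>

definition polynomial_basis ::
    "nat \<Rightarrow> 'a::field poly fract vec set \<Rightarrow> 'a poly vec set \<Rightarrow> bool" where
  "polynomial_basis p W B \<longleftrightarrow>
     B \<subseteq> carrier_vec p \<and>
     vectorspace.basis class_ring ((module_vec TYPE('a poly fract) p)\<lparr>carrier := W\<rparr>)
       (map_vec to_fract ` B)"

definition basis_order :: "'a::zero poly vec set \<Rightarrow> nat" where
  "basis_order B = (\<Sum>v\<in>B. vec_degree v)"

definition minimal_basis ::
    "nat \<Rightarrow> 'a::field poly fract vec set \<Rightarrow> 'a poly vec set \<Rightarrow> bool" where
  "minimal_basis p W B \<longleftrightarrow>
     polynomial_basis p W B \<and>
     (\<forall>B'. polynomial_basis p W B' \<longrightarrow> basis_order B \<le> basis_order B')"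

definition minimal_basis_mat :: "'a::field poly mat \<Rightarrow> bool" where
  "minimal_basis_mat N \<longleftrightarrow>
     distinct (cols N) \<and>
     minimal_basis (dim_row N) (range_space (rat_mat N)) (set (cols N))"

definition column_degrees :: "'a::zero poly mat \<Rightarrow> nat list" where
  "column_degrees N = map vec_degree (cols N)"


section \<open>Majorization\<close>

text \<open>Both arguments are meant to be in decreasing order already; no reordering takes place.\<close>

definition majorized :: "int list \<Rightarrow> int list \<Rightarrow> bool"  (infix "\<prec>\<^sub>m" 50) where
  "a \<prec>\<^sub>m b \<longleftrightarrow>
     length a = length b \<and>
     (\<forall>k \<in> {1..<length a}. sum_list (take k a) \<le> sum_list (take k b)) \<and>
     sum_list a = sum_list b"

end

theory Submission
  imports Defs
begin

text \<open>
  \<^bold>\<open>Reduction to an invertible square matrix.\<close>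
  Multiplication by a unimodular matrix turns a minimal basis \<open>K\<close> into \<open>[I; 0]\<close>, and after division of its
  \<open>j\<close>-th column by \<open>s\<close> to the power \<open>k\<^sub>j\<close> a biproper matrix does the same: if one of the two failed, then
  a combination of the columns would have too small a degree and could be exchanged for a column.
  The matrices \<open>R\<close> with the prescribed range spaces are the products \<open>K M L\<close> with \<open>M\<close> square and
  invertible (\<open>core_of_factorization\<close>, \<open>range_space_sandwich\<close>). Hence \<open>R\<close> has the invariant rational
  functions of \<open>M\<close>, and its orders at infinity are those of the matrix with the entries \<open>M\<^sub>i\<^sub>j\<close> times \<open>s\<close> to
  the power \<open>k\<^sub>i + l\<^sub>j\<close> (\<open>minimal_factorization_equivalent\<close>).

  \<^bold>\<open>Two rings.\<close>
  The finite structure is the equivalence class of a matrix over the ring of polynomials, the structure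
  at infinity its class over the ring of proper functions. Over both rings a pair of elements of
  the field can be reduced to a single one by an invertible matrix; the locale \<open>bezout_subring\<close> records
  this, and the matrix theory is developed once, over such a ring.

  \<^bold>\<open>Majorization.\<close>
  Put \<open>x\<^sub>i = deg \<epsilon>\<^sub>i - deg \<psi>\<^sub>i + q\<^sub>i\<close>, an increasing sequence, and let \<open>d\<^sub>j\<close> be minus the sum of \<open>l\<^sub>j\<close> and the
  \<open>j\<close>-th entry of \<open>k\<close> in reversed order. The majorization says that the sum of the first \<open>t\<close> numbers \<open>x\<^sub>i\<close>
  is at most the sum of the \<open>d\<^sub>j\<close> over any \<open>t\<close> indices, with equality for all indices
  (\<open>majorized_iff_dominates\<close>).

  \<^bold>\<open>Necessity\<close> (\<open>structure_dominates\<close>).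
  A minor of order \<open>t\<close> of \<open>M\<close> is a polynomial multiple of the product of the first \<open>t\<close> fractions, and the
  corresponding minor of the weighted matrix is a proper multiple of \<open>s\<close> to the power
  \<open>- (q\<^sub>1 + \<dots> + q\<^sub>t)\<close>. If the minor is nonzero, comparing degrees bounds \<open>x\<^sub>1 + \<dots> + x\<^sub>t\<close> by minus the sum of the
  weights \<open>k\<^sub>i\<close> of its rows and \<open>l\<^sub>j\<close> of its columns. It remains to find, for every index set, a nonzero
  minor of the same order whose weight is at least minus the sum of the \<open>d\<^sub>j\<close> over that set
  (\<open>heavy_nonzero_minor\<close>): elimination assigns to every row a pivot column, and among all assignments the one that
  pairs large with small weights has the smallest sums of \<open>t\<close> largest terms (\<open>antisorted_sum_le\<close>).

  \<^bold>\<open>Sufficiency\<close> (\<open>structure_realizable\<close>).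
  An upper triangular \<open>M\<close>, with its rows in the order of increasing \<open>k\<^sub>i\<close>, is built by induction on its size. The
  last diagonal degree \<open>d\<^sub>r\<close> lies between some \<open>x\<^sub>i\<close> and its successor; replacing these two by the single number
  \<open>x\<^sub>i + x\<^sub>i\<^sub>+\<^sub>1 - d\<^sub>r\<close> leaves a sequence that still majorizes the remaining \<open>d\<^sub>j\<close>, and because
  polynomials split into linear factors, there is a fraction \<open>c\<close> between the \<open>i\<close>-th fraction and its successor of the
  required degree (\<open>dominates_merge\<close>, \<open>polynomial_factor_of_degree\<close>). The matrix from the induction hypothesis is
  bordered by a column \<open>v\<close> and the diagonal entry \<open>\<alpha>\<close>, the product of the two fractions divided by \<open>c\<close>. Either ring
  prescribes \<open>v\<close> modulo multiples of \<open>\<alpha>\<close> (\<open>equivalent_border\<close>). Both conditions can be met at once because every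
  rational function is the sum of a polynomial and a proper function (\<open>fract_split_polynomial\<close>).
\<close>

section \<open>The degree of a rational function\<close>

text \<open>
  The representation of a fraction is not unique, so the degree is described by the value that all
  representations share. It is meaningful only for nonzero fractions.
\<close>

definition fdeg :: "'a::field poly fract \<Rightarrow> int" where
  "fdeg x = (THE d. \<exists>a b. a \<noteq> 0 \<and> b \<noteq> 0 \<and> x = to_fract a / to_fract b \<and>
     d = int (degree a) - int (degree b))"

lemma fract_quotient_cases:
  fixes x :: "'a::field poly fract"
  obtains a b where "b \<noteq> 0" "x = to_fract a / to_fract b"
  by (cases x) (auto simp: Fract_conv_to_fract)

lemma nonzero_fract_quotient_cases:
  fixes x :: "'a::field poly fract"
  assumes "x \<noteq> 0"
  obtains a b where "a \<noteq> 0" "b \<noteq> 0" "x = to_fract a / to_fract b"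
  using assms by (cases x rule: fract_quotient_cases) auto

lemma fdeg_quotient:
  fixes a b :: "'a::field poly"
  assumes "a \<noteq> 0" "b \<noteq> 0"
  shows "fdeg (to_fract a / to_fract b) = int (degree a) - int (degree b)"
  unfolding fdeg_def
proof (rule the_equality)
  fix d assume "\<exists>c e. c \<noteq> 0 \<and> e \<noteq> 0 \<and> to_fract a / to_fract b = to_fract c / to_fract e \<and>
     d = int (degree c) - int (degree e)"
  then obtain c e where ce: "c \<noteq> 0" "e \<noteq> 0" "to_fract a / to_fract b = to_fract c / to_fract e"
    and d: "d = int (degree c) - int (degree e)" by blast
  have "to_fract (a * e) = to_fract (c * b)"
    using ce assms by (simp add: field_simps)
  then have "a * e = c * b" by (simp only: to_fract_eq_iff)
  then have "degree a + degree e = degree c + degree b"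
    using ce assms by (metis degree_mult_eq)
  then show "d = int (degree a) - int (degree b)" using d by linarith
qed (use assms in blast)

lemma fdeg_to_fract: "a \<noteq> 0 \<Longrightarrow> fdeg (to_fract a) = int (degree a)"
  using fdeg_quotient[of a 1] by simp

lemma fdeg_mult:
  fixes x y :: "'a::field poly fract"
  assumes "x \<noteq> 0" "y \<noteq> 0"
  shows "fdeg (x * y) = fdeg x + fdeg y"
proof -
  obtain a b c e where *: "a \<noteq> 0" "b \<noteq> 0" "x = to_fract a / to_fract b"
    "c \<noteq> 0" "e \<noteq> 0" "y = to_fract c / to_fract e"
    using assms by (metis nonzero_fract_quotient_cases)
  then have "fdeg (x * y) = fdeg (to_fract (a * c) / to_fract (b * e))" by simp
  also have "\<dots> = int (degree (a * c)) - int (degree (b * e))"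
    using * by (intro fdeg_quotient) auto
  also have "\<dots> = fdeg x + fdeg y"
    using * by (simp add: fdeg_quotient degree_mult_eq)
  finally show ?thesis .
qed

lemma fdeg_1 [simp]: "fdeg 1 = 0"
  using fdeg_to_fract[of 1] by simp

lemma fdeg_divide:
  fixes x y :: "'a::field poly fract"
  assumes "x \<noteq> 0" "y \<noteq> 0"
  shows "fdeg (x / y) = fdeg x - fdeg y"
  using fdeg_mult[of "x / y" y] assms by simp

lemma fdeg_prod:
  fixes f :: "'b \<Rightarrow> 'a::field poly fract"
  assumes "finite I" "\<And>i. i \<in> I \<Longrightarrow> f i \<noteq> 0"
  shows "fdeg (prod f I) = (\<Sum>i\<in>I. fdeg (f i))"
  using assms by (induction I rule: finite_induct) (auto simp: fdeg_mult)

abbreviation ind :: "'a::field poly fract" where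
  "ind \<equiv> to_fract [:0, 1:]"

lemma fdeg_ind_powi: "fdeg ((ind :: 'a::field poly fract) powi k) = k"
proof -
  have 1: "fdeg ((ind :: 'a poly fract) ^ n) = int n" for n
    by (induction n) (auto simp: fdeg_mult fdeg_to_fract)
  show ?thesis
  proof (cases "k \<ge> 0")
    case True then show ?thesis using 1[of "nat k"] by (simp add: power_int_def)
  next
    case False
    then show ?thesis using 1[of "nat (- k)"] fdeg_divide[of 1 "(ind :: 'a poly fract) ^ nat (- k)"]
      by (simp add: power_int_def inverse_eq_divide power_divide)
  qed
qed

text \<open>
  The zero function counts as having degree minus infinity; with this convention the bound is stable under sums and
  products.
\<close>

definition fdeg_le :: "'a::field poly fract \<Rightarrow> int \<Rightarrow> bool" where
  "fdeg_le x d \<longleftrightarrow> x = 0 \<or> fdeg x \<le> d"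

lemma fdeg_le_quotient:
  fixes a b :: "'a::field poly"
  assumes "b \<noteq> 0"
  shows "fdeg_le (to_fract a / to_fract b) d \<longleftrightarrow> a = 0 \<or> int (degree a) \<le> int (degree b) + d"
  using assms by (cases "a = 0") (auto simp: fdeg_le_def fdeg_quotient)

lemma proper_fract_iff: "proper_fract x \<longleftrightarrow> fdeg_le x 0"
proof
  assume "proper_fract x"
  then show "fdeg_le x 0" by (auto simp: proper_fract_def fdeg_le_quotient)
next
  assume *: "fdeg_le x 0"
  obtain a b where "b \<noteq> 0" "x = to_fract a / to_fract b" by (rule fract_quotient_cases)
  then show "proper_fract x" using * fdeg_le_quotient[of b a 0] unfolding proper_fract_def by force
qed

lemma fdeg_le_0 [simp]: "fdeg_le 0 d"
  by (simp add: fdeg_le_def)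

lemma fdeg_le_mono: "fdeg_le x d \<Longrightarrow> d \<le> e \<Longrightarrow> fdeg_le x e"
  by (auto simp: fdeg_le_def)

lemma fdeg_le_mult: "fdeg_le x d \<Longrightarrow> fdeg_le y e \<Longrightarrow> fdeg_le (x * y) (d + e)"
  by (cases "x = 0"; cases "y = 0") (auto simp: fdeg_le_def fdeg_mult)

lemma fdeg_le_add:
  fixes x y :: "'a::field poly fract"
  assumes "fdeg_le x d" "fdeg_le y d"
  shows "fdeg_le (x + y) d"
proof -
  obtain a b where x: "b \<noteq> 0" "x = to_fract a / to_fract b" by (rule fract_quotient_cases)
  obtain c e where y: "e \<noteq> 0" "y = to_fract c / to_fract e" by (rule fract_quotient_cases)
  have 1: "a = 0 \<or> int (degree a) \<le> int (degree b) + d" "c = 0 \<or> int (degree c) \<le> int (degree e) + d"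
    using assms x y fdeg_le_quotient by metis+
  have xy: "x + y = to_fract (a * e + c * b) / to_fract (b * e)"
    using x y by (simp add: field_simps)
  have "a * e = 0 \<or> int (degree (a * e)) \<le> int (degree (b * e)) + d"
    using 1 x y by (cases "a = 0") (auto simp: degree_mult_eq)
  moreover have "c * b = 0 \<or> int (degree (c * b)) \<le> int (degree (b * e)) + d"
    using 1 x y by (cases "c = 0") (auto simp: degree_mult_eq)
  moreover have "degree (a * e + c * b) \<le> max (degree (a * e)) (degree (c * b))"
    by (rule degree_add_le_max)
  ultimately have "a * e + c * b = 0 \<or> int (degree (a * e + c * b)) \<le> int (degree (b * e)) + d"
    by (cases "a * e = 0"; cases "c * b = 0") (auto simp: max_def split: if_splits)
  then show ?thesis unfolding xy using x y by (subst fdeg_le_quotient) auto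
qed

lemma fdeg_le_uminus: "fdeg_le x d \<Longrightarrow> fdeg_le (- x) d"
  using fdeg_le_mult[of "to_fract (-1)" 0 x d] by (simp add: fdeg_le_def fdeg_to_fract del: to_fract_uminus)
    (simp add: fdeg_to_fract[of "-1", simplified])

lemma fdeg_le_sum: "(\<And>i. i \<in> I \<Longrightarrow> fdeg_le (f i) d) \<Longrightarrow> fdeg_le (sum f I) d"
  by (induction I rule: infinite_finite_induct) (auto intro: fdeg_le_add)

lemma fdeg_le_to_fract: "fdeg_le (to_fract p) d \<longleftrightarrow> p = 0 \<or> int (degree p) \<le> d"
  by (cases "p = 0") (auto simp: fdeg_le_def fdeg_to_fract)

text \<open>
  Division with remainder of the numerator by the denominator. The polynomials and the proper functions together
  thus span all rational functions, which lets conditions over the two rings be met simultaneously.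
\<close>

lemma fract_split_polynomial:
  fixes x :: "'a::field poly fract"
  obtains p y where "x = to_fract p + y" "fdeg_le y (-1)"
proof -
  obtain a b where x: "b \<noteq> 0" "x = to_fract a / to_fract b" by (rule fract_quotient_cases)
  have "to_fract a = to_fract (a div b) * to_fract b + to_fract (a mod b)"
    by (metis div_mult_mod_eq to_fract_add to_fract_mult)
  then have "x = to_fract (a div b) + to_fract (a mod b) / to_fract b"
    using x by (simp add: field_simps)
  moreover have "fdeg_le (to_fract (a mod b) / to_fract b) (-1)"
    using degree_mod_less[of b a] x by (subst fdeg_le_quotient) auto
  ultimately show ?thesis by (rule that)
qed

section \<open>The polynomials and the proper functions as subrings of the rational functions\<close>

text \<open>
  The last assumption provides an invertible matrix with rows \<open>(p, q)\<close> and \<open>(u, v)\<close> and determinant 1 that clears the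
  second of two given elements of the field. It is all that elimination over \<open>S\<close> needs.
\<close>

locale bezout_subring =
  fixes S :: "'k::field set"
  assumes zero_mem [simp, intro]: "0 \<in> S" and one_mem [simp, intro]: "1 \<in> S"
    and add_mem [intro]: "a \<in> S \<Longrightarrow> b \<in> S \<Longrightarrow> a + b \<in> S"
    and mult_mem [intro]: "a \<in> S \<Longrightarrow> b \<in> S \<Longrightarrow> a * b \<in> S"
    and uminus_mem [intro]: "a \<in> S \<Longrightarrow> - a \<in> S"
    and bezout: "\<exists>p\<in>S. \<exists>q\<in>S. \<exists>u\<in>S. \<exists>v\<in>S. p * v - q * u = 1 \<and> u * a + v * b = 0"

definition poly_fracts :: "'a::field poly fract set" where
  "poly_fracts = range to_fract"

definition proper_fracts :: "'a::field poly fract set" where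
  "proper_fracts = {x. fdeg_le x 0}"

text \<open>
  The Euclidean algorithm, recorded as a product of matrices of determinant 1; no greatest common divisor has to be
  chosen.
\<close>

lemma bezout_polynomials:
  fixes a b :: "'a::field poly"
  shows "\<exists>p q u v. p * v - q * u = 1 \<and> u * a + v * b = 0"
proof (induction "if b = 0 then 0 else Suc (degree b)" arbitrary: a b rule: less_induct)
  case less
  show ?case
  proof (cases "b = 0")
    case True
    then show ?thesis by (intro exI[of _ 1] exI[of _ 0]) auto
  next
    case False
    have "(if a mod b = 0 then 0 else Suc (degree (a mod b))) < (if b = 0 then 0 else Suc (degree b))"
      using False degree_mod_less[of b a] by auto
    from less[OF this, of b] obtain p q u v where
      *: "p * v - q * u = 1" "u * b + v * (a mod b) = 0" by blast
    have am: "a mod b = a - (a div b) * b" by (simp add: minus_div_mult_eq_mod)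
    have "v * a + (u - v * (a div b)) * b = 0"
      using *(2) unfolding am by (simp add: algebra_simps)
    moreover have "(- q) * (u - v * (a div b)) - (- (p - q * (a div b))) * v = 1"
      using *(1) by (simp add: algebra_simps)
    ultimately show ?thesis by blast
  qed
qed

interpretation poly_fracts: bezout_subring "poly_fracts :: 'a::field poly fract set"
proof (unfold_locales, goal_cases)
  case 1 show ?case unfolding poly_fracts_def using to_fract_0 by (metis rangeI)
next
  case 2 show ?case unfolding poly_fracts_def using to_fract_1 by (metis rangeI)
next
  case (3 a b)
  then show ?case unfolding poly_fracts_def by (auto simp flip: to_fract_add)
next
  case (4 a b)
  then show ?case unfolding poly_fracts_def by (auto simp flip: to_fract_mult)
next
  case (5 a)
  then show ?case unfolding poly_fracts_def by (auto simp flip: to_fract_uminus)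
next
  case (6 a b)
  obtain a1 a2 where a: "a2 \<noteq> 0" "a = to_fract a1 / to_fract a2" by (rule fract_quotient_cases)
  obtain b1 b2 where b: "b2 \<noteq> 0" "b = to_fract b1 / to_fract b2" by (rule fract_quotient_cases)
  obtain p q u v where *: "p * v - q * u = 1" "u * (a1 * b2) + v * (b1 * a2) = 0"
    using bezout_polynomials by blast
  have "to_fract p * to_fract v - to_fract q * to_fract u = to_fract (p * v - q * u)" by simp
  then have 1: "to_fract p * to_fract v - to_fract q * to_fract u = 1" using * by simp
  have "to_fract u * a + to_fract v * b
      = to_fract (u * (a1 * b2) + v * (b1 * a2)) / (to_fract a2 * to_fract b2)"
    unfolding a(2) b(2) using a(1) b(1) by (simp add: field_simps)
  then have 2: "to_fract u * a + to_fract v * b = 0" using * by simp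
  show ?case
    using 1 2 unfolding poly_fracts_def by blast
qed

lemma unit_mem_proper_fracts:
  "(0 :: 'a::field poly fract) \<in> proper_fracts" "(1 :: 'a poly fract) \<in> proper_fracts"
  "(-1 :: 'a poly fract) \<in> proper_fracts"
  using fdeg_le_uminus[of 1 0] by (auto simp: proper_fracts_def fdeg_le_def)

text \<open>
  Of two nonzero rational functions one always divides the other over the proper functions, so this ring is a
  valuation ring and clearing an entry takes a single row operation.
\<close>

lemma divide_mem_proper_fracts:
  "a \<noteq> 0 \<Longrightarrow> b \<noteq> 0 \<Longrightarrow> fdeg b \<le> fdeg a \<Longrightarrow> b / a \<in> proper_fracts"
  by (auto simp: proper_fracts_def fdeg_le_def fdeg_divide)

interpretation proper_fracts: bezout_subring "proper_fracts :: 'a::field poly fract set"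
proof (unfold_locales, goal_cases)
  case 1 show ?case by (rule unit_mem_proper_fracts)
next
  case 2 show ?case by (rule unit_mem_proper_fracts)
next
  case (3 a b)
  then show ?case unfolding proper_fracts_def by (auto intro: fdeg_le_add)
next
  case (4 a b)
  then show ?case unfolding proper_fracts_def using fdeg_le_mult[of a 0 b 0] by auto
next
  case (5 a)
  then show ?case unfolding proper_fracts_def by (auto intro: fdeg_le_uminus)
next
  case (6 a b)
  have um: "x \<in> proper_fracts \<Longrightarrow> - x \<in> proper_fracts" for x :: "'a poly fract"
    unfolding proper_fracts_def by (auto intro: fdeg_le_uminus)
  consider "a = 0" | "b = 0" | "a \<noteq> 0" "b \<noteq> 0" "fdeg b \<le> fdeg a" | "a \<noteq> 0" "b \<noteq> 0" "fdeg a \<le> fdeg b"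
    by linarith
  then show ?case
  proof cases
    case 1
    then show ?thesis using unit_mem_proper_fracts
      by (intro bexI[of _ 0] bexI[of _ "-1"] bexI[of _ 1]) auto
  next
    case 2
    then show ?thesis using unit_mem_proper_fracts
      by (intro bexI[of _ 1] bexI[of _ 0] bexI[of _ "0"]) auto
  next
    case 3
    then have "- (b / a) \<in> proper_fracts" by (intro um divide_mem_proper_fracts)
    then show ?thesis using 3 unit_mem_proper_fracts
      by (intro bexI[of _ 1] bexI[of _ 0] bexI[of _ "- (b / a)"]) auto
  next
    case 4
    then have "- (a / b) \<in> proper_fracts" by (intro um divide_mem_proper_fracts)
    then show ?thesis using 4 unit_mem_proper_fracts
      by (intro bexI[of _ 0] bexI[of _ "-1"] bexI[of _ 1] bexI[of _ "- (a / b)"]) auto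
  qed
qed

section \<open>Equivalence of matrices over a subring of a field\<close>

text \<open>
  The matrix acts on the coordinates \<open>i\<close> and \<open>j\<close> by the matrix with rows \<open>(p, q)\<close> and \<open>(u, v)\<close> and fixes all others.
\<close>

definition plane_mat :: "nat \<Rightarrow> nat \<Rightarrow> nat \<Rightarrow> 'k \<Rightarrow> 'k \<Rightarrow> 'k \<Rightarrow> 'k \<Rightarrow> 'k::comm_ring_1 mat" where
  "plane_mat N i j p q u v = mat N N (\<lambda>(a, b).
     if a = i then (if b = i then p else if b = j then q else 0)
     else if a = j then (if b = i then u else if b = j then v else 0)
     else if a = b then 1 else 0)"

lemma plane_mat_carrier [simp]: "plane_mat N i j p q u v \<in> carrier_mat N N"
  by (simp add: plane_mat_def)

lemma plane_mat_mult:
  assumes "A \<in> carrier_mat N n" "i < N" "j < N" "i \<noteq> j"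
  shows "plane_mat N i j p q u v * A = mat N n (\<lambda>(a, b).
     if a = i then p * A $$ (i, b) + q * A $$ (j, b)
     else if a = j then u * A $$ (i, b) + v * A $$ (j, b)
     else A $$ (a, b))" (is "_ = ?R")
proof (rule eq_matI)
  fix a b assume "a < dim_row ?R" "b < dim_col ?R"
  then have ab: "a < N" "b < n" by auto
  have e: "(plane_mat N i j p q u v * A) $$ (a, b)
     = (\<Sum>k\<in>{0..<N}. plane_mat N i j p q u v $$ (a, k) * A $$ (k, b))"
    using ab assms by (simp add: scalar_prod_def plane_mat_def)
  have two: "(\<Sum>k\<in>{0..<N}. (if k = i then x else 0) + (if k = j then y else 0)) = x + y"
    for x y :: 'a
    using assms by (simp add: sum.distrib)
  consider "a = i" | "a = j" "a \<noteq> i" | "a \<noteq> i" "a \<noteq> j" by blast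
  then show "(plane_mat N i j p q u v * A) $$ (a, b) = ?R $$ (a, b)"
  proof cases
    case 1
    have "(plane_mat N i j p q u v * A) $$ (a, b) = (\<Sum>k\<in>{0..<N}.
        (if k = i then p * A $$ (i, b) else 0) + (if k = j then q * A $$ (j, b) else 0))"
      unfolding e by (rule sum.cong) (use 1 ab assms in \<open>auto simp: plane_mat_def\<close>)
    then show ?thesis using 1 ab two by simp
  next
    case 2
    have "(plane_mat N i j p q u v * A) $$ (a, b) = (\<Sum>k\<in>{0..<N}.
        (if k = i then u * A $$ (i, b) else 0) + (if k = j then v * A $$ (j, b) else 0))"
      unfolding e by (rule sum.cong) (use 2 ab assms in \<open>auto simp: plane_mat_def\<close>)
    then show ?thesis using 2 ab two by simp
  next
    case 3
    have "(plane_mat N i j p q u v * A) $$ (a, b) = (\<Sum>k\<in>{0..<N}. (if k = a then A $$ (a, b) else 0))"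
      unfolding e by (rule sum.cong) (use 3 ab assms in \<open>auto simp: plane_mat_def\<close>)
    then show ?thesis using 3 ab by simp
  qed
qed (use assms in \<open>auto simp: plane_mat_def\<close>)

lemma plane_mat_transpose:
  "i \<noteq> j \<Longrightarrow> (plane_mat N i j p q u v)\<^sup>T = plane_mat N i j p u q v"
  by (rule eq_matI) (auto simp: plane_mat_def)

lemma mult_plane_mat:
  assumes A: "A \<in> carrier_mat n N" and ij: "i < N" "j < N" "i \<noteq> j"
  shows "A * plane_mat N i j p q u v = mat n N (\<lambda>(a, b).
     if b = i then A $$ (a, i) * p + A $$ (a, j) * u
     else if b = j then A $$ (a, i) * q + A $$ (a, j) * v
     else A $$ (a, b))" (is "_ = ?R")
proof -
  have "A * plane_mat N i j p q u v = (plane_mat N i j p u q v * A\<^sup>T)\<^sup>T"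
    using A by (subst transpose_mult[of _ N N _ n]) (auto simp: plane_mat_transpose[OF ij(3)])
  also have "\<dots> = ?R"
    using A ij by (subst plane_mat_mult[of _ N n]) (auto intro!: eq_matI simp: mult.commute)
  finally show ?thesis .
qed

lemma plane_mat_inverse:
  assumes ij: "i < N" "j < N" "i \<noteq> j" and det: "p * v - q * u = 1"
  shows "plane_mat N i j p q u v * plane_mat N i j v (- q) (- u) p = 1\<^sub>m N"
    and "plane_mat N i j v (- q) (- u) p * plane_mat N i j p q u v = 1\<^sub>m N"
proof -
  have 1: "plane_mat N i j p q u v * plane_mat N i j v (- q) (- u) p = 1\<^sub>m N"
    if "p * v - q * u = 1" for p q u v :: 'a
    unfolding plane_mat_mult[OF plane_mat_carrier ij]
    by (rule eq_matI) (use ij that in \<open>auto simp: plane_mat_def algebra_simps\<close>)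
  show "plane_mat N i j p q u v * plane_mat N i j v (- q) (- u) p = 1\<^sub>m N" by (rule 1[OF det])
  have "v * p - (- q) * (- u) = 1" using det by (simp add: mult.commute)
  from 1[OF this] show "plane_mat N i j v (- q) (- u) p * plane_mat N i j p q u v = 1\<^sub>m N" by simp
qed

context bezout_subring
begin

lemma sum_mem [intro]: "(\<And>i. i \<in> I \<Longrightarrow> f i \<in> S) \<Longrightarrow> sum f I \<in> S"
  by (induction I rule: infinite_finite_induct) auto

lemma prod_mem [intro]: "(\<And>i. i \<in> I \<Longrightarrow> f i \<in> S) \<Longrightarrow> prod f I \<in> S"
  by (induction I rule: infinite_finite_induct) auto

definition mats :: "nat \<Rightarrow> nat \<Rightarrow> 'k mat set" where
  "mats m n = {A \<in> carrier_mat m n. \<forall>i<m. \<forall>j<n. A $$ (i, j) \<in> S}"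

text \<open>
  For the polynomials these are the unimodular matrices, for the proper functions the biproper ones.
\<close>

definition units :: "nat \<Rightarrow> 'k mat set" where
  "units m = {U \<in> mats m m. \<exists>U'\<in>mats m m. U * U' = 1\<^sub>m m \<and> U' * U = 1\<^sub>m m}"

definition equivalent :: "'k mat \<Rightarrow> 'k mat \<Rightarrow> bool" where
  "equivalent A B \<longleftrightarrow> (\<exists>U\<in>units (dim_row A). \<exists>V\<in>units (dim_col A). U * A * V = B)"

lemma mats_carrier: "A \<in> mats m n \<Longrightarrow> A \<in> carrier_mat m n"
  by (simp add: mats_def)

lemma units_mats: "U \<in> units m \<Longrightarrow> U \<in> mats m m"
  by (simp add: units_def)

lemma units_carrier: "U \<in> units m \<Longrightarrow> U \<in> carrier_mat m m"
  by (simp add: units_def mats_def)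

lemma mats_mult: "A \<in> mats m n \<Longrightarrow> B \<in> mats n p \<Longrightarrow> A * B \<in> mats m p"
  by (auto simp: mats_def scalar_prod_def intro!: sum_mem mult_mem)

lemma mats_uminus: "A \<in> mats m n \<Longrightarrow> - A \<in> mats m n"
  by (auto simp: mats_def intro!: uminus_mem)

lemma mats_one: "1\<^sub>m m \<in> mats m m"
  by (auto simp: mats_def one_mat_def)

lemma mats_zero: "0\<^sub>m m n \<in> mats m n"
  by (auto simp: mats_def zero_mat_def)

lemma mats_four_block:
  "A \<in> mats m n \<Longrightarrow> B \<in> mats m n' \<Longrightarrow> C \<in> mats m' n \<Longrightarrow> D \<in> mats m' n' \<Longrightarrow>
    four_block_mat A B C D \<in> mats (m + m') (n + n')"
  by (auto simp: mats_def)

lemma unitsE: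
  assumes "U \<in> units m"
  obtains U' where "U' \<in> units m" "U * U' = 1\<^sub>m m" "U' * U = 1\<^sub>m m"
  using assms unfolding units_def by blast

lemma units_one: "1\<^sub>m m \<in> units m"
  using mats_one by (auto simp: units_def intro!: bexI[of _ "1\<^sub>m m"])

lemma units_mult:
  assumes "U \<in> units m" "V \<in> units m"
  shows "U * V \<in> units m"
proof -
  obtain U' where U': "U' \<in> units m" "U * U' = 1\<^sub>m m" "U' * U = 1\<^sub>m m" using unitsE assms(1) .
  obtain V' where V': "V' \<in> units m" "V * V' = 1\<^sub>m m" "V' * V = 1\<^sub>m m" using unitsE assms(2) .
  note c = units_carrier[OF assms(1)] units_carrier[OF assms(2)]
    units_carrier[OF U'(1)] units_carrier[OF V'(1)]
  have "(U * V) * (V' * U') = U * (V * V') * U'" using c by (simp add: assoc_mult_mat[of _ m m _ m _ m])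
  then have 1: "(U * V) * (V' * U') = 1\<^sub>m m" using c U' V' by simp
  have "(V' * U') * (U * V) = V' * (U' * U) * V" using c by (simp add: assoc_mult_mat[of _ m m _ m _ m])
  then have 2: "(V' * U') * (U * V) = 1\<^sub>m m" using c U' V' by simp
  show ?thesis unfolding units_def
    using 1 2 assms U' V' by (auto intro!: mats_mult dest!: units_mats)
qed

lemma mats_transpose: "A \<in> mats m n \<Longrightarrow> A\<^sup>T \<in> mats n m"
  by (auto simp: mats_def)

lemma units_transpose:
  assumes "U \<in> units m"
  shows "U\<^sup>T \<in> units m"
proof -
  obtain U' where U': "U' \<in> units m" "U * U' = 1\<^sub>m m" "U' * U = 1\<^sub>m m" using unitsE assms .
  have "U\<^sup>T * U'\<^sup>T = 1\<^sub>m m" "U'\<^sup>T * U\<^sup>T = 1\<^sub>m m"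
    using U' units_carrier[OF assms] units_carrier[OF U'(1)]
    by (metis transpose_mult transpose_one)+
  then show ?thesis
    using assms U' by (auto simp: units_def intro: mats_transpose)
qed

lemma units_plane_mat:
  assumes "i < N" "j < N" "i \<noteq> j" "p * v - q * u = 1" "p \<in> S" "q \<in> S" "u \<in> S" "v \<in> S"
  shows "plane_mat N i j p q u v \<in> units N"
proof -
  have "plane_mat N i j p q u v \<in> mats N N" "plane_mat N i j v (- q) (- u) p \<in> mats N N"
    using assms by (auto simp: mats_def plane_mat_def)
  then show ?thesis using plane_mat_inverse[OF assms(1-4)] unfolding units_def by blast
qed

lemma units_four_block:
  assumes U: "U \<in> units m" and V: "V \<in> units n" and B: "B \<in> mats m n"
  shows "four_block_mat U B (0\<^sub>m n m) V \<in> units (m + n)"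
proof -
  obtain U' where U': "U' \<in> units m" "U * U' = 1\<^sub>m m" "U' * U = 1\<^sub>m m" using unitsE U .
  obtain V' where V': "V' \<in> units n" "V * V' = 1\<^sub>m n" "V' * V = 1\<^sub>m n" using unitsE V .
  note c = units_carrier[OF U] units_carrier[OF V] units_carrier[OF U'(1)] units_carrier[OF V'(1)]
    mats_carrier[OF B]
  define B' where "B' = U' * (- B) * V'"
  have mB: "- B \<in> mats m n" using B by (rule mats_uminus)
  have B': "B' \<in> mats m n"
    unfolding B'_def by (intro mats_mult[of _ m m] mats_mult[of _ m n] units_mats U' V' mB)
  have cB': "B' \<in> carrier_mat m n" using B' by (rule mats_carrier)
  have UB': "U * B' = - (B * V')"
  proof -
    have "U * B' = (U * U') * (- B) * V'"
      unfolding B'_def using c by (simp add: assoc_mult_mat[of _ m m _ m _ n] assoc_mult_mat[of _ m m _ n _ n])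
    then show ?thesis using c U' by simp
  qed
  have B'V: "B' * V = - (U' * B)"
  proof -
    have "B' * V = U' * (- B) * (V' * V)"
      unfolding B'_def using c by (intro assoc_mult_mat[of _ m n]) auto
    then show ?thesis using c V' by simp
  qed
  have b0: "U * B' + B * V' = 0\<^sub>m m n"
    unfolding UB' using c by (intro eq_matI) auto
  have b1: "U' * B + B' * V = 0\<^sub>m m n"
    unfolding B'V using c by (intro eq_matI) auto
  have 1: "four_block_mat U B (0\<^sub>m n m) V * four_block_mat U' B' (0\<^sub>m n m) V' = 1\<^sub>m (m + n)"
    using c cB' U' V' by (subst mult_four_block_mat[of _ m m _ n _ n]) (auto simp: b0 intro!: four_block_one_mat)
  have 2: "four_block_mat U' B' (0\<^sub>m n m) V' * four_block_mat U B (0\<^sub>m n m) V = 1\<^sub>m (m + n)"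
    using c cB' U' V' by (subst mult_four_block_mat[of _ m m _ n _ n]) (auto simp: b1 intro!: four_block_one_mat)
  have "four_block_mat U B (0\<^sub>m n m) V \<in> mats (m + n) (m + n)"
    "four_block_mat U' B' (0\<^sub>m n m) V' \<in> mats (m + n) (m + n)"
    using U V U' V' B B' by (auto intro!: mats_four_block mats_zero dest: units_mats)
  then show ?thesis using 1 2 unfolding units_def by blast
qed

lemma equivalentE:
  assumes "equivalent A B" "A \<in> carrier_mat m n"
  obtains U V where "U \<in> units m" "V \<in> units n" "U * A * V = B"
  using assms unfolding equivalent_def by auto

lemma equivalentI:
  assumes "A \<in> carrier_mat m n" "U \<in> units m" "V \<in> units n" "U * A * V = B"
  shows "equivalent A B"
  using assms unfolding equivalent_def by auto

lemma equivalent_refl: "A \<in> carrier_mat m n \<Longrightarrow> equivalent A A"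
  by (rule equivalentI[OF _ units_one units_one]) auto

lemma regroup_mult_mat:
  fixes P :: "'k mat"
  assumes "P \<in> carrier_mat m m" "Q \<in> carrier_mat m m" "A \<in> carrier_mat m n"
    "X \<in> carrier_mat n n" "Y \<in> carrier_mat n n"
  shows "P * (Q * A * X) * Y = (P * Q) * A * (X * Y)"
proof -
  have "P * (Q * A * X) = P * (Q * A) * X"
    by (rule assoc_mult_mat[symmetric]) (use assms in auto)
  also have "P * (Q * A) = P * Q * A"
    by (rule assoc_mult_mat[symmetric]) (use assms in auto)
  finally have "P * (Q * A * X) * Y = P * Q * A * X * Y" by simp
  also have "\<dots> = P * Q * A * (X * Y)"
    by (rule assoc_mult_mat) (use assms in auto)
  finally show ?thesis .
qed

lemma equivalent_sym:
  assumes "equivalent A B"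
  shows "equivalent B A"
proof -
  define m n where "m = dim_row A" and "n = dim_col A"
  have A: "A \<in> carrier_mat m n" by (auto simp: m_def n_def)
  obtain U V where UV: "U \<in> units m" "V \<in> units n" "U * A * V = B" using equivalentE[OF assms A] .
  obtain U' where U': "U' \<in> units m" "U * U' = 1\<^sub>m m" "U' * U = 1\<^sub>m m" using unitsE UV(1) .
  obtain V' where V': "V' \<in> units n" "V * V' = 1\<^sub>m n" "V' * V = 1\<^sub>m n" using unitsE UV(2) .
  note c = units_carrier[OF UV(1)] units_carrier[OF UV(2)] units_carrier[OF U'(1)] units_carrier[OF V'(1)]
  have "U' * B * V' = A"
    unfolding UV(3)[symmetric] regroup_mult_mat[OF c(3,1) A c(2,4)] U' V' using A by simp
  moreover have "B \<in> carrier_mat m n" using UV(3) c A by auto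
  ultimately show ?thesis using equivalentI U' V' by blast
qed

lemma equivalent_trans:
  assumes "equivalent A B" "equivalent B C"
  shows "equivalent A C"
proof -
  define m n where "m = dim_row A" and "n = dim_col A"
  have A: "A \<in> carrier_mat m n" by (auto simp: m_def n_def)
  obtain U V where UV: "U \<in> units m" "V \<in> units n" "U * A * V = B" using equivalentE[OF assms(1) A] .
  have B: "B \<in> carrier_mat m n"
    using UV(3) A units_carrier[OF UV(1)] units_carrier[OF UV(2)] by auto
  obtain X Y where XY: "X \<in> units m" "Y \<in> units n" "X * B * Y = C" using equivalentE[OF assms(2) B] .
  note c = units_carrier[OF UV(1)] units_carrier[OF UV(2)] units_carrier[OF XY(1)] units_carrier[OF XY(2)]
  have "(X * U) * A * (V * Y) = C"
    using regroup_mult_mat[OF c(3,1) A c(2,4)] unfolding XY(3) UV(3) by simp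
  then show ?thesis using equivalentI[OF A, of "X * U" "V * Y" C] UV XY units_mult by blast
qed

text \<open>
  Row \<open>k\<close> is combined with one lower row at a time. Both rows vanish in the columns before \<open>k\<close>, so the zeros already
  obtained there survive.
\<close>

lemma triangularize_column:
  assumes A: "A \<in> carrier_mat m r" and k: "k < r"
    and tri: "\<And>i j. j < k \<Longrightarrow> j < i \<Longrightarrow> i < m \<Longrightarrow> A $$ (i, j) = 0"
  shows "\<exists>U\<in>units m. (\<forall>j<k. \<forall>i<m. j < i \<longrightarrow> (U * A) $$ (i, j) = 0) \<and>
    (\<forall>i<m. k < i \<longrightarrow> i < l \<longrightarrow> (U * A) $$ (i, k) = 0)"
proof (induction l)
  case 0
  then show ?case using A tri by (intro bexI[of _ "1\<^sub>m m"]) (auto intro: units_one)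
next
  case (Suc l)
  then obtain U where U: "U \<in> units m"
    and 1: "\<And>i j. j < k \<Longrightarrow> j < i \<Longrightarrow> i < m \<Longrightarrow> (U * A) $$ (i, j) = 0"
    and 2: "\<And>i. k < i \<Longrightarrow> i < m \<Longrightarrow> i < l \<Longrightarrow> (U * A) $$ (i, k) = 0" by blast
  show ?case
  proof (cases "k < l \<and> l < m")
    case False
    then show ?thesis using U 1 2 by (intro bexI[of _ U]) (auto simp: less_Suc_eq)
  next
    case True
    define B where "B = U * A"
    have B: "B \<in> carrier_mat m r" using A units_carrier[OF U] by (auto simp: B_def)
    obtain p q u v where pq: "p \<in> S" "q \<in> S" "u \<in> S" "v \<in> S" "p * v - q * u = 1"
      "u * B $$ (k, k) + v * B $$ (l, k) = 0" using bezout by metis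
    define E where "E = plane_mat m k l p q u v"
    have E: "E \<in> units m" unfolding E_def using True pq by (intro units_plane_mat) auto
    have "(E * U) * A = E * B"
      unfolding B_def using units_carrier[OF E] units_carrier[OF U] A by simp
    also have "\<dots> = mat m r (\<lambda>(a, b).
     if a = k then p * B $$ (k, b) + q * B $$ (l, b)
     else if a = l then u * B $$ (k, b) + v * B $$ (l, b)
     else B $$ (a, b))"
      unfolding E_def using B True by (intro plane_mat_mult) auto
    finally have e: "(E * U) * A = \<dots>" .
    show ?thesis
    proof (intro bexI[of _ "E * U"] conjI allI impI)
      fix j i assume "j < k" "i < m" "j < i"
      then show "(E * U * A) $$ (i, j) = 0"
        unfolding e using k True 1[folded B_def] by auto
    next
      fix i assume "k < i" "i < m" "i < Suc l"
      then show "(E * U * A) $$ (i, k) = 0"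
        unfolding e using k True 2[folded B_def] pq by auto
    qed (intro units_mult E U)
  qed
qed

lemma triangularize:
  assumes A: "A \<in> carrier_mat m r" and "k \<le> r"
  shows "\<exists>U\<in>units m. \<forall>j<k. \<forall>i<m. j < i \<longrightarrow> (U * A) $$ (i, j) = 0"
  using assms(2)
proof (induction k)
  case 0
  then show ?case using units_one by blast
next
  case (Suc k)
  then obtain U where U: "U \<in> units m" "\<forall>j<k. \<forall>i<m. j < i \<longrightarrow> (U * A) $$ (i, j) = 0" by auto
  have UA: "U * A \<in> carrier_mat m r" using units_carrier[OF U(1)] A by simp
  obtain V where V: "V \<in> units m" "\<forall>j<k. \<forall>i<m. j < i \<longrightarrow> (V * (U * A)) $$ (i, j) = 0"
    "\<forall>i<m. k < i \<longrightarrow> i < m \<longrightarrow> (V * (U * A)) $$ (i, k) = 0"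
    using triangularize_column[OF UA, of k m] U(2) Suc.prems by auto
  have "V * (U * A) = (V * U) * A"
    using units_carrier[OF U(1)] units_carrier[OF V(1)] A by simp
  then show ?case using V units_mult[OF V(1) U(1)] by (intro bexI[of _ "V * U"]) (auto simp: less_Suc_eq)
qed

end

section \<open>Full column rank over the subring\<close>

text \<open>
  The block matrix \<open>[I; 0]\<close> of the first \<open>r\<close> unit vectors.
\<close>

definition unit_columns :: "nat \<Rightarrow> nat \<Rightarrow> 'k::{zero,one} mat" where
  "unit_columns m r = mat m r (\<lambda>(i, j). if i = j then 1 else 0)"

lemma unit_columns_carrier [simp]: "unit_columns m r \<in> carrier_mat m r"
  by (simp add: unit_columns_def)

lemma unit_columns_mult:
  fixes A :: "'k::comm_ring_1 mat"
  assumes "A \<in> carrier_mat r n" "r \<le> m"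
  shows "unit_columns m r * A = mat m n (\<lambda>(i, j). if i < r then A $$ (i, j) else 0)"
proof (rule eq_matI)
  fix i j assume "i < dim_row (mat m n (\<lambda>(i, j). if i < r then A $$ (i, j) else 0))"
    "j < dim_col (mat m n (\<lambda>(i, j). if i < r then A $$ (i, j) else 0))"
  then have ij: "i < m" "j < n" by auto
  have "(unit_columns m r * A) $$ (i, j) = (\<Sum>k\<in>{0..<r}. (if i = k then 1 else 0) * A $$ (k, j))"
    using ij assms by (simp add: scalar_prod_def unit_columns_def)
  also have "\<dots> = (\<Sum>k\<in>{0..<r}. if k = i then A $$ (k, j) else 0)" by (intro sum.cong) auto
  finally show "(unit_columns m r * A) $$ (i, j)
      = mat m n (\<lambda>(i, j). if i < r then A $$ (i, j) else 0) $$ (i, j)"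
    using ij by simp
qed (use assms in \<open>auto simp: unit_columns_def\<close>)

context bezout_subring
begin

text \<open>
  Elimination writes \<open>A\<close> as an invertible matrix times \<open>[H; 0]\<close> with \<open>H\<close> square. Injectivity makes \<open>H\<close> invertible over
  the field, and the saturation hypothesis, applied to the columns of the inverse of \<open>H\<close>, makes it invertible
  over \<open>S\<close>; then \<open>H\<close> can be absorbed into the invertible factor.
\<close>

lemma saturated_completion:
  assumes A: "A \<in> mats m r" and r: "r \<le> m"
    and inj: "\<And>x. x \<in> carrier_vec r \<Longrightarrow> A *\<^sub>v x = 0\<^sub>v m \<Longrightarrow> x = 0\<^sub>v r"
    and sat: "\<And>x. x \<in> carrier_vec r \<Longrightarrow> (\<forall>i<m. (A *\<^sub>v x) $ i \<in> S) \<Longrightarrow> \<forall>j<r. x $ j \<in> S"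
  obtains W where "W \<in> units m" "A = W * unit_columns m r"
proof -
  have cA: "A \<in> carrier_mat m r" using A by (rule mats_carrier)
  obtain U where U: "U \<in> units m" "\<forall>j<r. \<forall>i<m. j < i \<longrightarrow> (U * A) $$ (i, j) = 0"
    using triangularize[OF cA order_refl] by blast
  obtain U' where U': "U' \<in> units m" "U * U' = 1\<^sub>m m" "U' * U = 1\<^sub>m m" using unitsE U(1) .
  note c = cA units_carrier[OF U(1)] units_carrier[OF U'(1)]
  define J where "J = (unit_columns m r :: 'k mat)"
  have J: "J \<in> carrier_mat m r" "J \<in> mats m r" by (auto simp: J_def unit_columns_def mats_def)
  define H where "H = mat r r (\<lambda>(i, j). (U * A) $$ (i, j))"
  have UA: "U * A \<in> mats m r" using mats_mult units_mats U(1) A by blast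
  have H: "H \<in> mats r r" using UA r by (auto simp: H_def mats_def)
  have cH: "H \<in> carrier_mat r r" using H by (rule mats_carrier)
  have JH: "U * A = J * H"
    unfolding J_def using unit_columns_mult[OF cH r] U(2) c r
    by (intro eq_matI) (auto simp: H_def)
  have "A = U' * (U * A)" using c U' by (simp add: assoc_mult_mat[of U' m m U m A r, symmetric])
  then have A_eq: "A = U' * (J * H)" unfolding JH .
  have Ax: "A *\<^sub>v x = U' *\<^sub>v (J *\<^sub>v (H *\<^sub>v x))" if "x \<in> carrier_vec r" for x
    unfolding A_eq using c J cH that by (simp add: assoc_mult_mat_vec[of _ m r _ r] assoc_mult_mat_vec[of _ m m _ r])
  have "det H \<noteq> 0"
  proof
    assume "det H = 0"
    then obtain v where v: "v \<in> carrier_vec r" "v \<noteq> 0\<^sub>v r" "H *\<^sub>v v = 0\<^sub>v r"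
      using det_0_iff_vec_prod_zero_field[OF cH] by blast
    moreover have "J *\<^sub>v 0\<^sub>v r = 0\<^sub>v m" "U' *\<^sub>v 0\<^sub>v m = 0\<^sub>v m"
      using c J by (auto intro!: eq_vecI)
    ultimately have "A *\<^sub>v v = 0\<^sub>v m" using Ax by simp
    then show False using inj v by blast
  qed
  from det_non_zero_imp_unit[OF cH this, unfolded Units_def, of "()"]
  obtain H' where H': "H' \<in> carrier_mat r r" "H' * H = 1\<^sub>m r" "H * H' = 1\<^sub>m r"
    by (auto simp: ring_mat_def)
  have UJ: "U' * J \<in> mats m r" using mats_mult units_mats U' J by blast
  have "H' \<in> mats r r"
  proof -
    have "H' $$ (i, j) \<in> S" if ij: "i < r" "j < r" for i j
    proof -
      have "A *\<^sub>v col H' j = U' *\<^sub>v (J *\<^sub>v (H *\<^sub>v col H' j))"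
        using Ax[of "col H' j"] H' ij by simp
      also have "H *\<^sub>v col H' j = col (1\<^sub>m r) j"
        using col_mult2[OF cH H'(1) ij(2)] H'(3) by simp
      also have "J *\<^sub>v col (1\<^sub>m r) j = col J j"
        using col_mult2[OF J(1) one_carrier_mat ij(2)] J by simp
      also have "U' *\<^sub>v col J j = col (U' * J) j"
        using col_mult2[OF c(3) J(1) ij(2)] by simp
      finally have "A *\<^sub>v col H' j = col (U' * J) j" .
      then have "(A *\<^sub>v col H' j) $ i = (U' * J) $$ (i, j)" if "i < m" for i
        using ij c J that by simp
      then have "\<forall>i<m. (A *\<^sub>v col H' j) $ i \<in> S"
        using UJ ij unfolding mats_def by auto
      from sat[OF _ this] show ?thesis using H' ij by auto
    qed
    then show ?thesis using H' by (auto simp: mats_def)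
  qed
  then have Hu: "H \<in> units r" using H H' by (auto simp: units_def)
  define G where "G = four_block_mat H (0\<^sub>m r (m - r)) (0\<^sub>m (m - r) r) (1\<^sub>m (m - r))"
  have G: "G \<in> units m"
    using units_four_block[OF Hu units_one[of "m - r"] mats_zero] r unfolding G_def by simp
  have GJ: "G * J = J * H"
  proof -
    have "J = four_block_mat (1\<^sub>m r) (0\<^sub>m r 0) (0\<^sub>m (m - r) r) (0\<^sub>m (m - r) 0)"
      using r by (intro eq_matI) (auto simp: J_def unit_columns_def)
    then have "G * J = four_block_mat H (0\<^sub>m r 0) (0\<^sub>m (m - r) r) (0\<^sub>m (m - r) 0)"
      unfolding G_def using cH by (simp, subst mult_four_block_mat[of _ r r _ "m - r" _ "m - r" _ _ r _ 0]) auto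
    also have "\<dots> = J * H"
      unfolding J_def unit_columns_mult[OF cH r] using cH r by (intro eq_matI) auto
    finally show ?thesis .
  qed
  have "A = (U' * G) * J"
    unfolding A_eq GJ[symmetric] using c J units_carrier[OF G] by simp
  then show ?thesis using that[of "U' * G"] units_mult[OF U'(1) G] J_def by blast
qed

end

section \<open>Diagonal forms\<close>

definition pad_mat :: "nat \<Rightarrow> nat \<Rightarrow> 'k::zero mat \<Rightarrow> 'k mat" where
  "pad_mat m n M = mat m n (\<lambda>(i, j). if i < dim_row M \<and> j < dim_col M then M $$ (i, j) else 0)"

lemma pad_mat_carrier [simp]: "pad_mat m n M \<in> carrier_mat m n"
  by (simp add: pad_mat_def)

lemma pad_mat_dim [simp]: "dim_row (pad_mat m n M) = m" "dim_col (pad_mat m n M) = n"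
  by (simp_all add: pad_mat_def)

lemma unit_columns_pad:
  fixes M :: "'k::comm_ring_1 mat"
  assumes M: "M \<in> carrier_mat r r" and r: "r \<le> m" "r \<le> n"
  shows "unit_columns m r * M * (unit_columns n r)\<^sup>T = pad_mat m n M"
proof -
  have 1: "(unit_columns m r * M) \<in> carrier_mat m r"
    using M by (auto simp: unit_columns_def)
  have "unit_columns m r * M * (unit_columns n r)\<^sup>T = (unit_columns n r * (unit_columns m r * M)\<^sup>T)\<^sup>T"
    using 1 by (subst transpose_mult[of _ n r _ m]) auto
  also have "\<dots> = pad_mat m n M"
    using 1 M r unfolding unit_columns_mult[OF M r(1)]
    by (subst unit_columns_mult[of _ r m]) (auto intro!: eq_matI simp: pad_mat_def)
  finally show ?thesis .
qed

lemma diag_block_pad: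
  assumes "length ds = r" "r \<le> m" "r \<le> n"
  shows "diag_block m n ds = pad_mat m n (mat_diag r (\<lambda>i. ds ! i))"
  using assms by (intro eq_matI) (auto simp: diag_block_def pad_mat_def mat_diag_def)

definition reindex_mat :: "nat \<Rightarrow> (nat \<Rightarrow> nat) \<Rightarrow> 'k::{zero,one} mat" where
  "reindex_mat N p = mat N N (\<lambda>(a, b). if b = p a then 1 else 0)"

lemma reindex_mat_carrier [simp]: "reindex_mat N p \<in> carrier_mat N N"
  by (simp add: reindex_mat_def)

lemma reindex_mat_dim [simp]: "dim_row (reindex_mat N p) = N" "dim_col (reindex_mat N p) = N"
  by (simp_all add: reindex_mat_def)

lemma reindex_mat_mult:
  fixes A :: "'k::comm_ring_1 mat"
  assumes A: "A \<in> carrier_mat N n" and p: "p permutes {..<N}"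
  shows "reindex_mat N p * A = mat N n (\<lambda>(a, b). A $$ (p a, b))"
proof (rule eq_matI)
  fix a b assume "a < dim_row (mat N n (\<lambda>(a, b). A $$ (p a, b)))"
    "b < dim_col (mat N n (\<lambda>(a, b). A $$ (p a, b)))"
  then have ab: "a < N" "b < n" by auto
  have pa: "p a < N" using permutes_in_image[OF p, of a] ab by simp
  have "(reindex_mat N p * A) $$ (a, b) = (\<Sum>k\<in>{0..<N}. (if k = p a then 1 else 0) * A $$ (k, b))"
    using ab A by (simp add: scalar_prod_def reindex_mat_def)
  also have "\<dots> = (\<Sum>k\<in>{0..<N}. if k = p a then A $$ (k, b) else 0)" by (intro sum.cong) auto
  finally show "(reindex_mat N p * A) $$ (a, b) = mat N n (\<lambda>(a, b). A $$ (p a, b)) $$ (a, b)"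
    using ab pa by simp
qed (use A in auto)

context bezout_subring
begin

lemma equivalent_pad:
  assumes M: "M \<in> carrier_mat r r" and eq: "equivalent M B" and r: "r \<le> m" "r \<le> n"
  shows "equivalent (pad_mat m n M) (pad_mat m n B)"
proof -
  obtain U V where UV: "U \<in> units r" "V \<in> units r" "U * M * V = B" using equivalentE[OF eq M] .
  note c = units_carrier[OF UV(1)] units_carrier[OF UV(2)]
  have B: "B \<in> carrier_mat r r" using UV(3) c M by auto
  have pad: "pad_mat m n A = four_block_mat A (0\<^sub>m r (n - r)) (0\<^sub>m (m - r) r) (0\<^sub>m (m - r) (n - r))"
    if "A \<in> carrier_mat r r" for A :: "'k mat"
    using that r by (intro eq_matI) (auto simp: pad_mat_def)
  define U' where "U' = four_block_mat U (0\<^sub>m r (m - r)) (0\<^sub>m (m - r) r) (1\<^sub>m (m - r))"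
  define V' where "V' = four_block_mat V (0\<^sub>m r (n - r)) (0\<^sub>m (n - r) r) (1\<^sub>m (n - r))"
  have U': "U' \<in> units m"
    using units_four_block[OF UV(1) units_one[of "m - r"] mats_zero] r unfolding U'_def by simp
  have V': "V' \<in> units n"
    using units_four_block[OF UV(2) units_one[of "n - r"] mats_zero] r unfolding V'_def by simp
  have "U' * pad_mat m n M = pad_mat m n (U * M)"
    unfolding U'_def pad[OF M] using c M
    by (subst mult_four_block_mat[of _ r r _ "m - r" _ "m - r" _ _ r _ "n - r"]) (auto simp: pad)
  also have "\<dots> * V' = pad_mat m n B"
    unfolding V'_def UV(3)[symmetric] using c M
    by (subst (1 2) pad, auto)
      (subst mult_four_block_mat[of _ r r _ "n - r" _ "m - r" _ _ r _ "n - r"], auto)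
  finally show ?thesis using equivalentI[OF pad_mat_carrier U' V'] by blast
qed

lemma units_reindex_mat:
  assumes p: "p permutes {..<N}"
  shows "reindex_mat N p \<in> units N"
proof -
  let ?P = "reindex_mat N p :: 'k mat"
  have 1: "?P * ?P\<^sup>T = 1\<^sub>m N"
    unfolding reindex_mat_mult[OF transpose_carrier_mat[THEN iffD2, OF reindex_mat_carrier] p]
    using permutes_in_image[OF p] permutes_inj[OF p]
    by (intro eq_matI) (auto simp: reindex_mat_def inj_eq)
  moreover have "?P\<^sup>T * ?P = 1\<^sub>m N"
    using 1 by (intro mat_mult_left_right_inverse[OF _ _ 1]) auto
  moreover have "?P \<in> mats N N" by (auto simp: mats_def reindex_mat_def)
  ultimately show ?thesis unfolding units_def using mats_transpose by blast
qed

lemma equivalent_diag_units: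
  assumes "\<And>i. i < N \<Longrightarrow> \<exists>u\<in>S. \<exists>u'\<in>S. u * u' = 1 \<and> u * f i = g i"
  shows "equivalent (mat_diag N f) (mat_diag N g)"
proof -
  obtain u u' where u: "\<And>i. i < N \<Longrightarrow> u i \<in> S" "\<And>i. i < N \<Longrightarrow> u' i \<in> S"
    "\<And>i. i < N \<Longrightarrow> u i * u' i = 1" "\<And>i. i < N \<Longrightarrow> u i * f i = g i"
    using assms by metis
  have "mat_diag N u * mat_diag N u' = 1\<^sub>m N" "mat_diag N u' * mat_diag N u = 1\<^sub>m N"
    using u(3) unfolding mat_diag_diag
    by (auto intro!: eq_matI simp: mat_diag_def mult.commute)
  moreover have "mat_diag N u \<in> mats N N" "mat_diag N u' \<in> mats N N"
    using u by (auto simp: mats_def mat_diag_def)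
  ultimately have U: "mat_diag N u \<in> units N" unfolding units_def by blast
  have "mat_diag N u * mat_diag N f * 1\<^sub>m N = mat_diag N g"
    using u(4) unfolding mat_diag_diag
    by (auto intro!: eq_matI simp: mat_diag_def)
  then show ?thesis by (rule equivalentI[OF mat_diag_dim U units_one])
qed

lemma equivalent_diag_permute:
  assumes p: "p permutes {..<N}"
  shows "equivalent (mat_diag N h) (mat_diag N (\<lambda>i. h (p i)))"
proof -
  let ?P = "reindex_mat N p :: 'k mat"
  define X where "X = ?P * mat_diag N h"
  have X: "X \<in> carrier_mat N N" "X\<^sup>T \<in> carrier_mat N N"
    unfolding X_def by (auto intro!: mult_carrier_mat[of _ N N _ N])
  have pN: "p a < N" if "a < N" for a using permutes_in_image[OF p, of a] that by simp
  have Xe: "X $$ (a, b) = (if p a = b then h b else 0)" if "a < N" "b < N" for a b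
    unfolding X_def reindex_mat_mult[OF mat_diag_dim p] using that pN by (simp add: mat_diag_def)
  have "X * ?P\<^sup>T = (?P * X\<^sup>T)\<^sup>T"
    using X by (subst transpose_mult[of _ N N _ N]) auto
  also have "\<dots> = mat_diag N (\<lambda>i. h (p i))"
    unfolding reindex_mat_mult[OF X(2) p] using X pN permutes_inj[OF p]
    by (intro eq_matI) (auto simp: Xe mat_diag_def inj_eq)
  finally have "?P * mat_diag N h * ?P\<^sup>T = mat_diag N (\<lambda>i. h (p i))" unfolding X_def .
  then show ?thesis
    using equivalentI[OF mat_diag_dim] units_reindex_mat[OF p] units_transpose by blast
qed

text \<open>
  Let \<open>U\<close> and \<open>V\<close> diagonalize \<open>M\<close>, and let \<open>v0\<close> be the column that \<open>U\<close> maps to \<open>a\<close> times the \<open>i\<close>-th unit vector. A further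
  summand of \<open>v\<close> that is a multiple of the corner \<open>a * z\<close> is removed with the last row. What remains is a diagonal
  matrix except for the block with rows \<open>(a * y, a)\<close> and \<open>(0, a * z)\<close> in the coordinates \<open>i\<close> and \<open>n\<close>; the entry \<open>a\<close>
  divides the others, and the block is equivalent to the diagonal of \<open>a\<close> and \<open>a * y * z\<close>. In this way the
  diagonal entries \<open>a * y\<close> and \<open>a * z\<close> are replaced by \<open>a\<close> and \<open>a * y * z\<close>, which redistributes their degrees.
\<close>

lemma equivalent_border:
  assumes M: "M \<in> carrier_mat n n" and eq: "equivalent M (mat_diag n f)"
    and i: "i < n" and y: "y \<in> S" "f i = a * y" and z: "z \<in> S"
  obtains v0 :: "nat \<Rightarrow> 'k" where
    "\<And>v. (\<And>j. j < n \<Longrightarrow> \<exists>t\<in>S. v j = v0 j + a * z * t) \<Longrightarrow>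
      equivalent (four_block_mat M (mat n 1 (\<lambda>(j, _). v j)) (0\<^sub>m 1 n) (mat 1 1 (\<lambda>_. a * z)))
        (mat_diag (Suc n) (f(i := a, n := a * y * z)))"
proof -
  obtain U V where UV: "U \<in> units n" "V \<in> units n" "U * M * V = mat_diag n f"
    using equivalentE[OF eq M] .
  obtain U' where U': "U' \<in> units n" "U * U' = 1\<^sub>m n" "U' * U = 1\<^sub>m n" using unitsE UV(1) .
  note c = units_carrier[OF UV(1)] units_carrier[OF UV(2)] units_carrier[OF U'(1)]
  define E where "E = mat n 1 (\<lambda>(j, _). if j = i then a else 0)"
  define v0 where "v0 j = (U' * E) $$ (j, 0)" for j
  have E: "E \<in> carrier_mat n 1" by (simp add: E_def)
  show ?thesis
  proof (rule that)
    fix v assume "\<And>j. j < n \<Longrightarrow> \<exists>t\<in>S. v j = v0 j + a * z * t"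
    then obtain t where t: "\<And>j. j < n \<Longrightarrow> t j \<in> S" "\<And>j. j < n \<Longrightarrow> v j = v0 j + a * z * t j"
      by metis
    define T where "T = mat n 1 (\<lambda>(j, _). t j)"
    have T: "T \<in> mats n 1" using t by (auto simp: T_def mats_def)
    have cT: "T \<in> carrier_mat n 1" by (simp add: T_def)
    let ?v = "mat n 1 (\<lambda>(j, _). v j)" and ?\<alpha> = "mat 1 1 (\<lambda>_. a * z) :: 'k mat"
    have v: "?v = U' * E + (a * z) \<cdot>\<^sub>m T"
      using t c E by (intro eq_matI) (auto simp: T_def v0_def)
    define P where "P = four_block_mat U (- (U * T)) (0\<^sub>m 1 n) (1\<^sub>m 1)"
    define Q where "Q = four_block_mat V (0\<^sub>m n 1) (0\<^sub>m 1 n) (1\<^sub>m 1)"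
    have "- (U * T) \<in> mats n 1"
      using mats_mult[OF units_mats[OF UV(1)] T] by (rule mats_uminus)
    then have P: "P \<in> units (n + 1)" unfolding P_def by (intro units_four_block UV units_one)
    have Q: "Q \<in> units (n + 1)" unfolding Q_def by (intro units_four_block UV units_one mats_zero)
    define X where "X = four_block_mat (mat_diag n f) E (0\<^sub>m 1 n) ?\<alpha>"
    have Uv: "U * ?v + - (U * T * ?\<alpha>) = E"
    proof -
      have "U * ?v = U * (U' * E) + (a * z) \<cdot>\<^sub>m (U * T)"
        unfolding v using c E cT by (subst mult_add_distrib_mat[of _ n n _ 1]) auto
      moreover have "U * (U' * E) = E"
        using c E U' by (simp add: assoc_mult_mat[of U n n U' n E 1, symmetric])
      moreover have "U * T * ?\<alpha> = (a * z) \<cdot>\<^sub>m (U * T)"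
        using c cT by (intro eq_matI) (auto simp: scalar_prod_def)
      ultimately show ?thesis using E c cT by (intro eq_matI) auto
    qed
    have "P * four_block_mat M ?v (0\<^sub>m 1 n) ?\<alpha> = four_block_mat (U * M) E (0\<^sub>m 1 n) ?\<alpha>"
      unfolding P_def using c M cT
      by (subst mult_four_block_mat[of _ n n _ 1 _ 1 _ _ n _ 1]) (auto simp: Uv[simplified])
    also have "\<dots> * Q = X"
      unfolding Q_def X_def UV(3)[symmetric] using c M E
      by (subst mult_four_block_mat[of _ n n _ 1 _ 1 _ _ n _ 1]) auto
    finally have 1: "equivalent (four_block_mat M ?v (0\<^sub>m 1 n) ?\<alpha>) X"
      by (intro equivalentI[of _ "n + 1" "n + 1", OF _ P Q] four_block_carrier_mat M) auto
    (* Exchanging the columns up to sign moves the entry a to position (i, i), where it clears its row and column. *)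
    define E1 where "E1 = plane_mat (Suc n) i n 1 0 (- z) 1"
    define E2 where "E2 = plane_mat (Suc n) i n 0 (- 1) 1 y"
    have u: "E1 \<in> units (Suc n)" "E2 \<in> units (Suc n)"
      unfolding E1_def E2_def using i y z by (auto intro!: units_plane_mat uminus_mem)
    have X: "X \<in> carrier_mat (Suc n) (Suc n)"
      by (rule carrier_matI) (auto simp: X_def E_def mat_diag_def)
    have Xe: "X $$ (b, j) = (if b < n then if j < n then if b = j then f b else 0
        else if b = i then a else 0 else if j < n then 0 else a * z)"
      if "b < Suc n" "j < Suc n" for b j
      using that by (auto simp: X_def E_def mat_diag_def)
    have "E1 * X * E2 = mat_diag (Suc n) (f(i := a, n := a * y * z))"
      unfolding E1_def E2_def using i y
      by (subst plane_mat_mult[OF X], simp, simp, simp, subst mult_plane_mat[of _ "Suc n" "Suc n"])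
        (auto intro!: eq_matI simp: Xe mat_diag_def algebra_simps)
    then have "equivalent X (mat_diag (Suc n) (f(i := a, n := a * y * z)))"
      using equivalentI[OF X u] by blast
    then show "equivalent (four_block_mat M ?v (0\<^sub>m 1 n) ?\<alpha>) (mat_diag (Suc n) (f(i := a, n := a * y * z)))"
      using 1 equivalent_trans by blast
  qed
qed

end

section \<open>Determinantal divisors\<close>

lemma det_mat_sum:
  "det (mat t t (\<lambda>(a, b). X a b)) =
    (\<Sum>p | p permutes {0..<t}. signof p * (\<Prod>i = 0..<t. X i (p i)))"
proof -
  have "p i < t" if "p permutes {0..<t}" "i < t" for p i
    using permutes_in_image[OF that(1), of i] that(2) by simp
  then show ?thesis
    by (subst det_def'[of _ t]) (auto intro!: sum.cong prod.cong arg_cong2[where f = times])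
qed

lemma det_scale_rows:
  "det (mat t t (\<lambda>(a, b). c a * X a b)) = (\<Prod>a<t. c a) * det (mat t t (\<lambda>(a, b). X a b))"
  for c :: "nat \<Rightarrow> 'k::comm_ring_1"
proof -
  have "det (mat t t (\<lambda>(a, b). c a * X a b)) =
      (\<Sum>p | p permutes {0..<t}. signof p * (\<Prod>i = 0..<t. c i * X i (p i)))"
    by (simp only: det_mat_sum)
  also have "\<dots> = (\<Sum>p | p permutes {0..<t}. (\<Prod>a<t. c a) * (signof p * (\<Prod>i = 0..<t. X i (p i))))"
    by (simp add: prod.distrib atLeast0LessThan mult_ac)
  also have "\<dots> = (\<Prod>a<t. c a) * det (mat t t (\<lambda>(a, b). X a b))"
    unfolding sum_distrib_left[symmetric]
    by (simp only: det_mat_sum)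
  finally show ?thesis .
qed

text \<open>
  Multilinearity in the rows. In contrast to the Cauchy-Binet formula the sum is over all index functions, with the
  rows of \<open>Q\<close> in the order given by \<open>h\<close>, so no ordering of index sets or sign has to be handled.
\<close>

lemma det_product_expand_rows:
  fixes P :: "nat \<Rightarrow> 'i \<Rightarrow> 'k::comm_ring_1"
  assumes I: "finite I"
  shows "det (mat t t (\<lambda>(a, b). \<Sum>k\<in>I. P a k * Q k b)) =
    (\<Sum>h\<in>PiE {0..<t} (\<lambda>_. I). (\<Prod>a = 0..<t. P a (h a)) * det (mat t t (\<lambda>(a, b). Q (h a) b)))"
proof -
  have "det (mat t t (\<lambda>(a, b). \<Sum>k\<in>I. P a k * Q k b)) =
      (\<Sum>p | p permutes {0..<t}. signof p * (\<Prod>i = 0..<t. \<Sum>k\<in>I. P i k * Q k (p i)))"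
    by (simp only: det_mat_sum)
  also have "\<dots> = (\<Sum>p | p permutes {0..<t}. \<Sum>h\<in>PiE {0..<t} (\<lambda>_. I).
      signof p * (\<Prod>i = 0..<t. P i (h i) * Q (h i) (p i)))"
    by (subst prod_sum_PiE) (auto simp: I sum_distrib_left)
  also have "\<dots> = (\<Sum>h\<in>PiE {0..<t} (\<lambda>_. I). \<Sum>p | p permutes {0..<t}.
      (\<Prod>a = 0..<t. P a (h a)) * (signof p * (\<Prod>i = 0..<t. Q (h i) (p i))))"
    by (subst sum.swap) (simp add: prod.distrib mult_ac)
  also have "\<dots> = (\<Sum>h\<in>PiE {0..<t} (\<lambda>_. I).
      (\<Prod>a = 0..<t. P a (h a)) * det (mat t t (\<lambda>(a, b). Q (h a) b)))"
    unfolding sum_distrib_left[symmetric]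
    by (simp only: det_mat_sum)
  finally show ?thesis .
qed

context bezout_subring
begin

lemma det_mem:
  assumes "\<And>a b. a < t \<Longrightarrow> b < t \<Longrightarrow> X a b \<in> S"
  shows "det (mat t t (\<lambda>(a, b). X a b)) \<in> S"
proof -
  have "p i < t" if "p permutes {0..<t}" "i < t" for p i
    using permutes_in_image[OF that(1), of i] that(2) by simp
  then show ?thesis unfolding det_mat_sum
    by (auto intro!: sum_mem mult_mem prod_mem uminus_mem assms simp: sign_def)
qed

lemma sum_multiple:
  "(\<And>i. i \<in> I \<Longrightarrow> \<exists>s\<in>S. f i = c * s) \<Longrightarrow> \<exists>s\<in>S. sum f I = c * s"
proof (induction I rule: infinite_finite_induct)
  case (insert x F)
  then obtain s u where "s \<in> S" "f x = c * s" "u \<in> S" "sum f F = c * u" by blast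
  then show ?case using insert by (intro bexI[of _ "s + u"]) (auto simp: distrib_left)
qed (auto intro!: bexI[of _ 0])

lemma chain_divides:
  assumes d: "\<And>i. Suc i < r \<Longrightarrow> \<exists>s\<in>S. d (Suc i) = d i * s" and "i \<le> j" "j < r"
  shows "\<exists>s\<in>S. d j = d i * s"
  using assms(2,3)
proof (induction j rule: dec_induct)
  case base
  then show ?case by (auto intro!: bexI[of _ 1])
next
  case (step j)
  then obtain s where s: "s \<in> S" "d j = d i * s" by auto
  obtain u where "u \<in> S" "d (Suc j) = d j * u" using d step by blast
  then show ?case using s by (auto intro!: bexI[of _ "s * u"])
qed

text \<open>
  The \<open>i\<close>-th smallest element of an index set is at least \<open>i\<close>, so its entry in the divisibility chain is a multiple of
  the \<open>i\<close>-th entry.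
\<close>

lemma prod_initial_divides:
  assumes d: "\<And>i. Suc i < r \<Longrightarrow> \<exists>s\<in>S. d (Suc i) = d i * s" and X: "finite X" "X \<subseteq> {..<r}"
  shows "\<exists>s\<in>S. (\<Prod>i\<in>X. d i) = (\<Prod>i<card X. d i) * s"
  using X
proof (induction X rule: finite_linorder_max_induct)
  case empty
  then show ?case by (auto intro!: bexI[of _ 1])
next
  case (insert b A)
  then obtain s where s: "s \<in> S" "(\<Prod>i\<in>A. d i) = (\<Prod>i<card A. d i) * s" by auto
  have "card A \<le> b" using card_mono[of "{..<b}" A] insert by auto
  then obtain u where u: "u \<in> S" "d b = d (card A) * u"
    using chain_divides[of r d "card A" b] d insert by auto
  have "b \<notin> A" using insert by auto
  then show ?case using s u insert by (auto intro!: bexI[of _ "s * u"] simp: mult_ac)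
qed

text \<open>
  In the expansion of the minor by rows every term carries a product of \<open>t\<close> entries \<open>d (f a)\<close>. A term with a repeated
  index vanishes since two rows coincide, and with distinct indices the product is a multiple of the one
  over the first \<open>t\<close> indices.
\<close>

lemma minor_divisible:
  assumes eq: "equivalent (pad_mat m n (mat_diag r d)) A"
    and r: "r \<le> m" "r \<le> n"
    and d: "\<And>i. Suc i < r \<Longrightarrow> \<exists>s\<in>S. d (Suc i) = d i * s"
    and h: "\<And>a. a < t \<Longrightarrow> h a < m" and g: "\<And>b. b < t \<Longrightarrow> g b < n"
  shows "\<exists>s\<in>S. det (mat t t (\<lambda>(a, b). A $$ (h a, g b))) = (\<Prod>i<t. d i) * s"
proof -
  obtain P Q where PQ: "P \<in> units m" "Q \<in> units n" "P * pad_mat m n (mat_diag r d) * Q = A"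
    using equivalentE[OF eq pad_mat_carrier] .
  note c = units_carrier[OF PQ(1)] units_carrier[OF PQ(2)]
  have PD: "(P * pad_mat m n (mat_diag r d)) $$ (a, k) = (if k < r then P $$ (a, k) * d k else 0)"
    if ak: "a < m" "k < n" for a k
  proof -
    have "(P * pad_mat m n (mat_diag r d)) $$ (a, k) =
        (\<Sum>j\<in>{0..<m}. P $$ (a, j) * (if j < r \<and> k < r then if j = k then d k else 0 else 0))"
      using ak c by (auto simp: scalar_prod_def pad_mat_def mat_diag_def intro!: sum.cong)
    also have "\<dots> = (\<Sum>j\<in>{0..<m}. if j = k then (if k < r then P $$ (a, k) * d k else 0) else 0)"
      by (intro sum.cong) auto
    finally show ?thesis using r by auto
  qed
  have A: "A $$ (a, b) = (\<Sum>k\<in>{..<r}. P $$ (a, k) * (d k * Q $$ (k, b)))" if ab: "a < m" "b < n" for a b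
  proof -
    have "A $$ (a, b) = (\<Sum>k\<in>{0..<n}. (P * pad_mat m n (mat_diag r d)) $$ (a, k) * Q $$ (k, b))"
      unfolding PQ(3)[symmetric] using ab c by (subst index_mult_mat) (auto simp: scalar_prod_def simp del: index_mult_mat(1))
    also have "\<dots> = (\<Sum>k\<in>{0..<n}. if k < r then P $$ (a, k) * (d k * Q $$ (k, b)) else 0)"
      using ab by (intro sum.cong) (auto simp: PD simp del: index_mult_mat(1))
    also have "\<dots> = (\<Sum>k\<in>{0..<n} \<inter> {k. k < r}. P $$ (a, k) * (d k * Q $$ (k, b)))"
      by (simp add: sum.inter_restrict)
    also have "{0..<n} \<inter> {k. k < r} = {..<r}" using r by auto
    finally show ?thesis .
  qed
  have "det (mat t t (\<lambda>(a, b). A $$ (h a, g b))) =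
      det (mat t t (\<lambda>(a, b). \<Sum>k\<in>{..<r}. P $$ (h a, k) * (d k * Q $$ (k, g b))))"
    by (intro arg_cong[where f = det] eq_matI) (auto simp: A h g)
  also have "\<dots> = (\<Sum>f\<in>PiE {0..<t} (\<lambda>_. {..<r}). (\<Prod>a = 0..<t. P $$ (h a, f a)) *
      ((\<Prod>a<t. d (f a)) * det (mat t t (\<lambda>(a, b). Q $$ (f a, g b)))))"
    by (subst det_product_expand_rows) (simp_all add: det_scale_rows[where c = "\<lambda>a. d (f a)" for f])
  also have "\<exists>s\<in>S. \<dots> = (\<Prod>i<t. d i) * s"
  proof -
    have "\<exists>s\<in>S. (\<Prod>a = 0..<t. P $$ (h a, f a)) *
      ((\<Prod>a<t. d (f a)) * det (mat t t (\<lambda>(a, b). Q $$ (f a, g b)))) = (\<Prod>i<t. d i) * s"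
      if f: "f \<in> PiE {0..<t} (\<lambda>_. {..<r})" for f
    proof (cases "inj_on f {..<t}")
      case True
      have fr: "f a < r" if "a < t" for a using f that by (auto simp: PiE_def)
      have "(\<Prod>a<t. d (f a)) = (\<Prod>i\<in>f ` {..<t}. d i)" using True by (simp add: prod.reindex)
      moreover have "card (f ` {..<t}) = t" using True by (simp add: card_image)
      moreover have "f ` {..<t} \<subseteq> {..<r}" using fr by auto
      ultimately obtain s where s: "s \<in> S" "(\<Prod>a<t. d (f a)) = (\<Prod>i<t. d i) * s"
        using prod_initial_divides[of r d "f ` {..<t}"] d by auto
      have "det (mat t t (\<lambda>(a, b). Q $$ (f a, g b))) \<in> S"
        using units_mats[OF PQ(2)] order.strict_trans2[OF fr r(2)] g by (intro det_mem) (auto simp: mats_def)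
      moreover have "(\<Prod>a = 0..<t. P $$ (h a, f a)) \<in> S"
        using units_mats[OF PQ(1)] order.strict_trans2[OF fr r(1)] h by (intro prod_mem) (auto simp: mats_def)
      ultimately show ?thesis using s
        by (intro bexI[of _ "(\<Prod>a = 0..<t. P $$ (h a, f a)) * (s * det (mat t t (\<lambda>(a, b). Q $$ (f a, g b))))"])
          (auto simp: mult_ac)
    next
      case False
      then obtain a b where ab: "a < t" "b < t" "a \<noteq> b" "f a = f b" by (auto simp: inj_on_def)
      have "det (mat t t (\<lambda>(a, b). Q $$ (f a, g b))) = 0"
        by (rule det_identical_rows[of _ t a b]) (use ab in \<open>auto intro!: eq_vecI\<close>)
      then show ?thesis by (intro bexI[of _ 0]) auto
    qed
    then show ?thesis by (rule sum_multiple)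
  qed
  finally show ?thesis .
qed

text \<open>
  The leading minor of order \<open>r\<close> of a product \<open>P * pad_mat m n M * Q\<close> involves only the leading blocks of \<open>P\<close> and
  \<open>Q\<close> and is therefore a product of three determinants. This is the converse bound to
  \<open>minor_divisible\<close> for the full order.
\<close>

lemma det_divides_diag:
  assumes eq: "equivalent (pad_mat m n M) (pad_mat m n (mat_diag r d))"
    and M: "M \<in> carrier_mat r r" and r: "r \<le> m" "r \<le> n"
  shows "\<exists>s\<in>S. (\<Prod>i<r. d i) = det M * s"
proof -
  obtain P Q where PQ: "P \<in> units m" "Q \<in> units n" "P * pad_mat m n M * Q = pad_mat m n (mat_diag r d)"
    using equivalentE[OF eq pad_mat_carrier] .
  define P' where "P' = mat r r (\<lambda>(a, b). P $$ (a, b))"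
  define Q' where "Q' = mat r r (\<lambda>(a, b). Q $$ (a, b))"
  have c: "P' \<in> carrier_mat r r" "Q' \<in> carrier_mat r r" by (auto simp: P'_def Q'_def)
  note cPQ = units_carrier[OF PQ(1)] units_carrier[OF PQ(2)]
  have PM: "(P * pad_mat m n M) $$ (a, j) = (if j < r then (P' * M) $$ (a, j) else 0)"
    if aj: "a < r" "j < n" for a j
  proof -
    have "(P * pad_mat m n M) $$ (a, j) = (\<Sum>i\<in>{0..<m}. P $$ (a, i) * pad_mat m n M $$ (i, j))"
      using aj cPQ r by (simp add: scalar_prod_def)
    also have "\<dots> = (\<Sum>i\<in>{0..<m}. if i \<in> {0..<r} then (if j < r then P $$ (a, i) * M $$ (i, j) else 0) else 0)"
    proof (rule sum.cong)
      fix i assume "i \<in> {0..<m}"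
      then show "P $$ (a, i) * pad_mat m n M $$ (i, j) =
          (if i \<in> {0..<r} then (if j < r then P $$ (a, i) * M $$ (i, j) else 0) else 0)"
        using aj M by (cases "i < r"; cases "j < r") (simp_all add: pad_mat_def)
    qed simp
    also have "\<dots> = (\<Sum>i\<in>{0..<m} \<inter> {0..<r}. if j < r then P $$ (a, i) * M $$ (i, j) else 0)"
      by (rule sum.inter_restrict[symmetric]) simp
    also have "{0..<m} \<inter> {0..<r} = {0..<r}" using r by auto
    finally show ?thesis using aj M c by (auto simp: scalar_prod_def P'_def)
  qed
  have "mat_diag r d = P' * M * Q'"
  proof (rule eq_matI)
    fix a b assume "a < dim_row (P' * M * Q')" "b < dim_col (P' * M * Q')"
    then have ab: "a < r" "b < r" using c by auto
    have "mat_diag r d $$ (a, b) = (P * pad_mat m n M * Q) $$ (a, b)"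
      unfolding PQ(3) using ab r by (auto simp: pad_mat_def mat_diag_def)
    also have "\<dots> = (\<Sum>j\<in>{0..<n}. (P * pad_mat m n M) $$ (a, j) * Q $$ (j, b))"
      using ab cPQ r by (subst index_mult_mat) (auto simp: scalar_prod_def simp del: index_mult_mat(1))
    also have "\<dots> = (\<Sum>j\<in>{0..<n}. if j \<in> {0..<r} then (P' * M) $$ (a, j) * Q $$ (j, b) else 0)"
      using ab by (intro sum.cong) (auto simp: PM simp del: index_mult_mat(1))
    also have "\<dots> = (\<Sum>j\<in>{0..<n} \<inter> {0..<r}. (P' * M) $$ (a, j) * Q $$ (j, b))"
      by (rule sum.inter_restrict[symmetric]) simp
    also have "{0..<n} \<inter> {0..<r} = {0..<r}" using r by auto
    also have "(\<Sum>j\<in>{0..<r}. (P' * M) $$ (a, j) * Q $$ (j, b)) =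
        (\<Sum>j\<in>{0..<r}. (P' * M) $$ (a, j) * Q' $$ (j, b))"
      using ab by (simp add: Q'_def del: index_mult_mat(1))
    also have "\<dots> = (P' * M * Q') $$ (a, b)"
    proof -
      have "(P' * M * Q') $$ (a, b) = row (P' * M) a \<bullet> col Q' b"
        by (rule index_mult_mat(1)) (use ab c in auto)
      also have "\<dots> = (\<Sum>j\<in>{0..<r}. (P' * M) $$ (a, j) * Q' $$ (j, b))"
        unfolding scalar_prod_def using ab c M by (intro sum.cong) auto
      finally show ?thesis by (rule sym)
    qed
    finally show "mat_diag r d $$ (a, b) = (P' * M * Q') $$ (a, b)" .
  qed (use c in \<open>auto simp: mat_diag_def\<close>)
  then have "det (mat_diag r d) = det P' * det M * det Q'"
    using c M by (simp add: det_mult[of _ r])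
  moreover have "det (mat_diag r d) = (\<Prod>i<r. d i)"
  proof -
    have "mat_diag r d = mat r r (\<lambda>(a, b). d a * (if a = b then 1 else 0))"
      by (intro eq_matI) (auto simp: mat_diag_def)
    then have "det (mat_diag r d) = (\<Prod>i<r. d i) * det (mat r r (\<lambda>(a, b). if a = b then 1 else 0))"
      by (simp only: det_scale_rows)
    then show ?thesis by (simp add: one_mat_def[symmetric])
  qed
  moreover have "det P' \<in> S"
    unfolding P'_def by (rule det_mem) (use units_mats[OF PQ(1)] r in \<open>auto simp: mats_def\<close>)
  moreover have "det Q' \<in> S"
    unfolding Q'_def by (rule det_mem) (use units_mats[OF PQ(2)] r in \<open>auto simp: mats_def\<close>)
  ultimately show ?thesis by (auto intro!: bexI[of _ "det P' * det Q'"] simp: mult_ac)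
qed

end

section \<open>Bases of a column space\<close>

lemma set_cols_rat_mat: "set (cols (rat_mat N)) = map_vec to_fract ` set (cols N)"
  unfolding cols_def by (auto simp: image_iff)

lemma distinct_cols_injective:
  fixes N :: "'k::field mat"
  assumes N: "N \<in> carrier_mat m r"
    and inj: "\<And>x. x \<in> carrier_vec r \<Longrightarrow> N *\<^sub>v x = 0\<^sub>v m \<Longrightarrow> x = 0\<^sub>v r"
  shows "distinct (cols N)"
proof (rule ccontr)
  assume "\<not> distinct (cols N)"
  then obtain i j where ij: "i < r" "j < r" "i \<noteq> j" "col N i = col N j"
    using N by (auto simp: distinct_conv_nth)
  have u: "N *\<^sub>v unit_vec r k = col N k" if "k < r" for k
    using col_mult2[OF N one_carrier_mat that] N that by simp
  have "N *\<^sub>v (unit_vec r i - unit_vec r j) = 0\<^sub>v m"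
    using N ij by (subst mult_minus_distrib_mat_vec[of _ m r]) (auto simp: u)
  then have "unit_vec r i - unit_vec r j = (0\<^sub>v r :: 'k vec)" by (intro inj) auto
  then have "(unit_vec r i - unit_vec r j :: 'k vec) $ i = 0" using ij by simp
  then show False using ij by auto
qed

text \<open>
  Being a basis of the column space, considered as a vector space in its own right, is linear independence of the
  columns, because spans and dependence are the same in a subspace that contains the vectors.
\<close>

lemma basis_col_space_iff:
  fixes N :: "'k::field mat"
  assumes N: "N \<in> carrier_mat m r" and dist: "distinct (cols N)"
  shows "vectorspace.basis class_ring ((module_vec TYPE('k) m)\<lparr>carrier := vec_space.col_space m N\<rparr>)
      (set (cols N)) \<longleftrightarrow> (\<forall>x\<in>carrier_vec r. N *\<^sub>v x = 0\<^sub>v m \<longrightarrow> x = 0\<^sub>v r)"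
proof -
  interpret vec_space "TYPE('k)" m .
  let ?S = "set (cols N)"
  have S: "?S \<subseteq> carrier_vec m" using N cols_dim by blast
  have SV: "?S \<subseteq> carrier V" using S by simp
  have vs: "vectorspace class_ring (span_vs ?S)"
    unfolding vectorspace_def
    using submodule_is_module[OF span_is_submodule[OF S]] VS_Connect.class_field by blast
  have sub: "?S \<subseteq> span ?S" by (rule in_own_span[OF S])
  have gen: "LinearCombinations.module.span class_ring (vs (span ?S)) ?S = span ?S"
    using module.span_li_not_depend(1)[OF _ sub span_is_submodule[OF S]] module_axioms by simp
  have dep: "LinearCombinations.module.lin_dep class_ring (vs (span ?S)) ?S = lin_dep ?S"
    using module.span_li_not_depend(2)[OF _ sub span_is_submodule[OF S]] module_axioms by simp
  have "vectorspace.basis class_ring (vs (span ?S)) ?S \<longleftrightarrow> lin_indpt ?S"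
    using sub gen dep by (simp add: vectorspace.basis_def[OF vs])
  also have "\<dots> \<longleftrightarrow> (\<forall>x\<in>carrier_vec r. N *\<^sub>v x = 0\<^sub>v m \<longrightarrow> x = 0\<^sub>v r)"
    using lin_depI[OF N _ _ _ dist] lin_depE[OF N _ dist] by metis
  finally show ?thesis unfolding col_space_def .
qed

lemma polynomial_basis_iff_injective:
  fixes N :: "'a::field poly mat"
  assumes N: "N \<in> carrier_mat m r"
  shows "distinct (cols N) \<and> polynomial_basis m (range_space (rat_mat N)) (set (cols N)) \<longleftrightarrow>
    (\<forall>x\<in>carrier_vec r. rat_mat N *\<^sub>v x = 0\<^sub>v m \<longrightarrow> x = 0\<^sub>v r)" (is "?L \<longleftrightarrow> ?R")
proof -
  have N': "rat_mat N \<in> carrier_mat m r" using N by simp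
  have inj: "inj (map_vec to_fract :: 'a poly vec \<Rightarrow> _)"
  proof (rule injI)
    fix u v :: "'a poly vec" assume *: "map_vec to_fract u = map_vec to_fract v"
    then have "dim_vec u = dim_vec v" by (metis index_map_vec(2))
    moreover have "to_fract (u $ i) = to_fract (v $ i)" if "i < dim_vec v" for i
      using that calculation * by (metis index_map_vec(1))
    ultimately show "u = v" by (intro eq_vecI) auto
  qed
  have cols: "cols (rat_mat N) = map (map_vec to_fract) (cols N)"
    using N by (auto simp: cols_def)
  have dist: "distinct (cols (rat_mat N)) \<longleftrightarrow> distinct (cols N)"
    unfolding cols by (metis distinct_map inj inj_on_subset subset_UNIV)
  have sub: "set (cols N) \<subseteq> carrier_vec m" using N cols_dim by blast
  have *: "polynomial_basis m (range_space (rat_mat N)) (set (cols N)) \<longleftrightarrow> ?R" if "distinct (cols N)"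
    unfolding polynomial_basis_def set_cols_rat_mat[symmetric]
    using basis_col_space_iff[OF N'] that dist sub N by simp
  show ?thesis
  proof
    assume ?L then show ?R using * by blast
  next
    assume ?R
    then have "distinct (cols N)" using distinct_cols_injective[OF N'] dist by blast
    then show ?L using * \<open>?R\<close> by blast
  qed
qed

lemma minimal_basis_mat_injective:
  assumes "N \<in> carrier_mat m r" "minimal_basis_mat N"
    and "x \<in> carrier_vec r" "rat_mat N *\<^sub>v x = 0\<^sub>v m"
  shows "x = 0\<^sub>v r"
  using assms polynomial_basis_iff_injective[OF assms(1)]
  unfolding minimal_basis_mat_def minimal_basis_def by auto

lemma rank_minimal_basis_mat:
  assumes N: "N \<in> carrier_mat m r" and "minimal_basis_mat N"
  shows "vec_space.rank m (rat_mat N) = r"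
proof -
  have N': "rat_mat N \<in> carrier_mat m r" using N by simp
  have inj: "x = 0\<^sub>v r" if "x \<in> carrier_vec r" "rat_mat N *\<^sub>v x = 0\<^sub>v m" for x
    using minimal_basis_mat_injective[OF assms that] .
  have dist: "distinct (cols (rat_mat N))" using distinct_cols_injective[OF N' inj] .
  interpret vec_space "TYPE('a poly fract)" m .
  have "lin_indpt (set (cols (rat_mat N)))"
    using lin_depE[OF N' _ dist] inj by metis
  then show ?thesis using lin_indpt_full_rank[OF N' dist] by blast
qed

lemma rank_eq_range_space:
  assumes "A \<in> carrier_mat m n" "B \<in> carrier_mat m r" "range_space A = range_space B"
  shows "vec_space.rank m A = vec_space.rank m B"
  using assms by (simp add: vec_space.rank_def vec_space.col_space_def)

section \<open>Degrees in a minimal basis\<close>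

lemma basis_order_cols:
  assumes "N \<in> carrier_mat m r" "distinct (cols N)"
  shows "basis_order (set (cols N)) = (\<Sum>b<r. vec_degree (col N b))"
  using assms unfolding basis_order_def
  by (subst sum.distinct_set_conv_list)
    (auto simp: cols_def comp_def interv_sum_list_conv_sum_set_nat atLeast0LessThan)

lemma degree_le_vec_degree:
  "i < dim_vec v \<Longrightarrow> degree (v $ i) \<le> vec_degree v"
  unfolding vec_degree_def by (intro Max_ge) auto

text \<open>
  If \<open>y\<close> has a nonzero \<open>j\<close>-th coordinate, exchanging the \<open>j\<close>-th column for the polynomial vector \<open>v\<close> gives
  another polynomial basis, and by minimality the degree of \<open>v\<close> is at least that of the column. The entry is stated to be
  nonzero because in the case of a column of degree 0 the bound on the degree alone would say nothing.
\<close>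

lemma minimal_basis_exchange:
  fixes K :: "'a::field poly mat"
  assumes K: "K \<in> carrier_mat m r" "minimal_basis_mat K"
    and y: "y \<in> carrier_vec r" and v: "v \<in> carrier_vec m"
    and Ky: "rat_mat K *\<^sub>v y = map_vec to_fract v" and j: "j < r" "y $ j \<noteq> 0"
  shows "\<exists>i<m. v $ i \<noteq> 0 \<and> vec_degree (col K j) \<le> degree (v $ i)"
proof -
  define K' where "K' = mat m r (\<lambda>(i, b). if b = j then v $ i else K $$ (i, b))"
  have K': "K' \<in> carrier_mat m r" by (simp add: K'_def)
  define E where "E x = vec r (\<lambda>a. y $ a * x $ j + (if a = j then 0 else x $ a))" for x :: "'a poly fract vec"
  have E: "E x \<in> carrier_vec r" for x by (simp add: E_def)
  have vi: "to_fract (v $ i) = (\<Sum>b\<in>{0..<r}. to_fract (K $$ (i, b)) * y $ b)" if "i < m" for i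
    using arg_cong[OF Ky, of "\<lambda>u. u $ i"] that K(1) y v by (simp add: scalar_prod_def)
  have act: "rat_mat K' *\<^sub>v x = rat_mat K *\<^sub>v E x" if x: "x \<in> carrier_vec r" for x
  proof (rule eq_vecI)
    fix i assume "i < dim_vec (rat_mat K *\<^sub>v E x)"
    then have i: "i < m" using K by simp
    have "(rat_mat K' *\<^sub>v x) $ i = (\<Sum>b\<in>{0..<r}. to_fract (if b = j then v $ i else K $$ (i, b)) * x $ b)"
      using i x by (simp add: K'_def scalar_prod_def)
    also have "\<dots> = (\<Sum>b\<in>{0..<r}. (if b = j then to_fract (v $ i) * x $ j else 0)
        + (if b = j then 0 else to_fract (K $$ (i, b)) * x $ b))"
      by (intro sum.cong) auto
    also have "\<dots> = to_fract (v $ i) * x $ j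
        + (\<Sum>b\<in>{0..<r}. if b = j then 0 else to_fract (K $$ (i, b)) * x $ b)"
      using j by (simp add: sum.distrib)
    also have "\<dots> = (\<Sum>b\<in>{0..<r}. to_fract (K $$ (i, b)) * E x $ b)"
      unfolding vi[OF i] sum_distrib_right sum.distrib[symmetric]
      by (intro sum.cong) (auto simp: E_def distrib_left mult_ac)
    also have "\<dots> = (rat_mat K *\<^sub>v E x) $ i"
      using i K E by (simp add: scalar_prod_def E_def)
    finally show "(rat_mat K' *\<^sub>v x) $ i = (rat_mat K *\<^sub>v E x) $ i" .
  qed (use K K' in auto)
  have inj: "\<forall>x\<in>carrier_vec r. rat_mat K' *\<^sub>v x = 0\<^sub>v m \<longrightarrow> x = 0\<^sub>v r"
  proof (intro ballI impI)
    fix x :: "'a poly fract vec" assume x: "x \<in> carrier_vec r" "rat_mat K' *\<^sub>v x = 0\<^sub>v m"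
    then have E0: "E x = 0\<^sub>v r" using act minimal_basis_mat_injective[OF K E] by simp
    have "E x $ a = 0" if "a < r" for a using E0 that by simp
    then have e: "y $ a * x $ j + (if a = j then 0 else x $ a) = 0" if "a < r" for a
      using that by (simp add: E_def)
    have "x $ j = 0" using e[OF j(1)] j(2) by simp
    then have "x $ a = 0" if "a < r" for a using e[OF that] by (cases "a = j") auto
    then show "x = 0\<^sub>v r" using x by (intro eq_vecI) auto
  qed
  have range: "range_space (rat_mat K') = range_space (rat_mat K)"
  proof -
    have c: "rat_mat K \<in> carrier_mat m r" "rat_mat K' \<in> carrier_mat m r" using K K' by auto
    have "\<exists>x\<in>carrier_vec r. E x = z" if z: "z \<in> carrier_vec r" for z
    proof
      show "E (vec r (\<lambda>a. if a = j then z $ j / y $ j else z $ a - y $ a * (z $ j / y $ j))) = z"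
        using z j by (intro eq_vecI) (auto simp: E_def)
    qed auto
    then show ?thesis
      using K K' vec_space.col_space_eq[OF c(1)] vec_space.col_space_eq[OF c(2)] act E by auto
  qed
  from inj have pb: "distinct (cols K')" "polynomial_basis m (range_space (rat_mat K)) (set (cols K'))"
    using polynomial_basis_iff_injective[OF K'] range by auto
  have "basis_order (set (cols K)) \<le> basis_order (set (cols K'))"
    using K pb unfolding minimal_basis_mat_def minimal_basis_def by auto
  then have "(\<Sum>b<r. vec_degree (col K b)) \<le> (\<Sum>b<r. vec_degree (col K' b))"
    using basis_order_cols[OF K'] basis_order_cols[OF K(1)] K(2) pb
    unfolding minimal_basis_mat_def by simp
  moreover have "(\<Sum>b\<in>{..<r} - {j}. vec_degree (col K b)) = (\<Sum>b\<in>{..<r} - {j}. vec_degree (col K' b))"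
    using K(1) by (intro sum.cong arg_cong[where f = vec_degree] eq_vecI) (auto simp: K'_def)
  moreover have "col K' j = v" using v j by (intro eq_vecI) (auto simp: K'_def)
  ultimately have deg: "vec_degree (col K j) \<le> vec_degree v"
    using j sum.remove[of "{..<r}" j "\<lambda>b. vec_degree (col K b)"]
      sum.remove[of "{..<r}" j "\<lambda>b. vec_degree (col K' b)"] by simp
  have "v \<noteq> 0\<^sub>v m"
  proof
    assume "v = 0\<^sub>v m"
    then have "rat_mat K *\<^sub>v y = 0\<^sub>v m" unfolding Ky by (intro eq_vecI) auto
    then show False using minimal_basis_mat_injective[OF K y] j by auto
  qed
  then obtain i0 where i0: "i0 < m" "v $ i0 \<noteq> 0" using v by (metis eq_vecI index_zero_vec carrier_vecD)
  have "vec_degree v \<in> (\<lambda>i. degree (v $ i)) ` {..<dim_vec v}"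
    unfolding vec_degree_def using i0 v by (intro Max_in) auto
  then obtain i where i: "i < m" "vec_degree v = degree (v $ i)" using v by auto
  show ?thesis
  proof (cases "v $ i = 0")
    case True
    then show ?thesis using i i0 deg by auto
  next
    case False
    then show ?thesis using i deg by auto
  qed
qed

lemma finite_max_index:
  fixes f :: "'i \<Rightarrow> nat"
  assumes "finite J" "J \<noteq> {}"
  shows "\<exists>j\<in>J. \<forall>b\<in>J. f b \<le> f j"
proof -
  have "Max (f ` J) \<in> f ` J" using assms by (intro Max_in) auto
  then obtain j where "j \<in> J" "f j = Max (f ` J)" by auto
  then show ?thesis using assms by (intro bexI[of _ j]) auto
qed

text \<open>
  Subtracting polynomial parts leaves coordinates \<open>y\<close> of negative degree for which \<open>K y\<close> is still polynomial. If \<open>y\<close>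
  were nonzero, then \<open>K y\<close> would have smaller degree than some column with a nonzero coordinate, against the
  exchange property.
\<close>

lemma minimal_basis_mat_poly_saturated:
  fixes K :: "'a::field poly mat"
  assumes K: "K \<in> carrier_mat m r" "minimal_basis_mat K"
    and x: "x \<in> carrier_vec r" "\<forall>i<m. (rat_mat K *\<^sub>v x) $ i \<in> poly_fracts"
  shows "\<forall>j<r. x $ j \<in> poly_fracts"
proof (rule ccontr)
  assume nx: "\<not> (\<forall>j<r. x $ j \<in> poly_fracts)"
  have "\<forall>j. \<exists>p y. x $ j = to_fract p + y \<and> fdeg_le y (-1)" by (metis fract_split_polynomial)
  then obtain p y where py: "\<And>j. x $ j = to_fract (p j) + y j" "\<And>j. fdeg_le (y j) (-1)" by metis
  define J where "J = {j. j < r \<and> y j \<noteq> 0}"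
  obtain j0 where j0: "j0 < r" "x $ j0 \<notin> poly_fracts" using nx by blast
  then have "y j0 \<noteq> 0" using py(1)[of j0] unfolding poly_fracts_def by auto
  then have J: "finite J" "J \<noteq> {}" using j0 by (auto simp: J_def)
  obtain j where j: "j \<in> J" "\<And>b. b \<in> J \<Longrightarrow> vec_degree (col K b) \<le> vec_degree (col K j)"
    using finite_max_index[OF J, of "\<lambda>j. vec_degree (col K j)"] by auto
  have Ky: "(rat_mat K *\<^sub>v vec r y) $ i = (\<Sum>b\<in>{0..<r}. to_fract (K $$ (i, b)) * y b)" if "i < m" for i
    using K that by (simp add: scalar_prod_def)
  have "\<exists>q. (rat_mat K *\<^sub>v vec r y) $ i = to_fract q" if i: "i < m" for i
  proof -
    obtain q where q: "(rat_mat K *\<^sub>v x) $ i = to_fract q"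
      using x(2) i unfolding poly_fracts_def by auto
    have "(rat_mat K *\<^sub>v x) $ i = (\<Sum>b\<in>{0..<r}. to_fract (K $$ (i, b)) * x $ b)"
      using K i x(1) by (simp add: scalar_prod_def)
    also have "\<dots> = (\<Sum>b\<in>{0..<r}. to_fract (K $$ (i, b) * p b)) + (rat_mat K *\<^sub>v vec r y) $ i"
      unfolding Ky[OF i] sum.distrib[symmetric] by (simp add: py distrib_left)
    finally have "(rat_mat K *\<^sub>v vec r y) $ i = to_fract (q - (\<Sum>b\<in>{0..<r}. K $$ (i, b) * p b))"
      using q by (simp add: to_fract_sum)
    then show ?thesis by blast
  qed
  then obtain q where q: "\<And>i. i < m \<Longrightarrow> (rat_mat K *\<^sub>v vec r y) $ i = to_fract (q i)" by metis
  have "rat_mat K *\<^sub>v vec r y = map_vec to_fract (vec m q)"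
    using K q by (intro eq_vecI) auto
  from minimal_basis_exchange[OF K _ _ this, of j] j(1) obtain i where
    i: "i < m" "q i \<noteq> 0" "vec_degree (col K j) \<le> degree (q i)"
    by (auto simp: J_def)
  have "fdeg_le (to_fract (q i)) (int (vec_degree (col K j)) - 1)"
    unfolding q[OF i(1), symmetric] Ky[OF i(1)]
  proof (rule fdeg_le_sum)
    fix b assume b: "b \<in> {0..<r}"
    show "fdeg_le (to_fract (K $$ (i, b)) * y b) (int (vec_degree (col K j)) - 1)"
    proof (cases "y b = 0")
      case False
      have "degree (K $$ (i, b)) \<le> vec_degree (col K b)"
        using degree_le_vec_degree[of i "col K b"] K i b by simp
      also have "\<dots> \<le> vec_degree (col K j)" using j(2) False b by (auto simp: J_def)
      finally have "fdeg_le (to_fract (K $$ (i, b))) (int (vec_degree (col K j)))"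
        by (simp add: fdeg_le_to_fract)
      from fdeg_le_mult[OF this py(2)[of b]] show ?thesis by simp
    qed simp
  qed
  then show False using i by (simp add: fdeg_le_to_fract)
qed

lemma to_fract_power: "to_fract (p ^ n) = to_fract p ^ n"
  by (induction n) auto

lemma to_fract_monom: "to_fract (monom a n) = to_fract [:a:] * ind powi (int n)"
proof -
  have "monom a n = [:a:] * [:0, 1:] ^ n" by (simp add: monom_altdef)
  then show ?thesis by (simp only: to_fract_mult to_fract_power power_int_of_nat)
qed

text \<open>
  Suppose that the polynomial parts \<open>p\<close> of the coordinates have largest degree \<open>N > 0\<close>, with coefficients \<open>a\<close> at that
  degree. Then the columns, scaled to a common degree and combined with the constants \<open>a\<close>, have cancelling leading
  terms, so the combination has smaller degree than some column that occurs in it, which the exchange property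
  excludes. This is the column reducedness of a minimal basis.
\<close>

lemma minimal_basis_mat_proper_saturated:
  fixes K :: "'a::field poly mat"
  defines "k \<equiv> \<lambda>j. int (vec_degree (col K j))"
  assumes K: "K \<in> carrier_mat m r" "minimal_basis_mat K"
    and x: "x \<in> carrier_vec r"
      "\<forall>i<m. ((rat_mat K * mat_diag r (\<lambda>j. ind powi (- k j))) *\<^sub>v x) $ i \<in> proper_fracts"
  shows "\<forall>j<r. x $ j \<in> proper_fracts"
proof -
  define A where "A i b = to_fract (K $$ (i, b)) * ind powi (- k b)" for i b
  have KD: "rat_mat K * mat_diag r (\<lambda>j. ind powi (- k j)) = mat m r (\<lambda>(i, b). A i b)"
    using K by (subst mat_diag_mult_right[of _ m]) (auto intro!: eq_matI simp: A_def)
  have Ap: "fdeg_le (A i b) 0" if "i < m" "b < r" for i b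
  proof -
    have "degree (K $$ (i, b)) \<le> vec_degree (col K b)"
      using degree_le_vec_degree[of i "col K b"] K that by simp
    then have 1: "fdeg_le (to_fract (K $$ (i, b))) (k b)" by (simp add: fdeg_le_to_fract k_def)
    have 2: "fdeg_le (ind powi (- k b) :: 'a poly fract) (- k b)"
      by (simp only: fdeg_le_def fdeg_ind_powi) simp
    show ?thesis unfolding A_def using fdeg_le_mult[OF 1 2] by simp
  qed
  have "\<forall>j. \<exists>p y. x $ j = to_fract p + y \<and> fdeg_le y (-1)" by (metis fract_split_polynomial)
  then obtain p y where py: "\<And>j. x $ j = to_fract (p j) + y j" "\<And>j. fdeg_le (y j) (-1)" by metis
  have Apb: "fdeg_le (\<Sum>b\<in>{0..<r}. A i b * to_fract (p b)) 0" if i: "i < m" for i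
  proof -
    have "fdeg_le (\<Sum>b\<in>{0..<r}. A i b * x $ b) 0"
      using x i unfolding KD proper_fracts_def by (simp add: scalar_prod_def)
    moreover have "fdeg_le (\<Sum>b\<in>{0..<r}. - (A i b * y b)) 0"
    proof (intro fdeg_le_sum fdeg_le_uminus)
      fix b assume "b \<in> {0..<r}"
      then show "fdeg_le (A i b * y b) 0"
        using fdeg_le_mult[OF Ap[OF i] py(2), of b b] by (auto intro: fdeg_le_mono)
    qed
    ultimately have "fdeg_le ((\<Sum>b\<in>{0..<r}. A i b * x $ b) + (\<Sum>b\<in>{0..<r}. - (A i b * y b))) 0"
      by (rule fdeg_le_add)
    then show ?thesis unfolding sum.distrib[symmetric] by (simp add: py(1) distrib_left)
  qed
  have "degree (p b) = 0" if b: "b < r" for b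
  proof (rule ccontr)
    assume nz: "degree (p b) \<noteq> 0"
    define N where "N = Max ((\<lambda>b. degree (p b)) ` {..<r})"
    have N_ge: "degree (p b) \<le> N" if "b < r" for b
      unfolding N_def using that by (intro Max_ge) auto
    have N0: "0 < N" using N_ge[OF b] nz by simp
    have "N \<in> (\<lambda>b. degree (p b)) ` {..<r}" unfolding N_def using b by (intro Max_in) auto
    then obtain b0 where b0: "b0 < r" "degree (p b0) = N" by auto
    define a where "a b = coeff (p b) N" for b
    define J where "J = {j. j < r \<and> a j \<noteq> 0}"
    have "a b0 \<noteq> 0" using b0 N0 unfolding a_def by (metis degree_0 leading_coeff_0_iff less_irrefl)
    then have J: "finite J" "J \<noteq> {}" using b0 by (auto simp: J_def)
      obtain j where j: "j \<in> J" "\<And>b. b \<in> J \<Longrightarrow> vec_degree (col K b) \<le> vec_degree (col K j)"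
      using finite_max_index[OF J, of "\<lambda>j. vec_degree (col K j)"] by auto
    (* The truncated difference only matters where a b is nonzero, and there column b has at most the degree of column j. *)
    define w where "w b = monom (a b) (vec_degree (col K j) - vec_degree (col K b))" for b
    define q where "q i = (\<Sum>b\<in>{0..<r}. K $$ (i, b) * w b)" for i
    have "rat_mat K *\<^sub>v vec r (\<lambda>b. to_fract (w b)) = map_vec to_fract (vec m q)"
      using K by (intro eq_vecI) (auto simp: scalar_prod_def q_def to_fract_sum)
    from minimal_basis_exchange[OF K _ _ this, of j] j(1) obtain i where
      i: "i < m" "q i \<noteq> 0" "vec_degree (col K j) \<le> degree (q i)"
      by (auto simp: J_def w_def)
    have Kw: "to_fract (K $$ (i, b)) * to_fract (w b) = ind powi (k j) * (A i b * to_fract [:a b:])"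
      if "b < r" for b
    proof (cases "a b = 0")
      case False
      then have "vec_degree (col K b) \<le> vec_degree (col K j)" using j(2) that by (auto simp: J_def)
      then have "ind powi (int (vec_degree (col K j) - vec_degree (col K b))) =
          (ind powi (k j) * ind powi (- k b) :: 'a poly fract)"
        by (subst power_int_add[symmetric]) (auto simp: k_def of_nat_diff)
      then show ?thesis by (simp add: A_def w_def to_fract_monom)
    qed (simp add: w_def)
    define l where "l b = p b - monom (a b) N" for b
    have l: "fdeg_le (to_fract (l b)) (int N - 1)" if "b < r" for b
    proof -
      have "degree (l b) \<le> N - 1"
      proof (rule degree_le, intro allI impI)
        fix e assume "N - 1 < e"
        then have "e = N \<or> degree (p b) < e" using N_ge[OF that] by auto
        then show "coeff (l b) e = 0" by (auto simp: l_def a_def coeff_eq_0)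
      qed
      then have "degree (l b) < N" using N0 by linarith
      then show ?thesis by (simp add: fdeg_le_to_fract)
    qed
    (* The leading terms are the difference between the full combination, which is proper, and the lower terms. *)
    have "to_fract (q i) * ind powi (int N) =
        ind powi (k j) * (\<Sum>b\<in>{0..<r}. A i b * (to_fract [:a b:] * ind powi (int N)))"
      unfolding q_def to_fract_sum to_fract_mult sum_distrib_right sum_distrib_left
    proof (rule sum.cong)
      fix b assume "b \<in> {0..<r}"
      then have "to_fract (K $$ (i, b)) * to_fract (w b) * ind powi (int N) =
          ind powi (k j) * (A i b * to_fract [:a b:]) * ind powi (int N)" using Kw by simp
      then show "to_fract (K $$ (i, b)) * to_fract (w b) * ind powi (int N) =
          ind powi (k j) * (A i b * (to_fract [:a b:] * ind powi (int N)))"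
        by (simp only: mult_ac)
    qed simp
    also have "(\<Sum>b\<in>{0..<r}. A i b * (to_fract [:a b:] * ind powi (int N))) =
        (\<Sum>b\<in>{0..<r}. A i b * to_fract (p b)) + (\<Sum>b\<in>{0..<r}. - (A i b * to_fract (l b)))"
      unfolding sum.distrib[symmetric] to_fract_monom[symmetric]
      by (intro sum.cong) (simp_all add: l_def algebra_simps)
    finally have e: "to_fract (q i) * ind powi (int N) = ind powi (k j) *
        ((\<Sum>b\<in>{0..<r}. A i b * to_fract (p b)) + (\<Sum>b\<in>{0..<r}. - (A i b * to_fract (l b))))" .
    have "fdeg_le (\<Sum>b\<in>{0..<r}. - (A i b * to_fract (l b))) (int N - 1)"
    proof (intro fdeg_le_sum fdeg_le_uminus)
      fix b assume "b \<in> {0..<r}"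
      then show "fdeg_le (A i b * to_fract (l b)) (int N - 1)"
        using fdeg_le_mult[OF Ap[OF i(1)] l, of b b] by simp
    qed
    moreover have "fdeg_le (\<Sum>b\<in>{0..<r}. A i b * to_fract (p b)) (int N - 1)"
      using Apb[OF i(1)] N0 by (auto intro: fdeg_le_mono)
    ultimately have "fdeg_le ((\<Sum>b\<in>{0..<r}. A i b * to_fract (p b)) +
        (\<Sum>b\<in>{0..<r}. - (A i b * to_fract (l b)))) (int N - 1)" by (intro fdeg_le_add)
    moreover have "fdeg_le (ind powi (k j) :: 'a poly fract) (k j)" by (simp add: fdeg_le_def fdeg_ind_powi)
    ultimately have "fdeg_le (to_fract (q i) * ind powi (int N)) (k j + (int N - 1))"
      unfolding e by (intro fdeg_le_mult)
    moreover have "to_fract (q i) * ind powi (int N) \<noteq> 0" using i by simp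
    ultimately have "fdeg (to_fract (q i) * ind powi (int N)) \<le> k j + (int N - 1)"
      unfolding fdeg_le_def by blast
    also have "fdeg (to_fract (q i) * ind powi (int N)) = int (degree (q i)) + int N"
      using i fdeg_mult[of "to_fract (q i)" "ind powi (int N)"] fdeg_to_fract[of "q i"]
      by (simp only: fdeg_ind_powi) simp
    finally show False using i by (simp add: k_def)
  qed
  then have "fdeg_le (to_fract (p j)) 0" if "j < r" for j
    using that by (simp add: fdeg_le_to_fract)
  then show ?thesis
    unfolding proper_fracts_def using fdeg_le_mono[OF py(2), of 0] by (auto simp: py(1) intro: fdeg_le_add)
qed

lemma minimal_basis_mat_poly_completion:
  fixes K :: "'a::field poly mat"
  assumes K: "K \<in> carrier_mat m r" "minimal_basis_mat K" and r: "r \<le> m"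
  obtains W where "W \<in> poly_fracts.units m" "rat_mat K = W * unit_columns m r"
proof (rule poly_fracts.saturated_completion[of "rat_mat K" m r])
  show "rat_mat K \<in> poly_fracts.mats m r"
    unfolding poly_fracts.mats_def using K by (auto simp: poly_fracts_def)
  show "x = 0\<^sub>v r" if "x \<in> carrier_vec r" "rat_mat K *\<^sub>v x = 0\<^sub>v m" for x
    using minimal_basis_mat_injective[OF K that] .
qed (use minimal_basis_mat_poly_saturated[OF K] r that in auto)

lemma ind_powi_nonzero [simp]: "(ind :: 'a::field poly fract) powi k \<noteq> 0"
  by simp

lemma minimal_basis_mat_proper_completion:
  fixes K :: "'a::field poly mat"
  defines "D \<equiv> mat_diag (dim_col K) (\<lambda>j. ind powi (- int (vec_degree (col K j))))"
  assumes K: "K \<in> carrier_mat m r" "minimal_basis_mat K" and r: "r \<le> m"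
  obtains W where "W \<in> proper_fracts.units m" "rat_mat K * D = W * unit_columns m r"
proof (rule proper_fracts.saturated_completion[of "rat_mat K * D" m r])
  have dim: "dim_col K = r" using K by simp
  have cK: "rat_mat K \<in> carrier_mat m r" using K by simp
  have cD: "D \<in> carrier_mat r r" unfolding D_def dim by simp
  show "rat_mat K * D \<in> proper_fracts.mats m r"
    unfolding D_def dim mat_diag_mult_right[OF cK] proper_fracts.mats_def unfolding proper_fracts_def
  proof (intro CollectI conjI allI impI)
    fix i b assume ib: "i < m" "b < r"
    have "degree (K $$ (i, b)) \<le> vec_degree (col K b)"
      using degree_le_vec_degree[of i "col K b"] K ib by simp
    then have 1: "fdeg_le (to_fract (K $$ (i, b))) (int (vec_degree (col K b)))"
      by (simp add: fdeg_le_to_fract)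
    have 2: "fdeg_le (ind powi (- int (vec_degree (col K b))) :: 'a poly fract)
        (- int (vec_degree (col K b)))"
      by (simp only: fdeg_le_def fdeg_ind_powi) simp
    have "fdeg_le (to_fract (K $$ (i, b)) * ind powi (- int (vec_degree (col K b)))) 0"
      using fdeg_le_mult[OF 1 2] by simp
    then show "fdeg_le (mat m r (\<lambda>(i, j). rat_mat K $$ (i, j) *
        ind powi (- int (vec_degree (col K j)))) $$ (i, b)) 0"
      using ib K by simp
  qed simp
  show "x = 0\<^sub>v r" if x: "x \<in> carrier_vec r" "rat_mat K * D *\<^sub>v x = 0\<^sub>v m" for x
  proof -
    have "rat_mat K *\<^sub>v (D *\<^sub>v x) = 0\<^sub>v m"
      using x assoc_mult_mat_vec[OF cK cD x(1)] by simp
    then have "D *\<^sub>v x = 0\<^sub>v r" using minimal_basis_mat_injective[OF K] cD x by auto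
    moreover have "(D *\<^sub>v x) $ i = ind powi (- int (vec_degree (col K i))) * x $ i" if "i < r" for i
    proof -
      have "(D *\<^sub>v x) $ i =
          (\<Sum>j\<in>{0..<r}. (if i = j then ind powi (- int (vec_degree (col K j))) else 0) * x $ j)"
        using that x(1) unfolding D_def dim by (simp add: mat_diag_def scalar_prod_def)
      also have "\<dots> = (\<Sum>j\<in>{0..<r}.
          if j = i then ind powi (- int (vec_degree (col K i))) * x $ i else 0)"
        by (intro sum.cong) auto
      finally show ?thesis using that by simp
    qed
    ultimately show ?thesis using x by (intro eq_vecI) auto
  qed
  show "\<forall>j<r. x $ j \<in> proper_fracts"
    if "x \<in> carrier_vec r" "\<forall>i<m. (rat_mat K * D *\<^sub>v x) $ i \<in> proper_fracts" for x
    using minimal_basis_mat_proper_saturated[OF K that(1)] that(2) unfolding D_def dim by blast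
qed (use r that in auto)

section \<open>Majorization\<close>

text \<open>
  For an increasing sequence \<open>x\<close> this says that \<open>d\<close>, once sorted, is majorized by \<open>x\<close>. Quantifying over all index sets
  instead of sorting \<open>d\<close> lets single entries be removed from \<open>d\<close> without reordering.
\<close>

definition dominates :: "(nat \<Rightarrow> int) \<Rightarrow> (nat \<Rightarrow> int) \<Rightarrow> nat \<Rightarrow> bool" where
  "dominates x d r \<longleftrightarrow> (\<forall>T\<subseteq>{..<r}. (\<Sum>i<card T. x i) \<le> (\<Sum>j\<in>T. d j)) \<and>
     (\<Sum>i<r. x i) = (\<Sum>j<r. d j)"

lemma dominates_cong:
  assumes "\<And>i. i < r \<Longrightarrow> x i = x' i" "\<And>j. j < r \<Longrightarrow> d j = d' j"
  shows "dominates x d r \<longleftrightarrow> dominates x' d' r"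
proof -
  have "(\<Sum>i<card T. x i) = (\<Sum>i<card T. x' i)" "(\<Sum>j\<in>T. d j) = (\<Sum>j\<in>T. d' j)" if "T \<subseteq> {..<r}" for T
    using that assms card_mono[of "{..<r}" T] by (auto intro!: sum.cong)
  from this this(1)[of "{..<r}"] this(2)[of "{..<r}"] show ?thesis
    unfolding dominates_def by simp
qed

lemma initial_sum_le:
  fixes y :: "nat \<Rightarrow> int"
  assumes mono: "\<And>i j. i \<le> j \<Longrightarrow> j < r \<Longrightarrow> y i \<le> y j" and X: "finite X" "X \<subseteq> {..<r}"
  shows "(\<Sum>i<card X. y i) \<le> (\<Sum>i\<in>X. y i)"
  using X
proof (induction X rule: finite_linorder_max_induct)
  case (insert b A)
  have "card A \<le> b" using card_mono[of "{..<b}" A] insert by auto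
  then have "y (card A) \<le> y b" using mono insert by auto
  moreover have "b \<notin> A" using insert by auto
  ultimately show ?case using insert by auto
qed simp

lemma sum_list_take: "k \<le> length xs \<Longrightarrow> sum_list (take k xs) = (\<Sum>i<k. xs ! i)"
  by (simp add: sum_list_sum_nth atLeast0LessThan)

lemma sum_list_take_rev:
  fixes xs :: "int list"
  assumes "k \<le> length xs"
  shows "sum_list (take k (rev xs)) = sum_list xs - (\<Sum>i<length xs - k. xs ! i)"
proof -
  have "sum_list (take k (rev xs)) = sum_list (drop (length xs - k) xs)"
    by (simp add: take_rev)
  moreover have "sum_list xs = sum_list (take (length xs - k) xs) + sum_list (drop (length xs - k) xs)"
    by (metis append_take_drop_id sum_list_append)
  ultimately show ?thesis using sum_list_take[of "length xs - k" xs] by simp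
qed

text \<open>
  The partial sums in the definition of majorization take the largest entries. Subtracted from the total, they become
  sums over the smallest entries, and a sum over \<open>t\<close> smallest entries is the least of all sums over \<open>t\<close> indices.
\<close>

lemma majorized_iff_dominates:
  fixes zs :: "nat list" and xs :: "int list"
  assumes len: "length zs = r" "length xs = r"
  shows "map (\<lambda>x. - int x) (sort zs) \<prec>\<^sub>m rev xs \<longleftrightarrow>
    dominates (\<lambda>i. xs ! i) (\<lambda>j. - int (zs ! j)) r"
proof -
  define y where "y i = int (sort zs ! i)" for i
  have y_mono: "y i \<le> y j" if "i \<le> j" "j < r" for i j
    using that len by (simp add: y_def sorted_nth_mono)
  obtain p where p: "p permutes {..<length (sort zs)}" "permute_list p (sort zs) = zs"
    using mset_eq_permutation[of zs "sort zs"] by auto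
  have pr: "p permutes {..<r}" using p len by simp
  have zp: "int (zs ! j) = y (p j)" if "j < r" for j
    using p(2) permute_list_nth[OF p(1), of j] that len by (simp add: y_def)
  have tot: "(\<Sum>j<r. int (zs ! j)) = (\<Sum>i<r. y i)"
    using sum.permute[OF pr, of y] by (simp add: zp comp_def)
  have compl: "(\<Sum>j\<in>T. - int (zs ! j)) = - (\<Sum>i<r. y i) + (\<Sum>j\<in>{..<r} - T. int (zs ! j))" if "T \<subseteq> {..<r}" for T
    using sum.subset_diff[OF that, of "\<lambda>j. int (zs ! j)"] tot by (simp add: sum_negf)
  have lower: "(\<Sum>i<card X. y i) \<le> (\<Sum>j\<in>X. int (zs ! j))" if X: "X \<subseteq> {..<r}" for X
  proof -
    have fin: "finite X" using X finite_subset by auto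
    have inj: "inj_on p X" by (rule permutes_inj_on[OF pr])
    have "(\<Sum>j\<in>X. int (zs ! j)) = (\<Sum>j\<in>p ` X. y j)"
      unfolding sum.reindex[OF inj] using X by (intro sum.cong) (auto simp: zp)
    moreover have "p ` X \<subseteq> {..<r}" using X permutes_image[OF pr] by blast
    ultimately show ?thesis
      using initial_sum_le[of r y "p ` X"] y_mono fin card_image[OF inj] by simp
  qed
  have attained: "\<exists>X\<subseteq>{..<r}. card X = t \<and> (\<Sum>j\<in>X. int (zs ! j)) = (\<Sum>i<t. y i)" if "t \<le> r" for t
  proof (intro exI conjI)
    let ?X = "inv_into UNIV p ` {..<t}"
    have ip: "inv_into UNIV p permutes {..<r}" by (rule permutes_inv[OF pr])
    have inj: "inj_on (inv_into UNIV p) {..<t}" by (rule permutes_inj_on[OF ip])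
    show X: "?X \<subseteq> {..<r}" using permutes_image[OF ip] that by auto
    show "card ?X = t" using card_image[OF inj] by simp
    show "(\<Sum>j\<in>?X. int (zs ! j)) = (\<Sum>i<t. y i)"
      unfolding sum.reindex[OF inj] using X zp permutes_inverses(1)[OF pr]
      by (intro sum.cong) (auto simp: image_subset_iff)
  qed
  have totx: "sum_list xs = (\<Sum>i<r. xs ! i)" using sum_list_take[of r xs] len by simp
  have a_take: "sum_list (take k (map (\<lambda>x. - int x) (sort zs))) = - (\<Sum>i<k. y i)" if "k \<le> r" for k
    using that len by (subst sum_list_take) (auto simp: y_def sum_negf[symmetric] intro!: sum.cong)
  have a_tot: "sum_list (map (\<lambda>x. - int x) (sort zs)) = - (\<Sum>i<r. y i)"
    using a_take[of r] len by simp
  have x_take: "sum_list (take k (rev xs)) = (\<Sum>i<r. xs ! i) - (\<Sum>i<r - k. xs ! i)" if "k \<le> r" for k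
    using sum_list_take_rev[of k xs] that len totx by simp
  have maj: "map (\<lambda>x. - int x) (sort zs) \<prec>\<^sub>m rev xs \<longleftrightarrow>
     (\<forall>k\<in>{1..<r}. - (\<Sum>i<k. y i) \<le> (\<Sum>i<r. xs ! i) - (\<Sum>i<r - k. xs ! i)) \<and>
     - (\<Sum>i<r. y i) = (\<Sum>i<r. xs ! i)"
    unfolding majorized_def using len a_take x_take a_tot totx by auto
  show ?thesis
  proof
    assume "map (\<lambda>x. - int x) (sort zs) \<prec>\<^sub>m rev xs"
    then have 1: "\<And>k. k \<in> {1..<r} \<Longrightarrow> - (\<Sum>i<k. y i) \<le> (\<Sum>i<r. xs ! i) - (\<Sum>i<r - k. xs ! i)"
      and 2: "- (\<Sum>i<r. y i) = (\<Sum>i<r. xs ! i)" using maj by auto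
    show "dominates (\<lambda>i. xs ! i) (\<lambda>j. - int (zs ! j)) r"
      unfolding dominates_def
    proof (intro conjI allI impI)
      show "(\<Sum>i<r. xs ! i) = (\<Sum>j<r. - int (zs ! j))" using 2 tot by (simp add: sum_negf)
      fix T :: "nat set" assume T: "T \<subseteq> {..<r}"
      then have fin: "finite T" and cT: "card T \<le> r" using finite_subset card_mono[of "{..<r}" T] by auto
      have c: "card ({..<r} - T) = r - card T" using T fin by (simp add: card_Diff_subset)
      have "(\<Sum>i<card T. xs ! i) \<le> (\<Sum>i<r. xs ! i) + (\<Sum>i<r - card T. y i)"
      proof -
        consider "card T = 0" | "card T = r" | "r - card T \<in> {1..<r}" using cT by fastforce
        then show ?thesis
        proof cases
          case 1
          then show ?thesis using 2 by simp
        next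
          case 2
          then show ?thesis by simp
        next
          case 3
          then show ?thesis using 1[OF 3] cT by simp
        qed
      qed
      also have "\<dots> \<le> (\<Sum>j\<in>T. - int (zs ! j))"
        using lower[of "{..<r} - T"] compl[OF T] c 2 by simp
      finally show "(\<Sum>i<card T. xs ! i) \<le> (\<Sum>j\<in>T. - int (zs ! j))" .
    qed
  next
    assume dom: "dominates (\<lambda>i. xs ! i) (\<lambda>j. - int (zs ! j)) r"
    have 2: "- (\<Sum>i<r. y i) = (\<Sum>i<r. xs ! i)"
      using dom tot unfolding dominates_def by (simp add: sum_negf)
    have "- (\<Sum>i<k. y i) \<le> (\<Sum>i<r. xs ! i) - (\<Sum>i<r - k. xs ! i)" if k: "k \<in> {1..<r}" for k
    proof -
      obtain X where X: "X \<subseteq> {..<r}" "card X = k" "(\<Sum>j\<in>X. int (zs ! j)) = (\<Sum>i<k. y i)"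
        using attained[of k] k by auto
      have fin: "finite X" using X finite_subset by auto
      have "card ({..<r} - X) = r - k" using X fin by (simp add: card_Diff_subset)
      then have "(\<Sum>i<r - k. xs ! i) \<le> (\<Sum>j\<in>{..<r} - X. - int (zs ! j))"
        using dom unfolding dominates_def by (metis Diff_subset)
      moreover have "{..<r} - ({..<r} - X) = X" using X by auto
      ultimately show ?thesis using compl[of "{..<r} - X"] X 2 by auto
    qed
    then show "map (\<lambda>x. - int x) (sort zs) \<prec>\<^sub>m rev xs" using maj 2 by blast
  qed
qed

section \<open>Nonzero minors of large weight\<close>

text \<open>
  If two terms are moved apart while their sum is kept, the sum of the largest terms can only grow: an index set that
  contains exactly one of the two is changed to contain the larger one, \<open>a\<close>.
\<close>

lemma exchange_pair_sum:
  fixes e e' :: "'i \<Rightarrow> int"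
  assumes T: "finite T" and ab: "a \<noteq> b" and off: "\<And>j. j \<noteq> a \<Longrightarrow> j \<noteq> b \<Longrightarrow> e j = e' j"
    and ge: "e' a \<le> e a" "e' b \<le> e a" and tot: "e a + e b = e' a + e' b"
  shows "\<exists>T'\<subseteq>T \<union> {a}. card T' = card T \<and> sum e' T \<le> sum e T'"
proof -
  let ?C = "T - {a, b}"
  have C: "sum e ?C = sum e' ?C" by (intro sum.cong) (auto simp: off)
  have fin: "finite ?C" "a \<notin> ?C" "b \<notin> ?C" using T by auto
  consider "a \<in> T" "b \<in> T" | "a \<in> T" "b \<notin> T" | "a \<notin> T" "b \<in> T" | "a \<notin> T" "b \<notin> T" by blast
  then show ?thesis
  proof cases
    case 1
    then have "T = insert a (insert b ?C)" by auto
    then have "sum f T = f a + (f b + sum f ?C)" for f :: "'i \<Rightarrow> int"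
      using fin ab by (metis Diff_iff insert_iff sum.insert finite_insert)
    then show ?thesis using C tot by (intro exI[of _ T]) auto
  next
    case 2
    then have "T = insert a ?C" by auto
    then have "sum f T = f a + sum f ?C" for f :: "'i \<Rightarrow> int"
      using fin by (metis sum.insert)
    then show ?thesis using C ge by (intro exI[of _ T]) auto
  next
    case 3
    then have T': "T = insert b ?C" by auto
    then have "sum e' T = e' b + sum e' ?C" using fin by (metis sum.insert)
    moreover have "sum e (insert a ?C) = e a + sum e ?C" using fin by simp
    moreover have "card (insert a ?C) = card T"
      using fin T' by (metis card_insert_disjoint)
    ultimately show ?thesis using C ge by (intro exI[of _ "insert a ?C"]) auto
  next
    case 4
    then have "?C = T" by auto
    then show ?thesis using C by (intro exI[of _ T]) auto
  qed
qed

text \<open>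
  Pairing the largest \<open>l\<close> with the smallest \<open>k\<close> minimizes the sums of largest terms. In an arbitrary pairing, swap
  partners so that \<open>l 0\<close> is paired with \<open>k (r - 1)\<close>; this moves two terms towards each other (\<open>exchange_pair_sum\<close>), and
  the remaining pairs are treated by induction.
\<close>

lemma antisorted_sum_le:
  fixes k l :: "nat \<Rightarrow> int"
  assumes "\<And>i j. i \<le> j \<Longrightarrow> j < r \<Longrightarrow> k j \<le> k i" "\<And>i j. i \<le> j \<Longrightarrow> j < r \<Longrightarrow> l j \<le> l i"
    and "inj_on \<sigma> {..<r}" "\<sigma> ` {..<r} \<subseteq> {..<r}" and "T \<subseteq> {..<r}"
  shows "\<exists>T'\<subseteq>{..<r}. card T' = card T \<and> (\<Sum>j\<in>T. k (r - 1 - j) + l j) \<le> (\<Sum>j\<in>T'. k (\<sigma> j) + l j)"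
  using assms
proof (induction r arbitrary: l \<sigma> T)
  case 0
  then show ?case by auto
next
  case (Suc r)
  note k = Suc.prems(1) and l = Suc.prems(2)
  have "\<sigma> ` {..<Suc r} = {..<Suc r}"
    using Suc.prems(3,4) by (intro endo_inj_surj) auto
  then obtain j0 where j0: "j0 < Suc r" "\<sigma> j0 = r" by (metis imageE lessI lessThan_iff)
  (* The pairing after the swap of the partners of 0 and j0; T1 and T2 collect the positive indices, shifted down by one. *)
  define \<tau> where "\<tau> = (\<lambda>j. \<sigma> (if j = 0 then j0 else if j = j0 then 0 else j))"
  have \<tau>inj: "inj_on \<tau> {..<Suc r}"
  proof -
    define s where "s j = (if j = 0 then j0 else if j = j0 then 0 else j)" for j
    have s: "inj_on s {..<Suc r}" "s ` {..<Suc r} \<subseteq> {..<Suc r}"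
      using j0(1) by (auto simp: inj_on_def s_def split: if_splits)
    have "\<tau> = \<sigma> \<circ> s" by (auto simp: \<tau>_def s_def)
    then show ?thesis
      using comp_inj_on[OF s(1) inj_on_subset[OF Suc.prems(3) s(2)]] by simp
  qed
  have \<tau>r: "\<tau> j < Suc r" if "j < Suc r" for j
    using Suc.prems(4) j0(1) that unfolding \<tau>_def by auto
  have \<tau>0: "\<tau> 0 = r" using j0 by (simp add: \<tau>_def)
  have \<tau>s: "\<tau> (Suc j) < r" if "j < r" for j
    using \<tau>r[of "Suc j"] inj_onD[OF \<tau>inj, of "Suc j" 0] \<tau>0 that by fastforce
  define T1 where "T1 = {j. Suc j \<in> T}"
  have T: "T \<subseteq> {..<Suc r}" by (rule Suc.prems)
  have T1: "T1 \<subseteq> {..<r}" using T by (auto simp: T1_def)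
  have T_eq: "T = (T \<inter> {0}) \<union> Suc ` T1"
    unfolding T1_def by (auto simp: image_iff) (metis not0_implies_Suc)
  have fin: "finite T1" using T1 finite_subset by auto
  obtain T2 where T2: "T2 \<subseteq> {..<r}" "card T2 = card T1"
    "(\<Sum>j\<in>T1. k (r - 1 - j) + l (Suc j)) \<le> (\<Sum>j\<in>T2. k (\<tau> (Suc j)) + l (Suc j))"
  proof -
    have "inj_on (\<lambda>j. \<tau> (Suc j)) {..<r}"
      using \<tau>inj by (auto simp: inj_on_def)
    moreover have "(\<lambda>j. \<tau> (Suc j)) ` {..<r} \<subseteq> {..<r}" using \<tau>s by auto
    ultimately have "\<exists>T2\<subseteq>{..<r}. card T2 = card T1 \<and>
        (\<Sum>j\<in>T1. k (r - 1 - j) + l (Suc j)) \<le> (\<Sum>j\<in>T2. k (\<tau> (Suc j)) + l (Suc j))"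
      by (intro Suc.IH k l T1) auto
    then show ?thesis using that by blast
  qed
  have fin2: "finite T2" using T2 finite_subset by auto
  have split: "sum f ((T \<inter> {0}) \<union> Suc ` X) = sum f (T \<inter> {0}) + (\<Sum>j\<in>X. f (Suc j))"
    "card ((T \<inter> {0}) \<union> Suc ` X) = card (T \<inter> {0}) + card X"
    if "finite X" for f :: "nat \<Rightarrow> int" and X
  proof -
    show "sum f ((T \<inter> {0}) \<union> Suc ` X) = sum f (T \<inter> {0}) + (\<Sum>j\<in>X. f (Suc j))"
      using that by (subst sum.union_disjoint) (auto simp: sum.reindex)
    show "card ((T \<inter> {0}) \<union> Suc ` X) = card (T \<inter> {0}) + card X"
      using that by (subst card_Un_disjoint) (auto simp: card_image)
  qed
  define T3 where "T3 = (T \<inter> {0}) \<union> Suc ` T2"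
  have T3: "T3 \<subseteq> {..<Suc r}" using T2 by (auto simp: T3_def)
  have c3: "card T3 = card T" unfolding T3_def by (subst (2) T_eq) (simp add: split fin fin2 T2)
  have s3: "(\<Sum>j\<in>T. k (Suc r - 1 - j) + l j) \<le> (\<Sum>j\<in>T3. k (\<tau> j) + l j)"
  proof -
    have "(\<Sum>j\<in>T. k (Suc r - 1 - j) + l j) =
        (\<Sum>j\<in>T \<inter> {0}. k (Suc r - 1 - j) + l j) + (\<Sum>j\<in>T1. k (r - 1 - j) + l (Suc j))"
      by (subst T_eq) (simp add: split fin)
    moreover have "(\<Sum>j\<in>T \<inter> {0}. k (Suc r - 1 - j) + l j) = (\<Sum>j\<in>T \<inter> {0}. k (\<tau> j) + l j)"
      by (intro sum.cong) (auto simp: \<tau>0)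
    ultimately show ?thesis using T2(3) unfolding T3_def by (simp add: split fin2)
  qed
  show ?case
  proof (cases "j0 = 0")
    case True
    then have "\<tau> = \<sigma>" by (auto simp: \<tau>_def)
    then show ?thesis using T3 c3 s3 by blast
  next
    case False
    have fin3: "finite T3" using T3 finite_subset by auto
    have s0: "\<sigma> 0 < Suc r" using Suc.prems(4) by auto
    have "\<exists>T'\<subseteq>T3 \<union> {0}. card T' = card T3 \<and>
        (\<Sum>j\<in>T3. k (\<tau> j) + l j) \<le> (\<Sum>j\<in>T'. k (\<sigma> j) + l j)"
      by (rule exchange_pair_sum[OF fin3, of 0 j0])
        (use False j0 s0 k[of "\<sigma> 0" r] l[of 0 j0] in \<open>auto simp: \<tau>_def\<close>)
    then obtain T' where T': "T' \<subseteq> T3 \<union> {0}" "card T' = card T3"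
      "(\<Sum>j\<in>T3. k (\<tau> j) + l j) \<le> (\<Sum>j\<in>T'. k (\<sigma> j) + l j)" by blast
    have "T' \<subseteq> {..<Suc r}" using T'(1) T3 by auto
    then show ?thesis using T'(2,3) c3 s3 by (intro exI[of _ T']) auto
  qed
qed

text \<open>
  To row \<open>j\<close> add a combination of earlier rows for which the first nonzero entry lies as far to the right as possible. Two rows
  with the same leading column would contradict this choice for the later one. Taking the maximum directly avoids
  running an elimination.
\<close>

lemma row_echelon_leads:
  fixes M :: "nat \<Rightarrow> nat \<Rightarrow> 'k::field"
  assumes inj: "\<And>b. (\<forall>c<r. (\<Sum>i<r. b i * M i c) = 0) \<Longrightarrow> \<forall>i<r. b i = 0"
  obtains B \<sigma> where "inj_on \<sigma> {..<r}" "\<sigma> ` {..<r} \<subseteq> {..<r}"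
    "\<And>j i. j < i \<Longrightarrow> B j i = 0"
    "\<And>j. j < r \<Longrightarrow> (\<Sum>i<r. B j i * M i (\<sigma> j)) \<noteq> 0"
    "\<And>j c. j < r \<Longrightarrow> c < \<sigma> j \<Longrightarrow> (\<Sum>i<r. B j i * M i c) = 0"
proof -
  define u where "u b c = (\<Sum>i<r. b i * M i c)" for b c
  define C where "C j = {b :: nat \<Rightarrow> 'k. b j = 1 \<and> (\<forall>i>j. b i = 0)}" for j
  define lead where "lead b p \<longleftrightarrow> p < r \<and> u b p \<noteq> 0 \<and> (\<forall>c<p. u b c = 0)" for b p
  have ex: "\<exists>p. lead b p" if "j < r" "b \<in> C j" for j b
  proof -
    have "b j \<noteq> 0" using that by (simp add: C_def)
    then have "\<exists>c. c < r \<and> u b c \<noteq> 0" using inj[of b] that unfolding u_def by blast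
    then have "(LEAST c. c < r \<and> u b c \<noteq> 0) < r \<and> u b (LEAST c. c < r \<and> u b c \<noteq> 0) \<noteq> 0"
      by (rule LeastI_ex)
    moreover have "u b c = 0" if "c < (LEAST c. c < r \<and> u b c \<noteq> 0)" for c
      using not_less_Least[OF that] that calculation by auto
    ultimately show ?thesis unfolding lead_def by blast
  qed
  have "\<exists>p b. b \<in> C j \<and> lead b p \<and> (\<forall>p' b'. b' \<in> C j \<longrightarrow> lead b' p' \<longrightarrow> p' \<le> p)" if j: "j < r" for j
  proof -
    define P where "P = {p. \<exists>b\<in>C j. lead b p}"
    have "P \<subseteq> {..<r}" by (auto simp: P_def lead_def)
    then have fin: "finite P" using finite_subset by auto
    have "(\<lambda>i. if i = j then 1 else 0) \<in> C j" by (simp add: C_def)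
    then obtain p where "lead (\<lambda>i. if i = j then 1 else 0) p" using ex[OF j] by blast
    then have "P \<noteq> {}" using \<open>_ \<in> C j\<close> unfolding P_def by blast
    then have "Max P \<in> P" using fin by simp
    then obtain b where "b \<in> C j" "lead b (Max P)" by (auto simp: P_def)
    moreover have "p' \<le> Max P" if "b' \<in> C j" "lead b' p'" for p' b'
      using fin that by (intro Max_ge) (auto simp: P_def)
    ultimately show ?thesis by blast
  qed
  then obtain \<sigma> B where *: "\<And>j. j < r \<Longrightarrow> B j \<in> C j" "\<And>j. j < r \<Longrightarrow> lead (B j) (\<sigma> j)"
    "\<And>j p' b'. j < r \<Longrightarrow> b' \<in> C j \<Longrightarrow> lead b' p' \<Longrightarrow> p' \<le> \<sigma> j" by metis
  have neq: "\<sigma> i \<noteq> \<sigma> j" if ij: "i < j" "j < r" for i j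
  proof
    assume eq: "\<sigma> i = \<sigma> j"
    let ?p = "\<sigma> j"
    define c where "c = u (B j) ?p / u (B i) ?p"
    define b where "b = (\<lambda>a. B j a - c * B i a)"
    have li: "lead (B i) ?p" "lead (B j) ?p" using * ij eq by (metis order.strict_trans)+
    have ub: "u b e = u (B j) e - c * u (B i) e" for e
      unfolding u_def b_def by (simp add: left_diff_distrib sum_subtractf sum_distrib_left mult.assoc)
    have "b \<in> C j" using *(1)[of i] *(1)[of j] ij by (auto simp: C_def b_def)
    then obtain p where p: "lead b p" using ex ij by blast
    then have "p \<le> ?p" using *(3) \<open>b \<in> C j\<close> ij by blast
    moreover have "u b e = 0" if "e \<le> ?p" for e
    proof (cases "e = ?p")
      case True
      then show ?thesis using li by (simp add: ub c_def lead_def)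
    next
      case False
      then show ?thesis using li that by (simp add: ub lead_def)
    qed
    ultimately show False using p by (auto simp: lead_def)
  qed
  define B' where "B' j = (if j < r then B j else (\<lambda>_. 0))" for j
  show ?thesis
  proof (rule that[of \<sigma> B'])
    show "inj_on \<sigma> {..<r}" using neq by (auto simp: inj_on_def) (metis linorder_neqE_nat)
    show "\<sigma> ` {..<r} \<subseteq> {..<r}" using *(2) by (auto simp: lead_def)
    show "j < i \<Longrightarrow> B' j i = 0" for j i using *(1)[of j] by (auto simp: B'_def C_def)
    show "j < r \<Longrightarrow> (\<Sum>i<r. B' j i * M i (\<sigma> j)) \<noteq> 0" for j
      using *(2)[of j] by (auto simp: lead_def u_def B'_def)
    show "j < r \<Longrightarrow> c < \<sigma> j \<Longrightarrow> (\<Sum>i<r. B' j i * M i c) = 0" for j c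
      using *(2)[of j] by (auto simp: lead_def u_def B'_def)
  qed
qed

text \<open>
  With the rows sorted by their leading columns, the modified rows restricted to these columns are upper triangular
  with nonzero diagonal, for any set of rows. Expanding this determinant by rows of \<open>M\<close> gives a nonzero
  minor of \<open>M\<close> with the same columns, in which each row is replaced by one that is not later and hence of no smaller
  weight. The set of rows comes from \<open>antisorted_sum_le\<close>, applied to the assignment of leading columns.
\<close>

lemma heavy_nonzero_minor:
  fixes M :: "'k::field mat" and k l :: "nat \<Rightarrow> int"
  assumes M: "M \<in> carrier_mat r r" "det M \<noteq> 0"
    and k: "\<And>i j. i \<le> j \<Longrightarrow> j < r \<Longrightarrow> k j \<le> k i" and l: "\<And>i j. i \<le> j \<Longrightarrow> j < r \<Longrightarrow> l j \<le> l i"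
    and T: "T \<subseteq> {..<r}"
  obtains h g where "\<And>a. a < card T \<Longrightarrow> h a < r" "\<And>a. a < card T \<Longrightarrow> g a < r"
    "det (mat (card T) (card T) (\<lambda>(a, b). M $$ (h a, g b))) \<noteq> 0"
    "(\<Sum>j\<in>T. k (r - 1 - j) + l j) \<le> (\<Sum>a<card T. k (h a) + l (g a))"
proof -
  have inj: "\<forall>i<r. b i = 0" if b: "\<forall>c<r. (\<Sum>i<r. b i * M $$ (i, c)) = 0" for b
  proof -
    have "M\<^sup>T *\<^sub>v vec r b = 0\<^sub>v r"
      using M b by (intro eq_vecI) (auto simp: scalar_prod_def atLeast0LessThan mult.commute)
    moreover have "M\<^sup>T \<in> carrier_mat r r" "det M\<^sup>T \<noteq> 0" using M det_transpose[OF M(1)] by auto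
    ultimately have "vec r b = 0\<^sub>v r"
      using det_0_iff_vec_prod_zero_field[of "M\<^sup>T" r] vec_carrier[of r b] by blast
    then have "vec r b $ i = 0" if "i < r" for i using that by simp
    then show ?thesis by simp
  qed
  obtain B \<sigma> where \<sigma>: "inj_on \<sigma> {..<r}" "\<sigma> ` {..<r} \<subseteq> {..<r}"
    and B: "\<And>j i. j < i \<Longrightarrow> B j i = 0"
    "\<And>j. j < r \<Longrightarrow> (\<Sum>i<r. B j i * M $$ (i, \<sigma> j)) \<noteq> 0"
    "\<And>j c. j < r \<Longrightarrow> c < \<sigma> j \<Longrightarrow> (\<Sum>i<r. B j i * M $$ (i, c)) = 0"
  proof (rule row_echelon_leads[of r "\<lambda>i c. M $$ (i, c)"])
    show "\<forall>i<r. b i = 0" if "\<forall>c<r. (\<Sum>i<r. b i * M $$ (i, c)) = 0" for b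
      using inj[OF that] .
  qed (rule that)
  define t where "t = card T"
  have finT: "finite T" using T finite_subset by auto
  (* Indexing by rows instead of columns turns the reversal of k into a reversal of l. *)
  define R where "R = (\<lambda>j. r - 1 - j) ` T"
  have injR: "inj_on (\<lambda>j. r - 1 - j) T"
  proof (rule inj_onI)
    fix x y assume "x \<in> T" "y \<in> T" "r - 1 - x = r - 1 - y"
    moreover have "x < r" "y < r" using calculation T by auto
    ultimately show "x = y" by linarith
  qed
  have R: "R \<subseteq> {..<r}" using T by (auto simp: R_def)
  have cR: "card R = t" unfolding R_def t_def by (rule card_image[OF injR])
  have sR: "(\<Sum>j\<in>T. k (r - 1 - j) + l j) = (\<Sum>i\<in>R. l (r - 1 - i) + k i)"
    unfolding R_def sum.reindex[OF injR]
  proof (rule sum.cong)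
    fix j assume "j \<in> T"
    then have "r - 1 - (r - 1 - j) = j" using T by fastforce
    then show "k (r - 1 - j) + l j = ((\<lambda>i. l (r - 1 - i) + k i) \<circ> (\<lambda>j. r - 1 - j)) j"
      by (simp add: add.commute)
  qed simp
  obtain T' where T': "T' \<subseteq> {..<r}" "card T' = t"
    "(\<Sum>i\<in>R. l (r - 1 - i) + k i) \<le> (\<Sum>j\<in>T'. l (\<sigma> j) + k j)"
  proof -
    have "\<exists>T'\<subseteq>{..<r}. card T' = card R \<and>
        (\<Sum>i\<in>R. l (r - 1 - i) + k i) \<le> (\<Sum>j\<in>T'. l (\<sigma> j) + k j)"
      by (rule antisorted_sum_le) (fact l k \<sigma> R)+
    then show ?thesis using that cR by auto
  qed
  have finT': "finite T'" using T' finite_subset by auto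
  have injT': "inj_on \<sigma> T'" using \<sigma>(1) T'(1) inj_on_subset by blast
  define ls where "ls = sorted_list_of_set (\<sigma> ` T')"
  have ls: "set ls = \<sigma> ` T'" "distinct ls" "sorted ls" "length ls = t"
    using finT' card_image[OF injT'] T'(2) by (auto simp: ls_def)
  define g where "g a = ls ! a" for a
  define \<tau> where "\<tau> a = inv_into T' \<sigma> (g a)" for a
  have gin: "g a \<in> \<sigma> ` T'" if "a < t" for a using ls that by (metis g_def nth_mem)
  have \<tau>: "\<tau> a \<in> T'" "\<sigma> (\<tau> a) = g a" if "a < t" for a
    using gin[OF that] unfolding \<tau>_def by (auto intro: inv_into_into f_inv_into_f)
  have \<tau>r: "\<tau> a < r" if "a < t" for a using \<tau>(1)[OF that] T' by auto
  have gr: "g a < r" if "a < t" for a using gin[OF that] \<sigma>(2) T'(1) by auto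
  have g_mono: "g a < g b" if "a < b" "b < t" for a b
    using ls that unfolding g_def
    by (metis le_neq_implies_less less_imp_le_nat nth_eq_iff_index_eq order.strict_trans sorted_nth_mono order.strict_iff_order)
  have inj\<tau>: "inj_on \<tau> {..<t}"
  proof (rule inj_onI)
    fix a b assume "a \<in> {..<t}" "b \<in> {..<t}" "\<tau> a = \<tau> b"
    then have "g a = g b" using \<tau>(2) by (metis lessThan_iff)
    then show "a = b" using g_mono \<open>a \<in> _\<close> \<open>b \<in> _\<close> by (metis lessThan_iff less_irrefl linorder_neqE_nat)
  qed
  have im\<tau>: "\<tau> ` {..<t} = T'"
    using \<tau>(1) card_image[OF inj\<tau>] T'(2) finT' by (intro card_subset_eq) auto
  let ?W = "mat t t (\<lambda>(a, b). \<Sum>i\<in>{..<r}. B (\<tau> a) i * M $$ (i, g b))"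
  have detW: "det ?W = prod_list (diag_mat ?W)"
  proof (rule det_upper_triangular[of _ t])
    show "upper_triangular ?W"
    proof (rule upper_triangularI)
      fix b a assume "b < a" "a < dim_row ?W"
      then have ab: "b < a" "a < t" "b < t" by auto
      have "g b < \<sigma> (\<tau> a)" using g_mono[OF ab(1,2)] \<tau>(2)[OF ab(2)] by simp
      from B(3)[OF \<tau>r[OF ab(2)] this] show "?W $$ (a, b) = 0" using ab by simp
    qed
  qed simp
  have nz: "0 \<notin> set (diag_mat ?W)"
  proof
    assume "0 \<in> set (diag_mat ?W)"
    then obtain a where a: "a < t" "?W $$ (a, a) = 0" unfolding diag_mat_def by auto
    then have "(\<Sum>i<r. B (\<tau> a) i * M $$ (i, g a)) = 0" by simp
    then show False using B(2)[OF \<tau>r[OF a(1)]] \<tau>(2)[OF a(1)] by simp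
  qed
  have "det ?W \<noteq> 0" unfolding detW prod_list_zero_iff by (rule nz)
  then have "(\<Sum>h\<in>PiE {0..<t} (\<lambda>_. {..<r}). (\<Prod>a = 0..<t. B (\<tau> a) (h a)) *
      det (mat t t (\<lambda>(a, b). M $$ (h a, g b)))) \<noteq> 0"
    unfolding det_product_expand_rows[OF finite_lessThan] .
  then obtain h where h: "h \<in> PiE {0..<t} (\<lambda>_. {..<r})"
    "(\<Prod>a = 0..<t. B (\<tau> a) (h a)) * det (mat t t (\<lambda>(a, b). M $$ (h a, g b))) \<noteq> 0"
    by (rule sum.not_neutral_contains_not_neutral)
  have hr: "h a < r" if "a < t" for a using h(1) that by (auto simp: PiE_def)
  have "h a \<le> \<tau> a" if "a < t" for a
  proof (rule ccontr)
    assume "\<not> h a \<le> \<tau> a"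
    then have "B (\<tau> a) (h a) = 0" using B(1) by simp
    then have "(\<Prod>a = 0..<t. B (\<tau> a) (h a)) = 0" using that by (intro prod_zero) auto
    then show False using h(2) by simp
  qed
  then have kh: "k (\<tau> a) \<le> k (h a)" if "a < t" for a using k \<tau>r that by blast
  have "(\<Sum>j\<in>T'. l (\<sigma> j) + k j) = (\<Sum>a<t. l (\<sigma> (\<tau> a)) + k (\<tau> a))"
    unfolding im\<tau>[symmetric] by (simp add: sum.reindex[OF inj\<tau>])
  also have "\<dots> \<le> (\<Sum>a<t. k (h a) + l (g a))"
    using kh \<tau>(2) by (intro sum_mono) (auto simp: add.commute)
  finally have "(\<Sum>j\<in>T. k (r - 1 - j) + l j) \<le> (\<Sum>a<t. k (h a) + l (g a))"
    using T'(3) sR by linarith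
  moreover have "det (mat t t (\<lambda>(a, b). M $$ (h a, g b))) \<noteq> 0" using h(2) by auto
  ultimately show ?thesis using that[of h g] hr gr unfolding t_def by blast
qed

section \<open>Necessity for an invertible square matrix\<close>

text \<open>
  The product of \<open>M\<close> with diagonal matrices of powers of the indeterminate on both sides (\<open>scale_mat_diag\<close>).
\<close>

definition scale_mat :: "(nat \<Rightarrow> int) \<Rightarrow> (nat \<Rightarrow> int) \<Rightarrow> 'a::field poly fract mat \<Rightarrow> 'a poly fract mat" where
  "scale_mat k l M = mat (dim_row M) (dim_col M) (\<lambda>(i, j). ind powi (k i + l j) * M $$ (i, j))"

lemma scale_mat_carrier [simp]: "M \<in> carrier_mat m n \<Longrightarrow> scale_mat k l M \<in> carrier_mat m n"
  by (auto simp: scale_mat_def)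

lemma ind_powi_add: "(ind :: 'a::field poly fract) powi (a + b) = ind powi a * ind powi b"
  by (subst power_int_add) auto

lemma prod_ind_powi_nonzero: "(\<Prod>i\<in>I. ind powi e i :: 'a::field poly fract) \<noteq> 0"
  by (induction I rule: infinite_finite_induct) auto

lemma fdeg_prod_ind_powi:
  "finite I \<Longrightarrow> fdeg (\<Prod>i\<in>I. ind powi e i :: 'a::field poly fract) = (\<Sum>i\<in>I. e i)"
  by (subst fdeg_prod) (simp_all only: fdeg_ind_powi ind_powi_nonzero not_False_eq_True)

lemma scale_mat_diag:
  assumes "M \<in> carrier_mat m n"
  shows "mat_diag m (\<lambda>i. ind powi (k i)) * M * mat_diag n (\<lambda>j. ind powi (l j)) = scale_mat k l M"
proof -
  have 1: "mat_diag m (\<lambda>i. ind powi (k i)) * M = mat m n (\<lambda>(i, j). ind powi (k i) * M $$ (i, j))"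
    by (rule mat_diag_mult_left[OF assms])
  show ?thesis unfolding 1 using assms
    by (subst mat_diag_mult_right[of _ m]) (auto intro!: eq_matI simp: scale_mat_def ind_powi_add mult_ac)
qed

lemma det_scale_mat:
  fixes M :: "'a::field poly fract mat"
  assumes M: "M \<in> carrier_mat r r" and h: "\<And>a. a < t \<Longrightarrow> h a < r" and g: "\<And>a. a < t \<Longrightarrow> g a < r"
  shows "det (mat t t (\<lambda>(a, b). scale_mat k l M $$ (h a, g b))) =
    (\<Prod>a<t. ind powi (k (h a) + l (g a))) * det (mat t t (\<lambda>(a, b). M $$ (h a, g b)))"
proof -
  have "(\<Prod>i = 0..<t. scale_mat k l M $$ (h i, g (p i))) =
      (\<Prod>a<t. ind powi (k (h a) + l (g a))) * (\<Prod>i = 0..<t. M $$ (h i, g (p i)))"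
    if p: "p permutes {0..<t}" for p
  proof -
    have pt: "p i < t" if "i < t" for i using permutes_in_image[OF p, of i] that by simp
    have "(\<Prod>i = 0..<t. scale_mat k l M $$ (h i, g (p i))) =
        (\<Prod>i = 0..<t. ind powi (k (h i)) * (ind powi (l (g (p i))) * M $$ (h i, g (p i))))"
      using M h g pt by (intro prod.cong) (auto simp: scale_mat_def ind_powi_add mult_ac)
    also have "\<dots> = (\<Prod>i = 0..<t. ind powi (k (h i))) * ((\<Prod>i = 0..<t. ind powi (l (g (p i)))) *
        (\<Prod>i = 0..<t. M $$ (h i, g (p i))))"
      by (simp add: prod.distrib)
    also have "(\<Prod>i = 0..<t. ind powi (l (g (p i)))) = (\<Prod>i = 0..<t. ind powi (l (g i)) :: 'a poly fract)"
      using prod.permute[OF p, of "\<lambda>i. ind powi (l (g i)) :: 'a poly fract"] by (simp add: comp_def)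
    finally show ?thesis by (simp add: ind_powi_add prod.distrib atLeast0LessThan mult_ac)
  qed
  then show ?thesis
    unfolding det_mat_sum sum_distrib_left by (intro sum.cong) (auto simp: mult_ac)
qed

text \<open>
  For every nonzero minor, its divisibility over the polynomials bounds its degree below and the
  divisibility of its scaled version over the proper functions bounds it above; a nonzero minor of large weight
  makes the resulting inequality strong enough. For the full order the diagonal products are multiples of the
  determinants as well, which gives the reverse inequality of the total sums.
\<close>

lemma structure_dominates:
  fixes M :: "'a::field poly fract mat" and k l q :: "nat \<Rightarrow> int"
  assumes M: "M \<in> carrier_mat r r" "det M \<noteq> 0" and r: "r \<le> m" "r \<le> n"
    and k: "\<And>i j. i \<le> j \<Longrightarrow> j < r \<Longrightarrow> k j \<le> k i" and l: "\<And>i j. i \<le> j \<Longrightarrow> j < r \<Longrightarrow> l j \<le> l i"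
    and f: "\<And>i. i < r \<Longrightarrow> f i \<noteq> 0" "\<And>i. Suc i < r \<Longrightarrow> \<exists>s\<in>poly_fracts. f (Suc i) = f i * s"
    and q: "\<And>i. Suc i < r \<Longrightarrow> q i \<le> q (Suc i)"
    and fin: "poly_fracts.equivalent (pad_mat m n M) (pad_mat m n (mat_diag r f))"
    and inf: "proper_fracts.equivalent (pad_mat m n (scale_mat k l M))
      (pad_mat m n (mat_diag r (\<lambda>i. ind powi (- q i))))"
  shows "dominates (\<lambda>i. fdeg (f i) + q i) (\<lambda>j. - (k (r - 1 - j) + l j)) r"
proof -
  have q': "\<exists>s\<in>(proper_fracts :: 'a poly fract set). ind powi (- q (Suc i)) = ind powi (- q i) * s" if "Suc i < r" for i
  proof (rule bexI)
    show "ind powi (- q (Suc i)) = ind powi (- q i) * (ind powi (q i - q (Suc i)) :: 'a poly fract)"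
      by (simp add: ind_powi_add[symmetric])
    show "ind powi (q i - q (Suc i)) \<in> (proper_fracts :: 'a poly fract set)"
      using q[OF that] by (simp add: proper_fracts_def fdeg_le_def fdeg_ind_powi)
  qed
  have scale_det: "det (scale_mat k l M) = (\<Prod>a<r. ind powi (k a + l a)) * det M"
  proof -
    have eta: "mat r r (\<lambda>(a, b). X $$ (a, b)) = X" if "X \<in> carrier_mat r r" for X :: "'a poly fract mat"
      using that by (intro eq_matI) auto
    show ?thesis
      using det_scale_mat[OF M(1), of r "\<lambda>a. a" "\<lambda>a. a" k l]
      unfolding eta[OF M(1)] eta[OF scale_mat_carrier[OF M(1)]] by simp
  qed
  have bound: "(\<Sum>i<t. fdeg (f i) + q i) + (\<Sum>a<t. k (h a) + l (g a)) \<le> 0"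
    if t: "t \<le> r" and h: "\<And>a. a < t \<Longrightarrow> h a < r" and g: "\<And>a. a < t \<Longrightarrow> g a < r"
      and nz: "det (mat t t (\<lambda>(a, b). M $$ (h a, g b))) \<noteq> 0" for t h g
  proof -
    let ?D = "det (mat t t (\<lambda>(a, b). M $$ (h a, g b)))"
    have hm: "h a < m" "g a < n" if "a < t" for a using h[OF that] g[OF that] r by auto
    have pad: "mat t t (\<lambda>(a, b). pad_mat m n X $$ (h a, g b)) = mat t t (\<lambda>(a, b). X $$ (h a, g b))"
      if "X \<in> carrier_mat r r" for X :: "'a poly fract mat"
      using that hm h g by (intro eq_matI) (auto simp: pad_mat_def)
    obtain s where s: "s \<in> poly_fracts" "?D = (\<Prod>i<t. f i) * s"
      using poly_fracts.minor_divisible[OF poly_fracts.equivalent_sym[OF fin] r f(2), of t h g] hm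
      unfolding pad[OF M(1)] by blast
    obtain p where p: "s = to_fract p" using s(1) by (auto simp: poly_fracts_def)
    have nz': "p \<noteq> 0" "(\<Prod>i<t. f i) \<noteq> 0" using nz s p by auto
    then have "fdeg ?D = fdeg (\<Prod>i<t. f i) + int (degree p)"
      unfolding s(2) p by (simp add: fdeg_mult fdeg_to_fract)
    also have "fdeg (\<Prod>i<t. f i) = (\<Sum>i<t. fdeg (f i))"
      using f(1) t by (intro fdeg_prod) auto
    finally have 1: "(\<Sum>i<t. fdeg (f i)) \<le> fdeg ?D" by simp
    let ?E = "\<Prod>a<t. ind powi (k (h a) + l (g a)) :: 'a poly fract"
    obtain s where s: "s \<in> proper_fracts" "?E * ?D = (\<Prod>i<t. ind powi (- q i)) * s"
    proof -
      have "\<exists>s\<in>proper_fracts. det (mat t t (\<lambda>(a, b). pad_mat m n (scale_mat k l M) $$ (h a, g b))) =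
          (\<Prod>i<t. ind powi (- q i)) * s"
        by (rule proper_fracts.minor_divisible[OF proper_fracts.equivalent_sym[OF inf] r q']) (use hm in auto)
      moreover have "det (mat t t (\<lambda>(a, b). scale_mat k l M $$ (h a, g b))) = ?E * ?D"
        by (rule det_scale_mat[OF M(1)]) (use h g in auto)
      ultimately show ?thesis using that unfolding pad[OF scale_mat_carrier[OF M(1)]] by auto
    qed
    have E: "?E \<noteq> 0" "fdeg ?E = (\<Sum>a<t. k (h a) + l (g a))"
      by (rule prod_ind_powi_nonzero, rule fdeg_prod_ind_powi, simp)
    have Q: "(\<Prod>i<t. ind powi (- q i) :: 'a poly fract) \<noteq> 0"
      "fdeg (\<Prod>i<t. ind powi (- q i) :: 'a poly fract) = - (\<Sum>i<t. q i)"
      by (rule prod_ind_powi_nonzero, subst fdeg_prod_ind_powi, simp, simp only: sum_negf)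
    have "s \<noteq> 0" using s E nz by auto
    then have "fdeg s \<le> 0" using s(1) by (auto simp: proper_fracts_def fdeg_le_def)
    moreover have "fdeg ?E + fdeg ?D = - (\<Sum>i<t. q i) + fdeg s"
      using arg_cong[OF s(2), of fdeg] E(1) nz Q \<open>s \<noteq> 0\<close> by (simp add: fdeg_mult)
    ultimately show ?thesis using 1 E(2) by (simp add: sum.distrib)
  qed
  have le: "(\<Sum>i<card T. fdeg (f i) + q i) \<le> (\<Sum>j\<in>T. - (k (r - 1 - j) + l j))" if T: "T \<subseteq> {..<r}" for T
  proof -
    obtain h g where hg: "\<And>a. a < card T \<Longrightarrow> h a < r" "\<And>a. a < card T \<Longrightarrow> g a < r"
      "det (mat (card T) (card T) (\<lambda>(a, b). M $$ (h a, g b))) \<noteq> 0"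
      "(\<Sum>j\<in>T. k (r - 1 - j) + l j) \<le> (\<Sum>a<card T. k (h a) + l (g a))"
    proof (rule heavy_nonzero_minor[OF M _ _ T, of k l])
      show "k j \<le> k i" if "i \<le> j" "j < r" for i j by (rule k[OF that])
      show "l j \<le> l i" if "i \<le> j" "j < r" for i j by (rule l[OF that])
    qed (rule that)
    have "card T \<le> r" using card_mono[OF _ T] by simp
    then have "(\<Sum>i<card T. fdeg (f i) + q i) + (\<Sum>a<card T. k (h a) + l (g a)) \<le> 0"
      by (rule bound) (fact hg)+
    then show ?thesis using hg(4) unfolding sum_negf by linarith
  qed
  have "(\<Sum>i<r. fdeg (f i) + q i) \<ge> (\<Sum>j<r. - (k (r - 1 - j) + l j))"
  proof -
    obtain s where s: "s \<in> poly_fracts" "(\<Prod>i<r. f i) = det M * s"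
      using poly_fracts.det_divides_diag[OF fin M(1) r] by blast
    obtain p where p: "s = to_fract p" using s(1) by (auto simp: poly_fracts_def)
    have "(\<Prod>i<r. f i) \<noteq> 0" using f(1) by simp
    then have "fdeg (\<Prod>i<r. f i) = fdeg (det M) + int (degree p)"
      using s(2) p M(2) by (auto simp: fdeg_mult fdeg_to_fract)
    moreover have "fdeg (\<Prod>i<r. f i) = (\<Sum>i<r. fdeg (f i))" using f(1) by (intro fdeg_prod) auto
    ultimately have 1: "fdeg (det M) \<le> (\<Sum>i<r. fdeg (f i))" by simp
    let ?E = "\<Prod>a<r. ind powi (k a + l a) :: 'a poly fract"
    obtain s where s: "s \<in> proper_fracts" "(\<Prod>i<r. ind powi (- q i)) = ?E * det M * s"
      using proper_fracts.det_divides_diag[OF inf scale_mat_carrier[OF M(1)] r] scale_det by metis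
    have E: "?E \<noteq> 0" "fdeg ?E = (\<Sum>a<r. k a + l a)"
      by (rule prod_ind_powi_nonzero, rule fdeg_prod_ind_powi, simp)
    have Q: "(\<Prod>i<r. ind powi (- q i) :: 'a poly fract) \<noteq> 0"
      "fdeg (\<Prod>i<r. ind powi (- q i) :: 'a poly fract) = - (\<Sum>i<r. q i)"
      by (rule prod_ind_powi_nonzero, subst fdeg_prod_ind_powi, simp, simp only: sum_negf)
    have "s \<noteq> 0" using s Q by auto
    then have "fdeg s \<le> 0" using s(1) by (auto simp: proper_fracts_def fdeg_le_def)
    moreover have "- (\<Sum>i<r. q i) = fdeg ?E + fdeg (det M) + fdeg s"
      using arg_cong[OF s(2), of fdeg] E(1) M(2) Q \<open>s \<noteq> 0\<close> by (simp add: fdeg_mult)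
    moreover have "(\<Sum>j<r. k (r - 1 - j)) = (\<Sum>j<r. k j)"
      using sum.nat_diff_reindex[of k r] by simp
    moreover have "(\<Sum>j<r. - (k (r - 1 - j) + l j)) = - (\<Sum>j<r. k (r - 1 - j)) - (\<Sum>j<r. l j)"
      by (simp add: sum_negf sum.distrib sum_subtractf)
    ultimately show ?thesis using 1 E(2) by (simp add: sum.distrib)
  qed
  then show ?thesis unfolding dominates_def using le le[of "{..<r}"] by auto
qed

section \<open>Realization of an invertible square matrix\<close>

text \<open>
  Over the proper functions only the degrees of the diagonal entries matter, since the functions of degree 0 are
  invertible.
\<close>

lemma proper_equivalent_diag:
  fixes f g :: "nat \<Rightarrow> 'a::field poly fract"
  assumes "\<And>i. i < N \<Longrightarrow> f i \<noteq> 0 \<and> g i \<noteq> 0 \<and> fdeg (f i) = fdeg (g i)"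
  shows "proper_fracts.equivalent (mat_diag N f) (mat_diag N g)"
proof (rule proper_fracts.equivalent_diag_units)
  fix i assume "i < N"
  from assms[OF this] show "\<exists>u\<in>proper_fracts. \<exists>u'\<in>proper_fracts. u * u' = 1 \<and> u * f i = g i"
    by (intro bexI[of _ "g i / f i"] bexI[of _ "f i / g i"])
      (auto simp: proper_fracts_def fdeg_le_def fdeg_divide)
qed

lemma mat_diag_cong: "(\<And>i. i < N \<Longrightarrow> f i = g i) \<Longrightarrow> mat_diag N f = mat_diag N g"
  by (auto intro!: eq_matI simp: mat_diag_def)

text \<open>
  Linear factors of the cofactor are moved over one at a time.
\<close>

lemma polynomial_factor_of_degree:
  fixes p :: "'a::field poly"
  assumes closed: "\<And>p :: 'a poly. 0 < degree p \<Longrightarrow> \<exists>x. poly p x = 0"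
    and p: "p \<noteq> 0" and y: "y \<le> degree p"
  shows "\<exists>g h. p = g * h \<and> degree g = y"
  using y
proof (induction y)
  case 0
  then show ?case by (intro exI[of _ 1] exI[of _ p]) auto
next
  case (Suc y)
  then obtain g h where gh: "p = g * h" "degree g = y" by auto
  have nz: "g \<noteq> 0" "h \<noteq> 0" using gh p by auto
  then have "degree p = degree g + degree h" using gh by (simp add: degree_mult_eq)
  then have "0 < degree h" using gh Suc.prems by simp
  then obtain x where "poly h x = 0" using closed by blast
  then obtain h' where h': "h = [:-x, 1:] * h'" by (auto simp: poly_eq_0_iff_dvd elim: dvdE)
  have "degree (g * [:-x, 1:]) = Suc y"
    using nz gh by (subst degree_mult_eq) auto
  moreover have "p = (g * [:-x, 1:]) * h'" unfolding gh(1) h' by (simp only: mult.assoc)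
  ultimately show ?case by blast
qed

lemma crossing_index:
  fixes x :: "nat \<Rightarrow> int"
  assumes "x 0 \<le> d" "d \<le> x N" "0 < N"
  shows "\<exists>i<N. x i \<le> d \<and> d \<le> x (Suc i)"
  using assms
proof (induction N)
  case (Suc N)
  show ?case
  proof (cases "0 < N \<and> d \<le> x N")
    case True
    then show ?thesis using Suc less_Suc_eq by blast
  next
    case False
    then have "x N \<le> d" using Suc.prems by (cases "N = 0") auto
    then show ?thesis using Suc.prems by blast
  qed
qed simp

text \<open>
  The partial sums of the merged sequence agree with those of \<open>x\<close> up to index \<open>i\<close>, and from there on they are
  the next partial sum of \<open>x\<close> minus \<open>d N\<close>. In the second case the bound for an index set \<open>T\<close> is the given one for \<open>T\<close>
  with \<open>N\<close> added.
\<close>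

lemma dominates_merge:
  fixes x d :: "nat \<Rightarrow> int"
  assumes dom: "dominates x d (Suc N)" and i: "i < N"
  defines "x' \<equiv> \<lambda>j. if j < i then x j else if j = i then x i + x (Suc i) - d N else x (Suc j)"
  assumes le: "x i \<le> d N" "d N \<le> x (Suc i)"
  shows "dominates x' d N"
proof -
  have low: "(\<Sum>j<c. x' j) = (\<Sum>j<c. x j)" if "c \<le> i" for c
    using that by (intro sum.cong) (auto simp: x'_def)
  have high: "(\<Sum>j<c. x' j) = (\<Sum>j<Suc c. x j) - d N" if "i < c" for c
    using that
  proof (induction c)
    case (Suc c)
    show ?case
    proof (cases "c = i")
      case True
      then show ?thesis using low[of i] by (simp add: x'_def)
    next
      case False
      then have "i < c" using Suc.prems by simp
      then show ?thesis using Suc.IH by (simp add: x'_def)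
    qed
  qed simp
  show ?thesis unfolding dominates_def
  proof (intro conjI allI impI)
    fix T assume T: "T \<subseteq> {..<N}"
    then have fin: "finite T" "N \<notin> T" using finite_subset by auto
    show "(\<Sum>j<card T. x' j) \<le> (\<Sum>j\<in>T. d j)"
    proof (cases "card T \<le> i")
      case True
      have "T \<subseteq> {..<Suc N}" using T by auto
      then show ?thesis using dom low[OF True] unfolding dominates_def by auto
    next
      case False
      have "insert N T \<subseteq> {..<Suc N}" using T by auto
      then have "(\<Sum>j<card (insert N T). x j) \<le> (\<Sum>j\<in>insert N T. d j)"
        using dom unfolding dominates_def by blast
      then show ?thesis using high[of "card T"] False fin by simp
    qed
  next
    show "(\<Sum>j<N. x' j) = (\<Sum>j<N. d j)"
      using high[OF i] dom unfolding dominates_def by simp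
  qed
qed

text \<open>
  The inverse of the merging: position \<open>N\<close> of the bordered diagonal, which holds the entry split off, moves to the
  position after \<open>i\<close>, and the later entries shift up.
\<close>

lemma split_permutation:
  assumes "i < N"
  defines "p \<equiv> \<lambda>j. if j = Suc i then N else if Suc i < j \<and> j \<le> N then j - 1 else j"
  shows "p permutes {..<Suc N}"
proof (rule inj_imp_permutes)
  show "inj_on p {..<Suc N}"
    using assms(1) unfolding p_def by (auto simp: inj_on_def split: if_splits)
qed (use assms(1) in \<open>auto simp: p_def\<close>)

text \<open>
  The induction step removes the last index \<open>N\<close>. The excess \<open>\<delta>\<close> of \<open>x (Suc i)\<close> over \<open>d N\<close> is divided into a finite
  part \<open>y\<close>, the degree of a divisor \<open>u\<close> of the quotient \<open>p\<close> of the two fractions, and a part \<open>z\<close> at infinity;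
  the merged entry is \<open>f i * u\<close> with order \<open>q i + z\<close>. The corner \<open>\<alpha>\<close> of the bordered matrix is \<open>f i\<close> times the
  cofactor of \<open>u\<close> in \<open>p\<close>.
\<close>

lemma structure_realizable:
  fixes f :: "nat \<Rightarrow> 'a::field poly fract" and k l q :: "nat \<Rightarrow> int"
  assumes closed: "\<And>p :: 'a poly. 0 < degree p \<Longrightarrow> \<exists>x. poly p x = 0"
    and "\<And>i. i \<le> N \<Longrightarrow> f i \<noteq> 0" "\<And>i. i < N \<Longrightarrow> \<exists>p. f (Suc i) = f i * to_fract p"
    and "\<And>i. i < N \<Longrightarrow> q i \<le> q (Suc i)"
    and "\<And>i j. i \<le> j \<Longrightarrow> j \<le> N \<Longrightarrow> k i \<le> k j"
    and "dominates (\<lambda>i. fdeg (f i) + q i) (\<lambda>j. - (k j + l j)) (Suc N)"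
  shows "\<exists>M\<in>carrier_mat (Suc N) (Suc N).
    poly_fracts.equivalent M (mat_diag (Suc N) f) \<and>
    proper_fracts.equivalent (scale_mat k l M) (mat_diag (Suc N) (\<lambda>i. ind powi (- q i)))"
  using assms(2-)
proof (induction N arbitrary: f q)
  case 0
  have d0: "fdeg (f 0) + q 0 = - (k 0 + l 0)" using 0(5) by (simp add: dominates_def)
  let ?M = "mat_diag 1 f"
  have "poly_fracts.equivalent ?M ?M"
    by (rule poly_fracts.equivalent_refl[OF mat_diag_dim])
  moreover have "scale_mat k l ?M = mat_diag 1 (\<lambda>i. ind powi (k 0 + l 0) * f 0)"
    by (intro eq_matI) (auto simp: scale_mat_def mat_diag_def)
  moreover have "proper_fracts.equivalent (mat_diag 1 (\<lambda>i. ind powi (k 0 + l 0) * f 0))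
      (mat_diag 1 (\<lambda>i. ind powi (- q i)))"
  proof (rule proper_equivalent_diag)
    fix i :: nat assume "i < 1"
    then have i: "i = 0" by simp
    have "fdeg (ind powi (k 0 + l 0) * f 0) = k 0 + l 0 + fdeg (f 0)"
      using 0(1)[of 0] by (subst fdeg_mult) (simp_all add: fdeg_ind_powi)
    then show "ind powi (k 0 + l 0) * f 0 \<noteq> 0 \<and> ind powi (- q i) \<noteq> (0 :: 'a poly fract) \<and>
        fdeg (ind powi (k 0 + l 0) * f 0) = fdeg (ind powi (- q i) :: 'a poly fract)"
      using 0(1)[of 0] d0 unfolding i fdeg_ind_powi by simp
  qed
  ultimately show ?case by (intro bexI[of _ ?M]) auto
next
  case (Suc N0)
  define N where "N = Suc N0"
  note fnz = Suc.prems(1)[folded N_def] and fdiv = Suc.prems(2)[folded N_def]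
    and qmono = Suc.prems(3)[folded N_def] and kmono = Suc.prems(4)[folded N_def]
    and dom = Suc.prems(5)[folded N_def]
  define x where "x = (\<lambda>i. fdeg (f i) + q i)"
  define d where "d = (\<lambda>j. - (k j + l j))"
  have dom: "dominates x d (Suc N)" unfolding x_def d_def by (rule dom)
  have x0: "x 0 \<le> d N"
  proof -
    have "(\<Sum>i<card {N}. x i) \<le> (\<Sum>j\<in>{N}. d j)"
      using dom unfolding dominates_def by blast
    then show ?thesis by simp
  qed
  have xN: "d N \<le> x N"
  proof -
    have "(\<Sum>i<card {..<N}. x i) \<le> (\<Sum>j\<in>{..<N}. d j)"
      using dom unfolding dominates_def by (metis lessThan_subset_iff le_SucI order_refl)
    moreover have "(\<Sum>i<Suc N. x i) = (\<Sum>j<Suc N. d j)" using dom unfolding dominates_def by blast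
    ultimately show ?thesis by simp
  qed
  obtain i where i: "i < N" "x i \<le> d N" "d N \<le> x (Suc i)"
    using crossing_index[of x "d N" N] x0 xN by (auto simp: N_def)
  obtain p where p: "f (Suc i) = f i * to_fract p" using fdiv i by blast
  have fi: "f i \<noteq> 0" "f (Suc i) \<noteq> 0" using fnz[of i] fnz[of "Suc i"] i(1) by auto
  have p0: "p \<noteq> 0" using p fi by auto
  have fd: "fdeg (f (Suc i)) = fdeg (f i) + int (degree p)"
    using p p0 fi by (simp add: fdeg_mult fdeg_to_fract)
  define \<delta> where "\<delta> = x (Suc i) - d N"
  define y where "y = min (nat \<delta>) (degree p)"
  define z where "z = \<delta> - int y"
  have yz: "y \<le> degree p" "0 \<le> z" "z \<le> q (Suc i) - q i"
    using i fd qmono[OF i(1)] unfolding y_def z_def \<delta>_def x_def by (auto simp: min_def)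
  obtain u v where uv: "p = u * v" "degree u = y"
    using polynomial_factor_of_degree[OF closed p0 yz(1)] by blast
  have uv0: "u \<noteq> 0" "v \<noteq> 0" using uv p0 by auto
  have dv: "int (degree v) = int (degree p) - int y"
    using uv uv0 by (simp add: degree_mult_eq)
  define c where "c = f i * to_fract u"
  define w where "w = q i + z"
  define f' where "f' j = (if j < i then f j else if j = i then c else f (Suc j))" for j
  define q' where "q' j = (if j < i then q j else if j = i then w else q (Suc j))" for j
  have c0: "c \<noteq> 0" using fi uv0 by (simp add: c_def)
  have cdeg: "fdeg c = fdeg (f i) + int y" using fi uv0 uv by (simp add: c_def fdeg_mult fdeg_to_fract)
  have "\<exists>M\<in>carrier_mat (Suc N0) (Suc N0).
    poly_fracts.equivalent M (mat_diag (Suc N0) f') \<and>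
    proper_fracts.equivalent (scale_mat k l M) (mat_diag (Suc N0) (\<lambda>i. ind powi (- q' i)))"
  proof (rule Suc.IH)
    show "f' j \<noteq> 0" if "j \<le> N0" for j
      using fnz[of j] fnz[of "Suc j"] c0 that by (auto simp: f'_def N_def)
    show "\<exists>p. f' (Suc j) = f' j * to_fract p" if "j < N0" for j
    proof -
      have j: "j < N" "Suc j < N" using that by (auto simp: N_def)
      obtain s where s: "f (Suc j) = f j * to_fract s" using fdiv[OF j(1)] by blast
      obtain s' where s': "f (Suc (Suc j)) = f (Suc j) * to_fract s'" using fdiv[OF j(2)] by blast
      consider "Suc j < i" | "Suc j = i" | "j = i" | "i < j" by linarith
      then show ?thesis
      proof cases
        case 1
        then show ?thesis using s by (auto simp: f'_def)
      next
        case 2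
        then have "f' (Suc j) = f' j * to_fract (s * u)" using s by (simp add: f'_def c_def mult_ac)
        then show ?thesis by blast
      next
        case 3
        then have "f' (Suc j) = f' j * to_fract (v * s')" using s' p uv by (simp add: f'_def c_def mult_ac)
        then show ?thesis by blast
      next
        case 4
        then show ?thesis using s' by (auto simp: f'_def)
      qed
    qed
    show "q' j \<le> q' (Suc j)" if "j < N0" for j
    proof -
      have j: "j < N" "Suc j < N" using that by (auto simp: N_def)
      show ?thesis using qmono[OF j(1)] qmono[OF j(2)] yz by (auto simp: q'_def w_def)
    qed
    show "k a \<le> k b" if "a \<le> b" "b \<le> N0" for a b using kmono[of a b] that by (simp add: N_def)
    have "dominates (\<lambda>j. if j < i then x j else if j = i then x i + x (Suc i) - d N else x (Suc j)) d N"
      by (rule dominates_merge[OF dom i])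
    moreover have "(\<lambda>j. fdeg (f' j) + q' j) =
        (\<lambda>j. if j < i then x j else if j = i then x i + x (Suc i) - d N else x (Suc j))"
      by (rule ext) (simp add: f'_def q'_def x_def cdeg w_def z_def \<delta>_def)
    ultimately show "dominates (\<lambda>j. fdeg (f' j) + q' j) (\<lambda>j. - (k j + l j)) (Suc N0)"
      by (simp add: d_def N_def)
  qed
  then obtain M where M: "M \<in> carrier_mat N N" "poly_fracts.equivalent M (mat_diag N f')"
    "proper_fracts.equivalent (scale_mat k l M) (mat_diag N (\<lambda>i. ind powi (- q' i)))"
    by (auto simp: N_def)
  define \<alpha> where "\<alpha> = f i * to_fract v"
  have \<alpha>0: "\<alpha> \<noteq> 0" using fi uv0 by (simp add: \<alpha>_def)
  have \<alpha>deg: "fdeg \<alpha> = fdeg (f i) + int (degree p) - int y"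
    using fi uv0 dv by (simp add: \<alpha>_def fdeg_mult fdeg_to_fract)
  (* The factor that equivalent_border needs at infinity; it makes the corner of the scaled matrix exactly the scaled \<alpha>. *)
  define \<zeta> where "\<zeta> = ind powi (q i + k N + l N) * \<alpha>"
  have \<zeta>0: "\<zeta> \<noteq> 0" using \<alpha>0 by (simp add: \<zeta>_def)
  have \<zeta>deg: "fdeg \<zeta> = w - q (Suc i)"
    unfolding \<zeta>_def using \<alpha>0 fd
    by (subst fdeg_mult) (simp_all add: fdeg_ind_powi \<alpha>deg w_def z_def \<delta>_def x_def d_def)
  have \<alpha>inf: "ind powi (- q i) * \<zeta> = ind powi (k N + l N) * \<alpha>"
    unfolding \<zeta>_def mult.assoc[symmetric] ind_powi_add[symmetric] by simp
  have upoly: "to_fract u \<in> poly_fracts" "to_fract v \<in> poly_fracts" by (auto simp: poly_fracts_def)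
  have f'i: "f' i = f i * to_fract u" by (simp add: f'_def c_def)
  obtain v0 where v0: "\<And>x. (\<And>j. j < N \<Longrightarrow> \<exists>t\<in>poly_fracts. x j = v0 j + \<alpha> * t) \<Longrightarrow>
      poly_fracts.equivalent (four_block_mat M (mat N 1 (\<lambda>(j, _). x j)) (0\<^sub>m 1 N) (mat 1 1 (\<lambda>_. \<alpha>)))
        (mat_diag (Suc N) (f'(i := f i, N := f i * to_fract u * to_fract v)))"
    by (rule poly_fracts.equivalent_border[OF M(1,2) i(1) upoly(1) f'i upoly(2), folded \<alpha>_def]) (erule that)
  have yinf: "ind powi (q i - w) \<in> (proper_fracts :: 'a poly fract set)"
    using yz by (simp add: proper_fracts_def fdeg_le_def fdeg_ind_powi w_def)
  have q'i: "ind powi (- q' i) = ind powi (- q i) * (ind powi (q i - w) :: 'a poly fract)"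
    unfolding ind_powi_add[symmetric] by (simp add: q'_def)
  have zinf: "\<zeta> \<in> proper_fracts"
    using \<zeta>deg yz by (simp add: proper_fracts_def fdeg_le_def w_def)
  obtain w0 where w0: "\<And>x. (\<And>j. j < N \<Longrightarrow> \<exists>t\<in>proper_fracts. x j = w0 j + ind powi (k N + l N) * \<alpha> * t) \<Longrightarrow>
      proper_fracts.equivalent (four_block_mat (scale_mat k l M) (mat N 1 (\<lambda>(j, _). x j)) (0\<^sub>m 1 N)
          (mat 1 1 (\<lambda>_. ind powi (k N + l N) * \<alpha>)))
        (mat_diag (Suc N) ((\<lambda>i. ind powi (- q' i))(i := ind powi (- q i), N := ind powi (- q i) * ind powi (q i - w) * \<zeta>)))"
    by (rule proper_fracts.equivalent_border[OF scale_mat_carrier[OF M(1)] M(3) i(1) yinf q'i zinf,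
      unfolded \<alpha>inf]) (erule that)
  (* Correct v0 by a polynomial multiple of \<alpha> so that it differs from the column prescribed at infinity by a strictly proper multiple of \<alpha>. *)
  have "\<forall>j. \<exists>p y. (w0 j * ind powi (- (k j + l N)) - v0 j) / \<alpha> = to_fract p + y \<and> fdeg_le y (-1)"
    by (metis fract_split_polynomial)
  then obtain t e where te: "\<And>j. (w0 j * ind powi (- (k j + l N)) - v0 j) / \<alpha> = to_fract (t j) + e j"
    "\<And>j. fdeg_le (e j) (-1)" by metis
  define V where "V j = v0 j + \<alpha> * to_fract (t j)" for j
  have V: "V j = w0 j * ind powi (- (k j + l N)) - \<alpha> * e j" for j
    using te(1)[of j] \<alpha>0 by (simp add: V_def field_simps)
  define B where "B = four_block_mat M (mat N 1 (\<lambda>(j, _). V j)) (0\<^sub>m 1 N) (mat 1 1 (\<lambda>_. \<alpha>))"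
  have B: "B \<in> carrier_mat (Suc N) (Suc N)"
    using four_block_carrier_mat[OF M(1), of "mat 1 1 (\<lambda>_. \<alpha>)" 1 1] by (simp add: B_def)
  have scaleB: "scale_mat k l B = four_block_mat (scale_mat k l M)
      (mat N 1 (\<lambda>(j, _). ind powi (k j + l N) * V j)) (0\<^sub>m 1 N) (mat 1 1 (\<lambda>_. ind powi (k N + l N) * \<alpha>))"
    using M(1) by (intro eq_matI) (auto simp: scale_mat_def B_def less_Suc_eq)
  have finB: "poly_fracts.equivalent B (mat_diag (Suc N) (f'(i := f i, N := f i * to_fract u * to_fract v)))"
    unfolding B_def by (rule v0) (auto simp: V_def poly_fracts_def)
  have infB: "proper_fracts.equivalent (scale_mat k l B)
    (mat_diag (Suc N) ((\<lambda>i. ind powi (- q' i))(i := ind powi (- q i), N := ind powi (- q i) * ind powi (q i - w) * \<zeta>)))"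
    unfolding scaleB
  proof (rule w0)
    fix j assume j: "j < N"
    have "ind powi (k j + l N) * V j = w0 j - ind powi (k j + l N) * \<alpha> * e j"
    proof -
      have "ind powi (k j + l N) * ind powi (- (k j + l N)) = (1 :: 'a poly fract)"
        unfolding ind_powi_add[symmetric] by simp
      then show ?thesis
        unfolding V right_diff_distrib mult.left_commute[of _ "w0 j"] by (simp only: mult.assoc mult_1_right)
    qed
    note step = this
    have split: "ind powi (k j + l N) = (ind powi (k N + l N) * ind powi (k j - k N) :: 'a poly fract)"
      unfolding ind_powi_add[symmetric] by (simp add: add.commute)
    have "ind powi (k j + l N) * V j = w0 j + ind powi (k N + l N) * \<alpha> * (- (ind powi (k j - k N) * e j))"
      unfolding step unfolding split by (simp add: mult_ac)
    moreover have "- (ind powi (k j - k N) * e j) \<in> proper_fracts"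
    (* Here the increasing order of k enters. *)
    proof -
      have "fdeg_le (ind powi (k j - k N) :: 'a poly fract) 0"
        using kmono[of j N] j by (simp add: fdeg_le_def fdeg_ind_powi)
      from fdeg_le_mult[OF this te(2)[of j]] show ?thesis
        unfolding proper_fracts_def using fdeg_le_mono[of _ "0 + - 1" 0] by (auto intro: fdeg_le_uminus)
    qed
    ultimately show "\<exists>t\<in>proper_fracts. ind powi (k j + l N) * V j = w0 j + ind powi (k N + l N) * \<alpha> * t"
      by blast
  qed
  define \<pi> where "\<pi> = (\<lambda>j. if j = Suc i then N else if Suc i < j \<and> j \<le> N then j - 1 else j)"
  have \<pi>: "\<pi> permutes {..<Suc N}" unfolding \<pi>_def by (rule split_permutation[OF i(1)])
  have fp: "(f'(i := f i, N := f i * to_fract u * to_fract v)) (\<pi> j) = f j" if "j < Suc N" for j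
  proof -
    have "f i * to_fract u * to_fract v = f (Suc i)" using p uv by (simp add: mult_ac)
    then show ?thesis using that i(1) by (auto simp: f'_def \<pi>_def)
  qed
  let ?Q = "(\<lambda>i. ind powi (- q' i))(i := ind powi (- q i), N := ind powi (- q i) * ind powi (q i - w) * \<zeta>)"
  have qp: "?Q (\<pi> j) \<noteq> 0 \<and> fdeg (?Q (\<pi> j)) = - q j" if "j < Suc N" for j
  proof -
    have "fdeg (ind powi (- q i) * ind powi (q i - w) * \<zeta>) = - q (Suc i)"
      unfolding ind_powi_add[symmetric] using \<zeta>0 \<zeta>deg
      by (subst fdeg_mult) (simp_all add: fdeg_ind_powi)
    moreover have "\<pi> j = N \<longleftrightarrow> j = Suc i" using that i(1) by (auto simp: \<pi>_def)
    moreover have "\<pi> j \<noteq> N \<Longrightarrow> ?Q (\<pi> j) = ind powi (- q j)"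
      using that i(1) by (auto simp: q'_def \<pi>_def)
    ultimately show ?thesis using \<zeta>0 fdeg_ind_powi[of "- q j", where 'a = 'a]
      by (cases "j = Suc i") auto
  qed
  have "poly_fracts.equivalent B (mat_diag (Suc N) f)"
    using poly_fracts.equivalent_trans[OF finB poly_fracts.equivalent_diag_permute[OF \<pi>]]
    by (simp only: mat_diag_cong[OF fp])
  moreover have "proper_fracts.equivalent (scale_mat k l B) (mat_diag (Suc N) (\<lambda>i. ind powi (- q i)))"
  proof -
    have "proper_fracts.equivalent (mat_diag (Suc N) (\<lambda>j. ?Q (\<pi> j))) (mat_diag (Suc N) (\<lambda>i. ind powi (- q i)))"
    proof (rule proper_equivalent_diag)
      fix j assume j: "j < Suc N"
      show "?Q (\<pi> j) \<noteq> 0 \<and> ind powi (- q j) \<noteq> (0 :: 'a poly fract) \<and>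
          fdeg (?Q (\<pi> j)) = fdeg (ind powi (- q j) :: 'a poly fract)"
        unfolding fdeg_ind_powi using qp[OF j] ind_powi_nonzero by blast
    qed
    then show ?thesis
      using proper_fracts.equivalent_trans[OF infB] proper_fracts.equivalent_diag_permute[OF \<pi>, of ?Q]
        proper_fracts.equivalent_trans by blast
  qed
  ultimately show ?case using B by (auto simp: N_def)
qed

section \<open>Unimodular and biproper matrices as units\<close>

lemma rat_mat_mult:
  assumes "A \<in> carrier_mat m n" "B \<in> carrier_mat n p"
  shows "rat_mat (A * B) = rat_mat A * rat_mat B"
  using assms by (intro eq_matI) (auto simp: scalar_prod_def to_fract_sum)

lemma rat_mat_one: "rat_mat (1\<^sub>m n) = 1\<^sub>m n"
  by (intro eq_matI) auto

lemma rat_mat_eq_iff: "rat_mat A = rat_mat B \<longleftrightarrow> A = B"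
proof
  assume *: "rat_mat A = rat_mat B"
  then have dim: "dim_row A = dim_row B" "dim_col A = dim_col B"
    by (metis index_map_mat(2), metis index_map_mat(3))
  have "to_fract (A $$ (i, j)) = to_fract (B $$ (i, j))" if "i < dim_row B" "j < dim_col B" for i j
    using * dim that by (metis index_map_mat(1))
  then show "A = B" using dim by (intro eq_matI) auto
qed simp

lemma invertible_matE:
  assumes "invertible_mat A" "A \<in> carrier_mat n n"
  obtains B where "B \<in> carrier_mat n n" "A * B = 1\<^sub>m n" "B * A = 1\<^sub>m n"
proof -
  obtain B where B: "inverts_mat A B" "inverts_mat B A" using assms unfolding invertible_mat_def by blast
  have 1: "A * B = 1\<^sub>m n" using B assms by (simp add: inverts_mat_def)
  have "dim_col (A * B) = dim_col B" by simp
  then have "dim_col B = n" unfolding 1 by simp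
  moreover have "dim_row B = n"
  proof -
    have "dim_col (B * A) = dim_col (1\<^sub>m (dim_row B) :: 'a mat)" using B by (simp add: inverts_mat_def)
    then show ?thesis using assms by simp
  qed
  ultimately show ?thesis using that[of B] B 1 by (auto simp: inverts_mat_def)
qed

lemma unimodular_units:
  assumes "U \<in> carrier_mat m m" "unimodular_mat U"
  shows "rat_mat U \<in> poly_fracts.units m"
proof -
  obtain U' where U': "U' \<in> carrier_mat m m" "U * U' = 1\<^sub>m m" "U' * U = 1\<^sub>m m"
    using invertible_matE assms unfolding unimodular_mat_def by metis
  have "rat_mat U * rat_mat U' = 1\<^sub>m m" "rat_mat U' * rat_mat U = 1\<^sub>m m"
    unfolding rat_mat_mult[OF assms(1) U'(1), symmetric] rat_mat_mult[OF U'(1) assms(1), symmetric] U'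
    by (rule rat_mat_one)+
  moreover have "rat_mat X \<in> poly_fracts.mats m m" if "X \<in> carrier_mat m m" for X :: "'a poly mat"
    unfolding poly_fracts.mats_def using that by (auto simp: poly_fracts_def)
  ultimately show ?thesis unfolding poly_fracts.units_def using assms(1) U'(1) by blast
qed

lemma units_unimodular:
  assumes "W \<in> poly_fracts.units m"
  obtains U where "U \<in> carrier_mat m m" "unimodular_mat U" "rat_mat U = W"
proof -
  have lift: "\<exists>X0\<in>carrier_mat m m. rat_mat X0 = X" if X: "X \<in> poly_fracts.mats m m"
    for X :: "'a poly fract mat"
  proof -
    have "\<forall>i j. \<exists>p. i < m \<longrightarrow> j < m \<longrightarrow> X $$ (i, j) = to_fract p"
      using X unfolding poly_fracts.mats_def unfolding poly_fracts_def by auto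
    then obtain p where p: "\<And>i j. i < m \<Longrightarrow> j < m \<Longrightarrow> X $$ (i, j) = to_fract (p i j)" by metis
    have "rat_mat (mat m m (\<lambda>(i, j). p i j)) = X"
      using poly_fracts.mats_carrier[OF X] p by (intro eq_matI) auto
    then show ?thesis by (intro bexI[of _ "mat m m (\<lambda>(i, j). p i j)"]) auto
  qed
  obtain W' where W': "W' \<in> poly_fracts.units m" "W * W' = 1\<^sub>m m" "W' * W = 1\<^sub>m m"
    using poly_fracts.unitsE[OF assms] .
  obtain U where U: "U \<in> carrier_mat m m" "rat_mat U = W" using lift poly_fracts.units_mats[OF assms] by blast
  obtain U' where U': "U' \<in> carrier_mat m m" "rat_mat U' = W'" using lift poly_fracts.units_mats[OF W'(1)] by blast
  have "rat_mat (U * U') = rat_mat (1\<^sub>m m)" "rat_mat (U' * U) = rat_mat (1\<^sub>m m)"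
    using rat_mat_mult[OF U(1) U'(1)] rat_mat_mult[OF U'(1) U(1)] U U' W' rat_mat_one by auto
  then have "U * U' = 1\<^sub>m m" "U' * U = 1\<^sub>m m" unfolding rat_mat_eq_iff .
  then have "unimodular_mat U"
    unfolding unimodular_mat_def invertible_mat_def inverts_mat_def using U U' by auto
  then show ?thesis using that U by blast
qed

lemma proper_mat_iff:
  assumes "A \<in> carrier_mat m n"
  shows "proper_mat A \<longleftrightarrow> A \<in> proper_fracts.mats m n"
  using assms unfolding proper_mat_def proper_fracts.mats_def
  by (auto simp: proper_fract_iff proper_fracts_def)

lemma biproper_iff_units:
  assumes B: "B \<in> carrier_mat m m"
  shows "biproper_mat B \<longleftrightarrow> B \<in> proper_fracts.units m"
proof
  assume bi: "biproper_mat B"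
  then obtain C where C: "proper_mat C" "inverts_mat B C" "inverts_mat C B" and pB: "proper_mat B"
    unfolding biproper_mat_def by blast
  have 1: "B * C = 1\<^sub>m m" using C B by (simp add: inverts_mat_def)
  have "dim_col (B * C) = dim_col C" by simp
  then have c: "dim_col C = m" unfolding 1 by simp
  have "dim_col (C * B) = dim_col (1\<^sub>m (dim_row C) :: 'a poly fract mat)" using C by (simp add: inverts_mat_def)
  then have r: "dim_row C = m" using B by simp
  have cC: "C \<in> carrier_mat m m" using c r by auto
  have "C * B = 1\<^sub>m m" using C r by (simp add: inverts_mat_def)
  then show "B \<in> proper_fracts.units m"
    using 1 C(1) pB unfolding proper_fracts.units_def proper_mat_iff[OF B] proper_mat_iff[OF cC] by blast
next
  assume U: "B \<in> proper_fracts.units m"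
  obtain C where C: "C \<in> proper_fracts.units m" "B * C = 1\<^sub>m m" "C * B = 1\<^sub>m m"
    using proper_fracts.unitsE[OF U] .
  have cC: "C \<in> carrier_mat m m" by (rule proper_fracts.units_carrier[OF C(1)])
  have "proper_mat B" "proper_mat C"
    using proper_fracts.units_mats U C(1) unfolding proper_mat_iff[OF B] proper_mat_iff[OF cC] by blast+
  then show "biproper_mat B"
    unfolding biproper_mat_def inverts_mat_def using C B cC by auto
qed

lemma invariant_rational_functions_iff:
  assumes R: "R \<in> carrier_mat m n" "vec_space.rank m R = r"
    and len: "length eps = r" "length psi = r" and r: "r \<le> m" "r \<le> n"
  shows "invariant_rational_functions R eps psi \<longleftrightarrow> smith_mcmillan_seq eps psi \<and>
    poly_fracts.equivalent R
      (pad_mat m n (mat_diag r (\<lambda>i. to_fract (eps ! i) / to_fract (psi ! i))))"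
proof -
  let ?ds = "map2 (\<lambda>e p. to_fract e / to_fract p) eps psi"
  have "diag_block m n ?ds = pad_mat m n (mat_diag r (\<lambda>i. ?ds ! i))"
    using len r by (intro diag_block_pad) auto
  also have "mat_diag r (\<lambda>i. ?ds ! i) = mat_diag r (\<lambda>i. to_fract (eps ! i) / to_fract (psi ! i))"
    using len by (intro mat_diag_cong) auto
  finally have D: "diag_block m n ?ds =
      pad_mat m n (mat_diag r (\<lambda>i. to_fract (eps ! i) / to_fract (psi ! i)))" .
  have "(\<exists>U\<in>carrier_mat m m. \<exists>V\<in>carrier_mat n n. unimodular_mat U \<and> unimodular_mat V \<and>
      rat_mat U * R * rat_mat V = X) \<longleftrightarrow> poly_fracts.equivalent R X" for X
  proof
    assume "\<exists>U\<in>carrier_mat m m. \<exists>V\<in>carrier_mat n n. unimodular_mat U \<and> unimodular_mat V \<and>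
      rat_mat U * R * rat_mat V = X"
    then show "poly_fracts.equivalent R X"
      using poly_fracts.equivalentI[OF R(1)] unimodular_units by blast
  next
    assume "poly_fracts.equivalent R X"
    then obtain U V where "U \<in> poly_fracts.units m" "V \<in> poly_fracts.units n" "U * R * V = X"
      using poly_fracts.equivalentE[OF _ R(1)] by blast
    then show "\<exists>U\<in>carrier_mat m m. \<exists>V\<in>carrier_mat n n. unimodular_mat U \<and> unimodular_mat V \<and>
      rat_mat U * R * rat_mat V = X"
      using units_unimodular by metis
  qed
  then show ?thesis
    unfolding invariant_rational_functions_def using R len D by simp
qed

lemma invariant_orders_at_infinity_iff:
  assumes R: "R \<in> carrier_mat m n" "vec_space.rank m R = r"
    and len: "length q = r" and r: "r \<le> m" "r \<le> n"
  shows "invariant_orders_at_infinity R q \<longleftrightarrow> sorted q \<and>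
    proper_fracts.equivalent R (pad_mat m n (mat_diag r (\<lambda>i. ind powi (- (q ! i)))))"
proof -
  let ?ds = "map (\<lambda>i. (ind :: 'a poly fract) powi (- i)) q"
  have "diag_block m n ?ds = pad_mat m n (mat_diag r (\<lambda>i. ?ds ! i))"
    using len r by (intro diag_block_pad) auto
  also have "mat_diag r (\<lambda>i. ?ds ! i) = mat_diag r (\<lambda>i. ind powi (- (q ! i)))"
    using len by (intro mat_diag_cong) auto
  finally have D: "diag_block m n ?ds = pad_mat m n (mat_diag r (\<lambda>i. ind powi (- (q ! i))))" .
  have "(\<exists>U\<in>carrier_mat m m. \<exists>V\<in>carrier_mat n n. biproper_mat U \<and> biproper_mat V \<and>
      U * R * V = X) \<longleftrightarrow> proper_fracts.equivalent R X" for X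
  proof
    assume "\<exists>U\<in>carrier_mat m m. \<exists>V\<in>carrier_mat n n. biproper_mat U \<and> biproper_mat V \<and> U * R * V = X"
    then show "proper_fracts.equivalent R X"
      using proper_fracts.equivalentI[OF R(1)] biproper_iff_units by blast
  next
    assume "proper_fracts.equivalent R X"
    then obtain U V where "U \<in> proper_fracts.units m" "V \<in> proper_fracts.units n" "U * R * V = X"
      using proper_fracts.equivalentE[OF _ R(1)] by blast
    then show "\<exists>U\<in>carrier_mat m m. \<exists>V\<in>carrier_mat n n. biproper_mat U \<and> biproper_mat V \<and> U * R * V = X"
      using biproper_iff_units proper_fracts.units_carrier by metis
  qed
  then show ?thesis
    unfolding invariant_orders_at_infinity_def using R len D by simp
qed

section \<open>Factorization through minimal bases\<close>

lemma unit_columns_left_inverse: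
  "r \<le> m \<Longrightarrow> (unit_columns m r)\<^sup>T * unit_columns m r = (1\<^sub>m r :: 'k::comm_ring_1 mat)"
proof (rule eq_matI)
  fix i j assume r: "r \<le> m" and "i < dim_row (1\<^sub>m r :: 'k mat)" "j < dim_col (1\<^sub>m r :: 'k mat)"
  then have ij: "i < r" "j < r" by auto
  have "((unit_columns m r)\<^sup>T * unit_columns m r :: 'k mat) $$ (i, j) =
      (\<Sum>k\<in>{0..<m}. (if k = i then 1 else 0) * (if k = j then 1 else 0))"
    using ij by (simp add: scalar_prod_def unit_columns_def)
  also have "\<dots> = (\<Sum>k\<in>{0..<m}. if k = i then (if i = j then 1 else 0) else 0)"
    by (intro sum.cong) auto
  finally show "((unit_columns m r)\<^sup>T * unit_columns m r :: 'k mat) $$ (i, j) = 1\<^sub>m r $$ (i, j)"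
    using ij r by simp
qed (auto simp: unit_columns_def)

lemma minimal_basis_mat_left_inverse:
  fixes K :: "'a::field poly mat"
  assumes K: "K \<in> carrier_mat m r" "minimal_basis_mat K" and r: "r \<le> m"
  obtains X where "X \<in> carrier_mat r m" "X * rat_mat K = 1\<^sub>m r"
proof -
  obtain W where W: "W \<in> poly_fracts.units m" "rat_mat K = W * unit_columns m r"
    using minimal_basis_mat_poly_completion[OF K r] .
  obtain W' where W': "W' \<in> poly_fracts.units m" "W * W' = 1\<^sub>m m" "W' * W = 1\<^sub>m m"
    using poly_fracts.unitsE[OF W(1)] .
  note c = poly_fracts.units_carrier[OF W(1)] poly_fracts.units_carrier[OF W'(1)]
  let ?J = "unit_columns m r :: 'a poly fract mat"
  have J: "?J \<in> carrier_mat m r" "?J\<^sup>T \<in> carrier_mat r m" by auto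
  have "(?J\<^sup>T * W') * (W * ?J) = ?J\<^sup>T * (W' * (W * ?J))"
    by (rule assoc_mult_mat[of _ r m _ m _ r]) (use c J in auto)
  also have "W' * (W * ?J) = (W' * W) * ?J"
    by (rule assoc_mult_mat[of _ m m _ m _ r, symmetric]) (use c J in auto)
  also have "?J\<^sup>T * ((W' * W) * ?J) = 1\<^sub>m r"
    unfolding W'(3) left_mult_one_mat[OF J(1)] by (rule unit_columns_left_inverse[OF r])
  finally have "(?J\<^sup>T * W') * rat_mat K = 1\<^sub>m r" using W(2) by simp
  then show ?thesis using that[of "?J\<^sup>T * W'"] c J by auto
qed

lemma range_space_subsetD:
  assumes A: "A \<in> carrier_mat m r" and R: "R \<in> carrier_mat m n"
    and sub: "range_space A \<subseteq> range_space R"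
  shows "\<exists>Z\<in>carrier_mat n r. A = R * Z"
proof -
  have "\<exists>z\<in>carrier_vec n. R *\<^sub>v z = col A j" if j: "j < r" for j
  proof -
    have "A *\<^sub>v unit_vec r j = col A j"
      using col_mult2[OF A one_carrier_mat j] A j by simp
    then have "col A j \<in> range_space A"
      using vec_space.col_space_eq[OF A] A j by auto
    then show ?thesis using sub vec_space.col_space_eq[OF R] A R by auto
  qed
  then obtain z where z: "\<And>j. j < r \<Longrightarrow> z j \<in> carrier_vec n" "\<And>j. j < r \<Longrightarrow> R *\<^sub>v z j = col A j"
    by metis
  define Z where "Z = mat n r (\<lambda>(i, j). z j $ i)"
  have Z: "Z \<in> carrier_mat n r" by (simp add: Z_def)
  have "A = R * Z"
  proof (rule eq_matI)
    fix i j assume "i < dim_row (R * Z)" "j < dim_col (R * Z)"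
    then have ij: "i < m" "j < r" using R Z by auto
    have "col Z j = z j" using z(1)[OF ij(2)] ij by (intro eq_vecI) (auto simp: Z_def)
    then have "col (R * Z) j = col A j" using col_mult2[OF R Z ij(2)] z(2)[OF ij(2)] by simp
    then have "col (R * Z) j $ i = col A j $ i" by simp
    then show "A $$ (i, j) = (R * Z) $$ (i, j)"
      using ij A R Z by simp
  qed (use A R Z in auto)
  then show ?thesis using Z by blast
qed

lemma range_space_factor:
  assumes A: "A \<in> carrier_mat m r" "X \<in> carrier_mat r m" "X * A = 1\<^sub>m r"
    and R: "R \<in> carrier_mat m n" and sub: "range_space R \<subseteq> range_space A"
  shows "A * (X * R) = R"
proof -
  obtain Y where Y: "Y \<in> carrier_mat r n" "R = A * Y" using range_space_subsetD[OF R A(1) sub] by blast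
  have "X * R = (X * A) * Y"
    unfolding Y(2) by (rule assoc_mult_mat[symmetric]) (use A Y in auto)
  then show ?thesis using A(3) Y by simp
qed

lemma range_space_mult_right:
  assumes A: "A \<in> carrier_mat m r" and B: "B \<in> carrier_mat r n"
  shows "range_space (A * B) \<subseteq> range_space A"
proof -
  have AB: "A * B \<in> carrier_mat m n" using A B by simp
  have "\<exists>y\<in>carrier_vec r. A *\<^sub>v y = A * B *\<^sub>v x" if "x \<in> carrier_vec n" for x
    using assoc_mult_mat_vec[OF A B that] B that by (intro bexI[of _ "B *\<^sub>v x"]) auto
  then show ?thesis
    using vec_space.col_space_eq[OF AB] vec_space.col_space_eq[OF A] A B by auto
qed

lemma assoc_outer_mat:
  fixes W :: "'k::comm_ring_1 mat"
  assumes "W \<in> carrier_mat m m" "J \<in> carrier_mat m r" "M \<in> carrier_mat r r"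
    "J' \<in> carrier_mat r n" "W' \<in> carrier_mat n n"
  shows "(W * J) * M * (J' * W') = W * (J * M * J') * W'"
proof -
  have "(W * J) * M = W * (J * M)" by (rule assoc_mult_mat) (use assms in auto)
  then have "(W * J) * M * (J' * W') = (W * (J * M)) * J' * W'"
    using assoc_mult_mat[of "W * (J * M)" m r J' n W' n] assms by simp
  also have "(W * (J * M)) * J' = W * (J * M * J')" by (rule assoc_mult_mat) (use assms in auto)
  finally show ?thesis .
qed

text \<open>
  Over the polynomials both minimal bases are \<open>[I; 0]\<close> up to units, and \<open>K M L\<close> becomes \<open>M\<close> padded with zeros. Over the
  proper functions this holds after the columns of the bases are divided by powers of the indeterminate, and
  multiplying \<open>M\<close> by these powers compensates the division.
\<close>

lemma minimal_factorization_equivalent: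
  fixes K L :: "'a::field poly mat"
  assumes K: "K \<in> carrier_mat m r" "minimal_basis_mat K"
    and L: "L \<in> carrier_mat r n" "minimal_basis_mat L\<^sup>T" and r: "r \<le> m" "r \<le> n"
    and M: "M \<in> carrier_mat r r"
  defines "R \<equiv> rat_mat K * M * rat_mat L"
  defines "k \<equiv> \<lambda>j. int (vec_degree (col K j))" and "l \<equiv> \<lambda>j. int (vec_degree (col L\<^sup>T j))"
  shows "poly_fracts.equivalent (pad_mat m n M) R"
    and "proper_fracts.equivalent (pad_mat m n (scale_mat k l M)) R"
proof -
  have LT: "L\<^sup>T \<in> carrier_mat n r" using L by simp
  let ?Jm = "unit_columns m r :: 'a poly fract mat" and ?Jn = "unit_columns n r :: 'a poly fract mat"
  have J: "?Jm \<in> carrier_mat m r" "?Jn \<in> carrier_mat n r" "?Jn\<^sup>T \<in> carrier_mat r n" by auto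
  have ratLT: "rat_mat L\<^sup>T = (rat_mat L)\<^sup>T" by (intro eq_matI) auto
  obtain W where W: "W \<in> poly_fracts.units m" "rat_mat K = W * ?Jm"
    using minimal_basis_mat_poly_completion[OF K r(1)] .
  obtain W' where W': "W' \<in> poly_fracts.units n" "rat_mat L\<^sup>T = W' * ?Jn"
    using minimal_basis_mat_poly_completion[OF LT L(2) r(2)] .
  have rL: "rat_mat L = ?Jn\<^sup>T * W'\<^sup>T"
    using W'(2) poly_fracts.units_carrier[OF W'(1)] J unfolding ratLT
    by (metis transpose_mult transpose_transpose)
  have "R = W * (?Jm * M * ?Jn\<^sup>T) * W'\<^sup>T"
    unfolding R_def W(2) rL
    by (rule assoc_outer_mat) (use poly_fracts.units_carrier[OF W(1)] poly_fracts.units_carrier[OF W'(1)] J M in auto)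
  then have "R = W * pad_mat m n M * W'\<^sup>T" using unit_columns_pad[OF M r] by simp
  then show "poly_fracts.equivalent (pad_mat m n M) R"
    using poly_fracts.equivalentI[OF pad_mat_carrier W(1) poly_fracts.units_transpose[OF W'(1)]] by blast
  define DK where "DK = mat_diag r (\<lambda>j. ind powi (- k j) :: 'a poly fract)"
  define DL where "DL = mat_diag r (\<lambda>j. ind powi (- l j) :: 'a poly fract)"
  define EK where "EK = mat_diag r (\<lambda>j. ind powi (k j) :: 'a poly fract)"
  define EL where "EL = mat_diag r (\<lambda>j. ind powi (l j) :: 'a poly fract)"
  have c: "DK \<in> carrier_mat r r" "DL \<in> carrier_mat r r" "EK \<in> carrier_mat r r" "EL \<in> carrier_mat r r"
    by (auto simp: DK_def DL_def EK_def EL_def)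
  have inv: "DK * EK = 1\<^sub>m r" "DL * EL = 1\<^sub>m r"
    unfolding DK_def EK_def DL_def EL_def mat_diag_diag ind_powi_add[symmetric] by simp_all
  obtain B where B: "B \<in> proper_fracts.units m" "rat_mat K * DK = B * ?Jm"
    using minimal_basis_mat_proper_completion[OF K r(1)] K(1) unfolding DK_def k_def by auto
  obtain B' where B': "B' \<in> proper_fracts.units n" "rat_mat L\<^sup>T * DL = B' * ?Jn"
    using minimal_basis_mat_proper_completion[OF LT L(2) r(2)] LT unfolding DL_def l_def by auto
  have cB: "B \<in> carrier_mat m m" "B' \<in> carrier_mat n n"
    using proper_fracts.units_carrier B(1) B'(1) by auto
  have cK: "rat_mat K \<in> carrier_mat m r" and cL: "rat_mat L\<^sup>T \<in> carrier_mat n r" using K L by auto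
  have undo: "A = (A * D) * E" if "A \<in> carrier_mat p r" "D \<in> carrier_mat r r" "E \<in> carrier_mat r r"
    "D * E = 1\<^sub>m r" for A D E :: "'a poly fract mat" and p
    using assoc_mult_mat[OF that(1-3)] that by simp
  have eK: "rat_mat K = B * ?Jm * EK" using undo[OF cK c(1,3) inv(1)] B(2) by simp
  have eL: "rat_mat L = EL * (?Jn\<^sup>T * B'\<^sup>T)"
  proof -
    have "rat_mat L\<^sup>T = B' * ?Jn * EL" using undo[OF cL c(2,4) inv(2)] B'(2) by simp
    then have "rat_mat L = (B' * ?Jn * EL)\<^sup>T" unfolding ratLT by (metis transpose_transpose)
    also have "\<dots> = EL\<^sup>T * (B' * ?Jn)\<^sup>T" by (rule transpose_mult[of _ n r _ r]) (use cB J c in auto)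
    also have "(B' * ?Jn)\<^sup>T = ?Jn\<^sup>T * B'\<^sup>T" by (rule transpose_mult[of _ n n _ r]) (use cB J in auto)
    also have "EL\<^sup>T = EL" by (intro eq_matI) (auto simp: EL_def mat_diag_def)
    finally show ?thesis .
  qed
  have cBJ: "B * ?Jm \<in> carrier_mat m r" "?Jn\<^sup>T * B'\<^sup>T \<in> carrier_mat r n"
    using cB J by (auto intro: mult_carrier_mat[of _ m m _ r] mult_carrier_mat[of _ r n _ n])
  have "R = (B * ?Jm * EK) * M * (EL * (?Jn\<^sup>T * B'\<^sup>T))" unfolding R_def eK eL ..
  also have "\<dots> = (B * ?Jm) * (EK * M * EL) * (?Jn\<^sup>T * B'\<^sup>T)"
  proof -
    have 1: "(B * ?Jm * EK) * M = (B * ?Jm) * (EK * M)"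
      by (rule assoc_mult_mat[of _ m r _ r _ r]) (use cBJ c M in auto)
    have 2: "(B * ?Jm) * (EK * M) * (EL * (?Jn\<^sup>T * B'\<^sup>T)) = (B * ?Jm) * (EK * M) * EL * (?Jn\<^sup>T * B'\<^sup>T)"
      by (rule assoc_mult_mat[of _ m r _ r _ n, symmetric]) (use cBJ c M in auto)
    have 3: "(B * ?Jm) * (EK * M) * EL = (B * ?Jm) * (EK * M * EL)"
      by (rule assoc_mult_mat[of _ m r _ r _ r]) (use cBJ c M in auto)
    show ?thesis unfolding 1 2 3 ..
  qed
  also have "EK * M * EL = scale_mat k l M"
    unfolding EK_def EL_def by (rule scale_mat_diag[OF M])
  also have "(B * ?Jm) * scale_mat k l M * (?Jn\<^sup>T * B'\<^sup>T) = B * (?Jm * scale_mat k l M * ?Jn\<^sup>T) * B'\<^sup>T"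
    by (rule assoc_outer_mat[of _ m _ r _ _ n]) (use cB J M in auto)
  also have "\<dots> = B * pad_mat m n (scale_mat k l M) * B'\<^sup>T"
    using unit_columns_pad[OF scale_mat_carrier[OF M] r] by simp
  finally show "proper_fracts.equivalent (pad_mat m n (scale_mat k l M)) R"
    using proper_fracts.equivalentI[OF pad_mat_carrier B(1) proper_fracts.units_transpose[OF B'(1)]] by metis
qed

text \<open>
  The right factor \<open>M * B\<close> has the right inverse \<open>Z * N\<close>, with \<open>N\<close> the inverse of \<open>M\<close>.
\<close>

lemma range_space_sandwich:
  fixes A :: "'a::field poly fract mat"
  assumes A: "A \<in> carrier_mat m r" and M: "M \<in> carrier_mat r r" "det M \<noteq> 0"
    and B: "B \<in> carrier_mat r n" and Z: "Z \<in> carrier_mat n r" "B * Z = 1\<^sub>m r"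
  shows "range_space (A * M * B) = range_space A"
proof
  have AMB: "A * M * B = A * (M * B)"
    by (rule assoc_mult_mat) (use A M B in auto)
  show "range_space (A * M * B) \<subseteq> range_space A"
    unfolding AMB by (rule range_space_mult_right[of _ m r _ n]) (use A M B in auto)
  from det_non_zero_imp_unit[OF M, unfolded Units_def, of "()"]
  obtain N where N: "N \<in> carrier_mat r r" "M * N = 1\<^sub>m r"
    by (auto simp: ring_mat_def)
  have "(A * M * B) * (Z * N) = (A * M) * (B * (Z * N))"
    by (rule assoc_mult_mat) (use A M B Z N in auto)
  also have "B * (Z * N) = (B * Z) * N"
    by (rule assoc_mult_mat[symmetric]) (use B Z N in auto)
  also have "(A * M) * ((B * Z) * N) = A * (M * N)"
    by (simp only: Z(2) left_mult_one_mat[OF N(1)] assoc_mult_mat[OF A M(1) N(1)])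
  finally have "(A * M * B) * (Z * N) = A" using A N by simp
  moreover have "range_space ((A * M * B) * (Z * N)) \<subseteq> range_space (A * M * B)"
    by (rule range_space_mult_right[of _ m n _ r]) (use A M B Z N in auto)
  ultimately show "range_space A \<subseteq> range_space (A * M * B)" by simp
qed

text \<open>
  The middle factor is \<open>X R Y\<^sup>T\<close>, with \<open>X\<close> and \<open>Y\<close> left inverses of \<open>A\<close> and \<open>B\<^sup>T\<close>; the products \<open>A X\<close> and \<open>Y\<^sup>T B\<close> act as
  the identity on the left and on the right of \<open>R\<close> by the hypotheses on the ranges. It is invertible because the columns of \<open>A\<close>
  are in turn combinations of those of \<open>R\<close>.
\<close>

lemma core_of_factorization:
  fixes A :: "'a::field poly fract mat"
  assumes A: "A \<in> carrier_mat m r" "X \<in> carrier_mat r m" "X * A = 1\<^sub>m r"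
    and B: "B \<in> carrier_mat r n" "Y \<in> carrier_mat r n" "Y * B\<^sup>T = 1\<^sub>m r"
    and R: "R \<in> carrier_mat m n"
    and range: "range_space R = range_space A" "range_space R\<^sup>T = range_space B\<^sup>T"
  obtains M where "M \<in> carrier_mat r r" "det M \<noteq> 0" "R = A * M * B"
proof -
  have AX: "A * (X * R) = R" by (rule range_space_factor[OF A R]) (simp add: range)
  have "B\<^sup>T * (Y * R\<^sup>T) = R\<^sup>T"
    by (rule range_space_factor[of _ n r _ _ m]) (use B R range in auto)
  then have "R = (B\<^sup>T * (Y * R\<^sup>T))\<^sup>T" by simp
  also have "\<dots> = (Y * R\<^sup>T)\<^sup>T * B"
    by (subst transpose_mult[of _ n r _ m]) (use B R in auto)
  also have "(Y * R\<^sup>T)\<^sup>T = R * Y\<^sup>T"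
    by (subst transpose_mult[of _ r n _ m]) (use B R in auto)
  finally have BY: "R = R * Y\<^sup>T * B" .
  define M where "M = X * R * Y\<^sup>T"
  have M: "M \<in> carrier_mat r r" using A R B by (auto simp: M_def)
  have "A * M = A * (X * R) * Y\<^sup>T"
    unfolding M_def by (rule assoc_mult_mat[symmetric]) (use A R B in auto)
  then have "A * M * B = R * Y\<^sup>T * B" unfolding AX by (rule arg_cong)
  then have R_eq: "R = A * M * B" unfolding BY[symmetric] by (rule sym)
  obtain Z where Z: "Z \<in> carrier_mat n r" "A = R * Z"
    using range_space_subsetD[OF A(1) R] range by auto
  have "A * (M * (B * Z)) = A * M * (B * Z)"
    by (rule assoc_mult_mat[symmetric]) (use A M B Z(1) in auto)
  also have "\<dots> = A * M * B * Z" by (rule assoc_mult_mat[symmetric]) (use A M B Z(1) in auto)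
  also have "\<dots> = A" unfolding R_eq[symmetric] by (rule Z(2)[symmetric])
  finally have "X * (A * (M * (B * Z))) = 1\<^sub>m r" using A(3) by simp
  then have "1\<^sub>m r = X * (A * (M * (B * Z)))" by (rule sym)
  also have "\<dots> = (X * A) * (M * (B * Z))"
    by (rule assoc_mult_mat[symmetric]) (use A M B Z(1) in auto)
  finally have "1\<^sub>m r = M * (B * Z)" using A(3) M B Z(1) by simp
  then have "det (1\<^sub>m r :: 'a poly fract mat) = det M * det (B * Z)"
    using det_mult[OF M, of "B * Z"] B Z(1) by simp
  then have "det M \<noteq> 0" by auto
  then show ?thesis using that M R_eq by blast
qed

section \<open>Rational matrices with prescribed structure and range spaces\<close>

lemma smith_mcmillan_fractions:
  fixes eps psi :: "'a::field poly list"
  assumes seq: "smith_mcmillan_seq eps psi" "length eps = r"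
  defines "f \<equiv> \<lambda>i. to_fract (eps ! i) / to_fract (psi ! i)"
  shows "i < r \<Longrightarrow> f i \<noteq> 0"
    and "i < r \<Longrightarrow> fdeg (f i) = int (degree (eps ! i)) - int (degree (psi ! i))"
    and "Suc i < r \<Longrightarrow> \<exists>p. f (Suc i) = f i * to_fract p"
proof -
  have nz: "eps ! i \<noteq> 0" "psi ! i \<noteq> 0" if "i < r" for i
    using seq that unfolding smith_mcmillan_seq_def by (metis leading_coeff_0_iff zero_neq_one)+
  show "i < r \<Longrightarrow> f i \<noteq> 0" using nz by (simp add: f_def)
  show "i < r \<Longrightarrow> fdeg (f i) = int (degree (eps ! i)) - int (degree (psi ! i))"
    unfolding f_def using nz by (intro fdeg_quotient) auto
  assume i: "Suc i < r"
  then have "eps ! i dvd eps ! Suc i" "psi ! Suc i dvd psi ! i"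
    using seq unfolding smith_mcmillan_seq_def by auto
  then obtain a b where ab: "eps ! Suc i = eps ! i * a" "psi ! i = psi ! Suc i * b"
    by (auto elim!: dvdE)
  have "b \<noteq> 0" "psi ! Suc i \<noteq> 0" using nz[of i] i ab by auto
  then have "f (Suc i) = f i * to_fract (a * b)"
    unfolding f_def ab by (simp add: field_simps)
  then show "\<exists>p. f (Suc i) = f i * to_fract p" by blast
qed

lemma reverse_permutes: "(\<lambda>i. if i < r then r - 1 - i else i) permutes {..<r :: nat}"
  by (rule inj_imp_permutes) (auto simp: inj_on_def)

theorem theorem6p2:
  fixes m n r :: nat
    and eps psi :: "'a::field poly list"
    and q :: "int list"
    and K L :: "'a poly mat"
    and k l g :: "nat list"
  assumes pos: "0 < m" "0 < n" "0 < r" and r_le: "r \<le> min m n"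
    and fractions: "length eps = r" "length psi = r" "smith_mcmillan_seq eps psi"
    and orders: "length q = r" "sorted q"
    and K: "K \<in> carrier_mat m r" "minimal_basis_mat K"
    and k: "k = column_degrees K" "sorted_wrt (\<ge>) k"
    and L: "L \<in> carrier_mat r n" "minimal_basis_mat L\<^sup>T"
    and l: "l = column_degrees L\<^sup>T" "sorted_wrt (\<ge>) l"
    and g: "g = rev (sort (map2 (+) (rev k) l))"
  shows
    "(\<forall>R \<in> carrier_mat m n.
        vec_space.rank m R = r \<and>
        invariant_rational_functions R eps psi \<and>
        invariant_orders_at_infinity R q \<and>
        range_space R = range_space (rat_mat K) \<and>
        range_space R\<^sup>T = range_space (rat_mat L\<^sup>T) \<longrightarrow>
        map (\<lambda>x. - int x) (rev g) \<prec>\<^sub>m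
          rev (map (\<lambda>i. int (degree (eps ! i)) - int (degree (psi ! i)) + q ! i) [0..<r]))
     \<and>
     ((\<forall>p :: 'a poly. 0 < degree p \<longrightarrow> (\<exists>x. poly p x = 0)) \<longrightarrow>
        map (\<lambda>x. - int x) (rev g) \<prec>\<^sub>m
          rev (map (\<lambda>i. int (degree (eps ! i)) - int (degree (psi ! i)) + q ! i) [0..<r]) \<longrightarrow>
        (\<exists>R \<in> carrier_mat m n.
           vec_space.rank m R = r \<and>
           invariant_rational_functions R eps psi \<and>
           invariant_orders_at_infinity R q \<and>
           range_space R = range_space (rat_mat K) \<and>
           range_space R\<^sup>T = range_space (rat_mat L\<^sup>T)))"
proof -
  have rm: "r \<le> m" "r \<le> n" using r_le by auto
  have LT: "L\<^sup>T \<in> carrier_mat n r" using L by simp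
  define f where "f = (\<lambda>i. to_fract (eps ! i) / to_fract (psi ! i))"
  have f: "\<And>i. i < r \<Longrightarrow> f i \<noteq> 0"
    "\<And>i. i < r \<Longrightarrow> fdeg (f i) = int (degree (eps ! i)) - int (degree (psi ! i))"
    "\<And>i. Suc i < r \<Longrightarrow> \<exists>p. f (Suc i) = f i * to_fract p"
    unfolding f_def using smith_mcmillan_fractions[OF fractions(3,1)] by blast+
  define kk where "kk j = int (vec_degree (col K j))" for j
  define ll where "ll j = int (vec_degree (col L\<^sup>T j))" for j
  have len: "length k = r" "length l = r"
    using k(1) l(1) K(1) LT by (auto simp: column_degrees_def)
  have k_nth: "int (k ! j) = kk j" "int (l ! j) = ll j" if "j < r" for j
    using that k(1) l(1) K(1) LT by (auto simp: column_degrees_def kk_def ll_def)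
  have kk_anti: "kk j \<le> kk i" "ll j \<le> ll i" if "i \<le> j" "j < r" for i j
  proof -
    have "k ! j \<le> k ! i" "l ! j \<le> l ! i"
      using k(2) l(2) that len by (cases "i = j"; auto simp: sorted_wrt_iff_nth_less)+
    then show "kk j \<le> kk i" "ll j \<le> ll i" using k_nth that by (metis of_nat_le_iff order_le_less_trans)+
  qed
  have q_mono: "q ! i \<le> q ! Suc i" if "Suc i < r" for i
    using orders that by (simp add: sorted_nth_mono)
  let ?zs = "map2 (+) (rev k) l"
  let ?xs = "map (\<lambda>i. int (degree (eps ! i)) - int (degree (psi ! i)) + q ! i) [0..<r]"
  have "map (\<lambda>x. - int x) (rev g) \<prec>\<^sub>m rev ?xs \<longleftrightarrow>
      dominates (\<lambda>i. ?xs ! i) (\<lambda>j. - int (?zs ! j)) r"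
    unfolding g rev_rev_ident by (rule majorized_iff_dominates) (use len in auto)
  also have "\<dots> \<longleftrightarrow> dominates (\<lambda>i. fdeg (f i) + q ! i) (\<lambda>j. - (kk (r - 1 - j) + ll j)) r"
  proof (rule dominates_cong)
    show "?xs ! i = fdeg (f i) + q ! i" if "i < r" for i using that f(2) by simp
    show "- int (?zs ! j) = - (kk (r - 1 - j) + ll j)" if "j < r" for j
      using that len k_nth(1)[of "r - 1 - j"] k_nth(2)[of j] by (simp add: rev_nth)
  qed
  finally have maj: "map (\<lambda>x. - int x) (rev g) \<prec>\<^sub>m rev ?xs \<longleftrightarrow>
      dominates (\<lambda>i. fdeg (f i) + q ! i) (\<lambda>j. - (kk (r - 1 - j) + ll j)) r" .
  have cK: "rat_mat K \<in> carrier_mat m r" and cL: "rat_mat L \<in> carrier_mat r n"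
    and ratLT: "rat_mat L\<^sup>T = (rat_mat L)\<^sup>T" using K L by auto
  obtain X where X: "X \<in> carrier_mat r m" "X * rat_mat K = 1\<^sub>m r"
    using minimal_basis_mat_left_inverse[OF K rm(1)] .
  obtain Y where Y: "Y \<in> carrier_mat r n" "Y * (rat_mat L)\<^sup>T = 1\<^sub>m r"
    using minimal_basis_mat_left_inverse[OF LT L(2) rm(2)] unfolding ratLT .
  show ?thesis
  proof (intro conjI ballI impI)
    fix R :: "'a poly fract mat" assume R: "R \<in> carrier_mat m n"
    assume "vec_space.rank m R = r \<and> invariant_rational_functions R eps psi \<and>
        invariant_orders_at_infinity R q \<and> range_space R = range_space (rat_mat K) \<and>
        range_space R\<^sup>T = range_space (rat_mat L\<^sup>T)"
    then have rank: "vec_space.rank m R = r" and fin: "invariant_rational_functions R eps psi"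
      and inf: "invariant_orders_at_infinity R q" and rK: "range_space R = range_space (rat_mat K)"
      and rL: "range_space R\<^sup>T = range_space (rat_mat L)\<^sup>T" unfolding ratLT by auto
    obtain M where M: "M \<in> carrier_mat r r" "det M \<noteq> 0" "R = rat_mat K * M * rat_mat L"
      using core_of_factorization[OF cK X cL Y R rK rL] .
    note eqR = minimal_factorization_equivalent[OF K L rm M(1), folded M(3) kk_def ll_def]
    have "poly_fracts.equivalent (pad_mat m n M) (pad_mat m n (mat_diag r f))"
      using poly_fracts.equivalent_trans[OF eqR(1)] fin
      unfolding invariant_rational_functions_iff[OF R rank fractions(1,2) rm] f_def by blast
    moreover have "proper_fracts.equivalent (pad_mat m n (scale_mat kk ll M))
        (pad_mat m n (mat_diag r (\<lambda>i. ind powi (- (q ! i)))))"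
      using proper_fracts.equivalent_trans[OF eqR(2)] inf
      unfolding invariant_orders_at_infinity_iff[OF R rank orders(1) rm] by blast
    moreover have "\<exists>s\<in>poly_fracts. f (Suc i) = f i * s" if "Suc i < r" for i
      using f(3)[OF that] by (auto simp: poly_fracts_def)
    ultimately have "dominates (\<lambda>i. fdeg (f i) + q ! i) (\<lambda>j. - (kk (r - 1 - j) + ll j)) r"
      by (intro structure_dominates[OF M(1,2) rm]) (use kk_anti f(1) q_mono in auto)
    then show "map (\<lambda>x. - int x) (rev g) \<prec>\<^sub>m rev ?xs" unfolding maj .
  next
    assume closed: "\<forall>p :: 'a poly. 0 < degree p \<longrightarrow> (\<exists>x. poly p x = 0)"
      and "map (\<lambda>x. - int x) (rev g) \<prec>\<^sub>m rev ?xs"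
    then have dom: "dominates (\<lambda>i. fdeg (f i) + q ! i) (\<lambda>j. - (kk (r - 1 - j) + ll j)) r"
      unfolding maj by blast
    obtain N where N: "r = Suc N" using pos(3) by (cases r) auto
    define \<kappa> where "\<kappa> j = kk (r - 1 - j)" for j
    have "\<exists>M\<in>carrier_mat (Suc N) (Suc N). poly_fracts.equivalent M (mat_diag (Suc N) f) \<and>
        proper_fracts.equivalent (scale_mat \<kappa> ll M) (mat_diag (Suc N) (\<lambda>i. ind powi (- (q ! i))))"
    proof (rule structure_realizable)
      show "\<exists>x. poly p x = 0" if "0 < degree p" for p :: "'a poly" using closed that by blast
      show "f i \<noteq> 0" if "i \<le> N" for i using f(1)[of i] that N by simp
      show "\<exists>p. f (Suc i) = f i * to_fract p" if "i < N" for i using f(3)[of i] that N by simp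
      show "q ! i \<le> q ! Suc i" if "i < N" for i using q_mono[of i] that N by simp
      show "\<kappa> i \<le> \<kappa> j" if "i \<le> j" "j \<le> N" for i j
        unfolding \<kappa>_def using that N by (intro kk_anti) auto
      show "dominates (\<lambda>i. fdeg (f i) + q ! i) (\<lambda>j. - (\<kappa> j + ll j)) (Suc N)"
        using dom unfolding \<kappa>_def N .
    qed
    then obtain M0 where M0: "M0 \<in> carrier_mat r r" "poly_fracts.equivalent M0 (mat_diag r f)"
      "proper_fracts.equivalent (scale_mat \<kappa> ll M0) (mat_diag r (\<lambda>i. ind powi (- (q ! i))))"
      unfolding N by blast
    (* The realization has its rows in the order of increasing k, the reverse of the order of the columns of K. *)
    define \<rho> where "\<rho> = (\<lambda>i. if i < r then r - 1 - i else i)"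
    have \<rho>: "\<rho> permutes {..<r}" unfolding \<rho>_def by (rule reverse_permutes)
    define M where "M = reindex_mat r \<rho> * M0"
    have M: "M \<in> carrier_mat r r" unfolding M_def using M0(1) by (auto intro: mult_carrier_mat)
    have scaleM: "scale_mat kk ll M = reindex_mat r \<rho> * scale_mat \<kappa> ll M0"
      unfolding M_def reindex_mat_mult[OF M0(1) \<rho>] reindex_mat_mult[OF scale_mat_carrier[OF M0(1)] \<rho>]
      using M0(1) by (intro eq_matI) (auto simp: scale_mat_def \<rho>_def \<kappa>_def)
    have eqM: "poly_fracts.equivalent M (mat_diag r f)"
    proof (rule poly_fracts.equivalent_trans[OF poly_fracts.equivalent_sym M0(2)])
      show "poly_fracts.equivalent M0 M"
        by (rule poly_fracts.equivalentI[OF M0(1) poly_fracts.units_reindex_mat[OF \<rho>] poly_fracts.units_one])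
          (simp only: M_def[symmetric] right_mult_one_mat[OF M])
    qed
    have infM: "proper_fracts.equivalent (scale_mat kk ll M) (mat_diag r (\<lambda>i. ind powi (- (q ! i))))"
    proof (rule proper_fracts.equivalent_trans[OF proper_fracts.equivalent_sym M0(3)])
      show "proper_fracts.equivalent (scale_mat \<kappa> ll M0) (scale_mat kk ll M)"
        by (rule proper_fracts.equivalentI[OF scale_mat_carrier[OF M0(1)]
            proper_fracts.units_reindex_mat[OF \<rho>] proper_fracts.units_one])
          (simp only: scaleM[symmetric] right_mult_one_mat[OF scale_mat_carrier[OF M]])
    qed
    have padM: "poly_fracts.equivalent (pad_mat m n M) (pad_mat m n (mat_diag r f))"
      by (rule poly_fracts.equivalent_pad[OF M eqM rm])
    have detM: "det M \<noteq> 0"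
    proof
      assume "det M = 0"
      moreover obtain s where "(\<Prod>i<r. f i) = det M * s"
        using poly_fracts.det_divides_diag[OF padM M rm] by blast
      ultimately have "(\<Prod>i<r. f i) = 0" by simp
      then show False using f(1) by auto
    qed
    define R where "R = rat_mat K * M * rat_mat L"
    have R: "R \<in> carrier_mat m n" unfolding R_def using cK M cL by auto
    note eqR = minimal_factorization_equivalent[OF K L rm M, folded R_def kk_def ll_def]
    have rK: "range_space R = range_space (rat_mat K)"
    proof -
      have "rat_mat L * Y\<^sup>T = (Y * (rat_mat L)\<^sup>T)\<^sup>T"
        using cL Y by (subst transpose_mult[of _ r n _ r]) auto
      then have "rat_mat L * Y\<^sup>T = 1\<^sub>m r" using Y by simp
      then show ?thesis unfolding R_def
        by (intro range_space_sandwich[OF cK M detM cL, of "Y\<^sup>T"]) (use Y in auto)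
    qed
    have rL: "range_space R\<^sup>T = range_space (rat_mat L\<^sup>T)"
    proof -
      have "R\<^sup>T = (rat_mat L)\<^sup>T * (rat_mat K * M)\<^sup>T"
        unfolding R_def by (rule transpose_mult) (use cK M cL in auto)
      also have "(rat_mat K * M)\<^sup>T = M\<^sup>T * (rat_mat K)\<^sup>T"
        by (rule transpose_mult) (use cK M in auto)
      also have "(rat_mat L)\<^sup>T * (M\<^sup>T * (rat_mat K)\<^sup>T) = (rat_mat L)\<^sup>T * M\<^sup>T * (rat_mat K)\<^sup>T"
        by (rule assoc_mult_mat[symmetric]) (use cK M cL in auto)
      finally have RT: "R\<^sup>T = (rat_mat L)\<^sup>T * M\<^sup>T * (rat_mat K)\<^sup>T" .
      have "(rat_mat K)\<^sup>T * X\<^sup>T = (X * rat_mat K)\<^sup>T"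
        using cK X by (subst transpose_mult[of _ r m _ r]) auto
      then have "(rat_mat K)\<^sup>T * X\<^sup>T = 1\<^sub>m r" using X by simp
      moreover have "det M\<^sup>T \<noteq> 0" using det_transpose[OF M] detM by simp
      ultimately show ?thesis unfolding RT ratLT
        by (intro range_space_sandwich[of _ n r _ _ m "X\<^sup>T"]) (use cK cL M X in auto)
    qed
    have rank: "vec_space.rank m R = r"
      using rank_eq_range_space[OF R cK rK] rank_minimal_basis_mat[OF K] by simp
    have "invariant_rational_functions R eps psi"
      unfolding invariant_rational_functions_iff[OF R rank fractions(1,2) rm] f_def[symmetric]
      using fractions(3) poly_fracts.equivalent_trans[OF poly_fracts.equivalent_sym[OF eqR(1)] padM] by blast
    moreover have "invariant_orders_at_infinity R q"
      unfolding invariant_orders_at_infinity_iff[OF R rank orders(1) rm]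
      using orders(2) proper_fracts.equivalent_trans[OF proper_fracts.equivalent_sym[OF eqR(2)]
        proper_fracts.equivalent_pad[OF scale_mat_carrier[OF M] infM rm]] by blast
    ultimately show "\<exists>R \<in> carrier_mat m n. vec_space.rank m R = r \<and>
           invariant_rational_functions R eps psi \<and> invariant_orders_at_infinity R q \<and>
           range_space R = range_space (rat_mat K) \<and> range_space R\<^sup>T = range_space (rat_mat L\<^sup>T)"
      using R rank rK rL by blast
  qed
qed

end
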